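(* Let $k$ be a commutative ring, $S=k[x_1,\ldots,x_n]$, $\prec$ a monomial order, let $\Delta$ and $\Pi$ be standard sets in $\mathbb{N}^n$ of the same finite size $d\ge1$, and let $\Delta\subset N$ and $\Pi\subset M$ with $N,M\subset\mathbb{N}^n$ standard sets. With the matrices $T,U,T^\Box,U^\Box$ as in the context, the intersection ${\rm Hilb}^{\prec\Delta}_{S/k}\cap{\rm Hilb}^{\Pi}_{S/k}$ is the locally closed subscheme of ${\rm Hilb}^{\Pi}_{S/k}$ in which - $U^{\Box}$ is the inverse of $T^{\Box}$, and - $T$ is a lower triangular matrix w.r.t. $\prec$. Explicitly: it is the closed subscheme, defined by the equations $T_{\alpha,\beta}=0$ for all $\alpha\in P\cup P^{(1)}$, $\beta\in\Delta$ with $\alpha\prec\beta$, of the open subscheme of ${\rm Hilb}^\Pi_{S/k}$ on which $U^\Box$ is invertible, where on that open subscheme $T=U\cdot(U^\Box)^{-1}$ and $T^\Box=(U^\Box)^{-1}$.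
   Context: All rings are commutative with $1$; $x^\alpha=x_1^{\alpha_1}\cdots x_n^{\alpha_n}$ for $\alpha\in\mathbb{N}^n$, $B[x]=B[x_1,\ldots,x_n]$; $\prec$ also denotes the induced order on exponents; $e_i$ is the $i$-th standard basis vector. A standard set is a subset $P\subset\mathbb{N}^n$ with $(\mathbb{N}^n-P)+\mathbb{N}^n\subset\mathbb{N}^n-P$; its border is $\mathscr{B}(P)=P^{(1)}=\bigcup_{i}(P+e_i)-P$. ${\rm Hilb}^d_{S/k}$ is the $k$-scheme representing the functor sending a $k$-algebra $B$ to the set of ideals $I\subset B[x]$ with $B[x]/I$ locally free of rank $d$. For a standard set $\Delta$ of size $d$, ${\rm Hilb}^\Delta_{S/k}$ is its (affine) open subscheme representing the subfunctor of those $I$ for which $(x^\beta+I)_{\beta\in\Delta}$ is a $B$-basis of $B[x]/I$, and ${\rm Hilb}^{\prec\Delta}_{S/k}$ is the closed subscheme of ${\rm Hilb}^\Delta_{S/k}$ representing the subfunctor of monic ideals with attached standard set $\Delta$ (one-element set for $B=0$ by convention). Here the standard set attached to $I$ is the complement in $\mathbb{N}^n$ of the set of leading exponents of nonzero elements of $I$, and $I$ is monic if for each $x^\alpha$ the ideal of $B$ consisting of $0$ and all leading coefficients of those $f\in I-\{0\}$ with leading exponent $\alpha$ is the zero or the unit ideal. Put $P=N\cup M$, a standard set containing $\Delta$ and $\Pi$. Let $T=(T_{\alpha,\beta})_{\alpha\in P\cup P^{(1)},\beta\in\Delta}$ be the matrix of regular functions on ${\rm Hilb}^\Delta_{S/k}$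 characterized by $x^\alpha\equiv\sum_{\beta\in\Delta}T_{\alpha,\beta}x^\beta$ in the universal quotient, and $U=(U_{\alpha,\xi})_{\alpha\in P\cup P^{(1)},\xi\in\Pi}$ the matrix of regular functions on ${\rm Hilb}^\Pi_{S/k}$ characterized by $x^\alpha\equiv\sum_{\xi\in\Pi}U_{\alpha,\xi}x^\xi$. $T^\Box$ is the square submatrix of $T$ with rows indexed by $\Pi$ (columns by $\Delta$); $U^\Box$ is the square submatrix of $U$ with rows indexed by $\Delta$ (columns by $\Pi$). Ordering index sets with $\Delta\cap\Pi$ first, $T^\Box=\begin{pmatrix} E & 0 \\ T_{31} & T_{32} \end{pmatrix}$ and $U^\Box=\begin{pmatrix} E & 0 \\ U_{21} & U_{22} \end{pmatrix}$, $E$ the identity. "$T$ is lower triangular w.r.t. $\prec$" means $T_{\alpha,\beta}=0$ whenever $\alpha\prec\beta$. *)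

theory Defs
  imports
    "HOL-Algebra.Ideal"
    "HOL-Algebra.RingHom"
    "HOL-Algebra.QuotRing"
    "HOL-Combinatorics.Permutations"
    "HOL-Analysis.Finite_Cartesian_Product"
begin

text \<open>
  Rings are carrier-based, since the zero ring has to be allowed and since homomorphisms,
  quotients and localisations between varying rings occur.
\<close>

section \<open>Exponents, standard sets, monomial orders\<close>

type_synonym 'n expo = "nat ^ 'n"

definition standard_set :: "('n::finite) expo set \<Rightarrow> bool" where
  "standard_set P \<longleftrightarrow> (\<forall>\<alpha> \<gamma>. \<alpha> \<notin> P \<longrightarrow> \<alpha> + \<gamma> \<notin> P)"

definition border :: "('n::finite) expo set \<Rightarrow> 'n expo set" where
  "border P = (\<Union>i. (\<lambda>\<alpha>. \<alpha> + axis i 1) ` P) - P"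

definition monomial_order :: "(('n::finite) expo \<Rightarrow> 'n expo \<Rightarrow> bool) \<Rightarrow> bool" where
  "monomial_order prec \<longleftrightarrow>
     irreflp prec \<and> transp prec \<and> totalp prec \<and>
     (\<forall>\<alpha> \<beta> \<gamma>. prec \<alpha> \<beta> \<longrightarrow> prec (\<alpha> + \<gamma>) (\<beta> + \<gamma>)) \<and>
     (\<forall>\<alpha>. \<alpha> \<noteq> 0 \<longrightarrow> prec 0 \<alpha>)"

section \<open>Polynomials in \<open>n\<close> variables over a ring \<open>B\<close>\<close>

text \<open>A polynomial is its coefficient function; multiplication is convolution.\<close>

definition mpoly :: "('b, 'm) ring_scheme \<Rightarrow> (('n::finite) expo \<Rightarrow> 'b) ring" where
  "mpoly B =
     \<lparr> carrier = {f. (\<forall>\<alpha>. f \<alpha> \<in> carrier B) \<and> finite {\<alpha>. f \<alpha> \<noteq> \<zero>\<^bsub>B\<^esub>}},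
       monoid.mult = (\<lambda>f g \<gamma>. \<Oplus>\<^bsub>B\<^esub>p\<in>{p. fst p + snd p = \<gamma>}. f (fst p) \<otimes>\<^bsub>B\<^esub> g (snd p)),
       one = (\<lambda>\<alpha>. if \<alpha> = 0 then \<one>\<^bsub>B\<^esub> else \<zero>\<^bsub>B\<^esub>),
       zero = (\<lambda>\<alpha>. \<zero>\<^bsub>B\<^esub>),
       add = (\<lambda>f g \<alpha>. f \<alpha> \<oplus>\<^bsub>B\<^esub> g \<alpha>) \<rparr>"

definition term_poly :: "('b, 'm) ring_scheme \<Rightarrow> 'b \<Rightarrow> ('n::finite) expo \<Rightarrow> 'n expo \<Rightarrow> 'b" where
  "term_poly B c \<alpha> = (\<lambda>\<gamma>. if \<gamma> = \<alpha> then c else \<zero>\<^bsub>B\<^esub>)"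

definition lincomb ::
    "('b, 'm) ring_scheme \<Rightarrow> ('n::finite) expo set \<Rightarrow> ('n expo \<Rightarrow> 'b) \<Rightarrow> 'n expo \<Rightarrow> 'b" where
  "lincomb B D c = (\<Oplus>\<^bsub>mpoly B\<^esub>\<beta>\<in>D. term_poly B (c \<beta>) \<beta>)"

text \<open>\<open>is_monomial_basis B D I\<close>: the classes \<open>x\<^sup>\<beta> + I\<close>, \<open>\<beta> \<in> D\<close>, form a \<open>B\<close>-basis of \<open>B[x]/I\<close>.\<close>

definition is_monomial_basis ::
    "('b, 'm) ring_scheme \<Rightarrow> ('n::finite) expo set \<Rightarrow> ('n expo \<Rightarrow> 'b) set \<Rightarrow> bool" where
  "is_monomial_basis B D I \<longleftrightarrow>
     (\<forall>q \<in> carrier (mpoly B Quot I).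
        \<exists>!c. c \<in> D \<rightarrow>\<^sub>E carrier B \<and> q = I +>\<^bsub>mpoly B\<^esub> lincomb B D c)"

section \<open>Leading exponents, monic ideals\<close>

definition lead_exp ::
    "(('n::finite) expo \<Rightarrow> 'n expo \<Rightarrow> bool) \<Rightarrow> ('b, 'm) ring_scheme \<Rightarrow> ('n expo \<Rightarrow> 'b) \<Rightarrow> 'n expo" where
  "lead_exp prec B f =
     (THE \<alpha>. f \<alpha> \<noteq> \<zero>\<^bsub>B\<^esub> \<and> (\<forall>\<beta>. f \<beta> \<noteq> \<zero>\<^bsub>B\<^esub> \<longrightarrow> \<beta> = \<alpha> \<or> prec \<beta> \<alpha>))"

definition lead_coeffs ::
    "(('n::finite) expo \<Rightarrow> 'n expo \<Rightarrow> bool) \<Rightarrow> ('b, 'm) ring_scheme \<Rightarrow> ('n expo \<Rightarrow> 'b) set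
      \<Rightarrow> 'n expo \<Rightarrow> 'b set" where
  "lead_coeffs prec B I \<alpha> =
     insert \<zero>\<^bsub>B\<^esub> {f (lead_exp prec B f) | f. f \<in> I - {\<zero>\<^bsub>mpoly B\<^esub>} \<and> lead_exp prec B f = \<alpha>}"

definition monic_ideal ::
    "(('n::finite) expo \<Rightarrow> 'n expo \<Rightarrow> bool) \<Rightarrow> ('b, 'm) ring_scheme \<Rightarrow> ('n expo \<Rightarrow> 'b) set \<Rightarrow> bool" where
  "monic_ideal prec B I \<longleftrightarrow>
     (\<forall>\<alpha>. lead_coeffs prec B I \<alpha> = {\<zero>\<^bsub>B\<^esub>} \<or> lead_coeffs prec B I \<alpha> = carrier B)"

definition attached_set ::
    "(('n::finite) expo \<Rightarrow> 'n expo \<Rightarrow> bool) \<Rightarrow> ('b, 'm) ring_scheme \<Rightarrow> ('n expo \<Rightarrow> 'b) set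
      \<Rightarrow> 'n expo set" where
  "attached_set prec B I = - (lead_exp prec B ` (I - {\<zero>\<^bsub>mpoly B\<^esub>}))"

section \<open>The functors of points\<close>

definition hilb :: "('n::finite) expo set \<Rightarrow> 'b ring \<Rightarrow> ('n expo \<Rightarrow> 'b) set set" where
  "hilb D B = {I. ideal I (mpoly B) \<and> is_monomial_basis B D I}"

text \<open>
  Over the zero ring no polynomial has a leading exponent, so there the value is, by convention,
  the set consisting of the unique ideal.
\<close>

definition hilb_prec ::
    "(('n::finite) expo \<Rightarrow> 'n expo \<Rightarrow> bool) \<Rightarrow> 'n expo set \<Rightarrow> 'b ring \<Rightarrow> ('n expo \<Rightarrow> 'b) set set" where
  "hilb_prec prec D B =
     {I. ideal I (mpoly B) \<and>
         (carrier B = {\<zero>\<^bsub>B\<^esub>} \<or> (monic_ideal prec B I \<and> attached_set prec B I = D))}"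

text \<open>The image of \<open>I \<subseteq> A[x]\<close> under base change along \<open>\<phi> : A \<rightarrow> B\<close>, i.e. \<open>I B[x]\<close>.\<close>

definition base_change ::
    "('b, 'm) ring_scheme \<Rightarrow> ('a \<Rightarrow> 'b) \<Rightarrow> (('n::finite) expo \<Rightarrow> 'a) set \<Rightarrow> ('n expo \<Rightarrow> 'b) set" where
  "base_change B \<phi> I = Idl\<^bsub>mpoly B\<^esub> ((\<lambda>f. \<phi> \<circ> f) ` I)"

definition k_algebra :: "'k ring \<Rightarrow> 'b ring \<Rightarrow> ('k \<Rightarrow> 'b) \<Rightarrow> bool" where
  "k_algebra k B b \<longleftrightarrow> cring B \<and> b \<in> ring_hom k B"

definition k_hom :: "'k ring \<Rightarrow> 'a ring \<Rightarrow> ('k \<Rightarrow> 'a) \<Rightarrow> 'b ring \<Rightarrow> ('k \<Rightarrow> 'b) \<Rightarrow> ('a \<Rightarrow> 'b) set" where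
  "k_hom k A a B b =
     {\<phi> \<in> ring_hom A B \<inter> extensional (carrier A). \<forall>c \<in> carrier k. \<phi> (a c) = b c}"

text \<open>
  \<open>represents k A a \<I> F\<close>: \<open>Spec A\<close> represents the functor \<open>F\<close> on \<open>k\<close>-algebras, with universal
  element \<open>\<I>\<close>.  The \<open>k\<close>-algebras range over those carried by subsets of one type, which plays
  the role of the universe.
\<close>

definition represents ::
    "'k ring \<Rightarrow> 'b ring \<Rightarrow> ('k \<Rightarrow> 'b) \<Rightarrow> (('n::finite) expo \<Rightarrow> 'b) set
      \<Rightarrow> ('b ring \<Rightarrow> ('n expo \<Rightarrow> 'b) set set) \<Rightarrow> bool" where
  "represents k A a \<I> F \<longleftrightarrow>
     k_algebra k A a \<and> \<I> \<in> F A \<and>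
     (\<forall>B b. k_algebra k B b \<longrightarrow>
        bij_betw (\<lambda>\<phi>. base_change B \<phi> \<I>) (k_hom k A a B b) (F B))"

section \<open>Principal open and closed subschemes of affine schemes\<close>

text \<open>\<open>\<iota> : A \<rightarrow> L\<close> is a localisation at the powers of \<open>f\<close>, i.e. \<open>Spec L\<close> is the open subscheme
  \<open>D(f)\<close> of \<open>Spec A\<close>.\<close>

definition localization_away :: "'a ring \<Rightarrow> 'a \<Rightarrow> 'b ring \<Rightarrow> ('a \<Rightarrow> 'b) \<Rightarrow> bool" where
  "localization_away A f L \<iota> \<longleftrightarrow>
     cring L \<and> \<iota> \<in> ring_hom A L \<and> f \<in> carrier A \<and> \<iota> f \<in> Units L \<and>
     (\<forall>y \<in> carrier L. \<exists>x \<in> carrier A. \<exists>m::nat. y \<otimes>\<^bsub>L\<^esub> (\<iota> f [^]\<^bsub>L\<^esub> m) = \<iota> x) \<and>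
     (\<forall>x \<in> carrier A. \<iota> x = \<zero>\<^bsub>L\<^esub> \<longrightarrow> (\<exists>m::nat. (f [^]\<^bsub>A\<^esub> m) \<otimes>\<^bsub>A\<^esub> x = \<zero>\<^bsub>A\<^esub>))"

text \<open>\<open>\<pi> : L \<rightarrow> C\<close> is a quotient by the ideal generated by \<open>E\<close>, i.e. \<open>Spec C\<close> is the closed
  subscheme of \<open>Spec L\<close> defined by the equations \<open>e = 0\<close>, \<open>e \<in> E\<close>.\<close>

definition quotient_by :: "'a ring \<Rightarrow> 'a set \<Rightarrow> 'b ring \<Rightarrow> ('a \<Rightarrow> 'b) \<Rightarrow> bool" where
  "quotient_by L E C \<pi> \<longleftrightarrow>
     cring C \<and> \<pi> \<in> ring_hom L C \<and> \<pi> ` carrier L = carrier C \<and> E \<subseteq> carrier L \<and>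
     a_kernel L C \<pi> = Idl\<^bsub>L\<^esub> E"

section \<open>Matrices with arbitrary index sets\<close>

text \<open>An \<open>R \<times> C\<close>-matrix over \<open>B\<close> is an element of \<open>R \<times> C \<rightarrow>\<^sub>E carrier B\<close>.\<close>

definition submat :: "'i set \<Rightarrow> 'j set \<Rightarrow> ('i \<times> 'j \<Rightarrow> 'b) \<Rightarrow> 'i \<times> 'j \<Rightarrow> 'b" where
  "submat R C X = restrict X (R \<times> C)"

definition mat_mult ::
    "('b, 'm) ring_scheme \<Rightarrow> 'i set \<Rightarrow> 'q set \<Rightarrow> 'j set
      \<Rightarrow> ('i \<times> 'q \<Rightarrow> 'b) \<Rightarrow> ('q \<times> 'j \<Rightarrow> 'b) \<Rightarrow> 'i \<times> 'j \<Rightarrow> 'b" where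
  "mat_mult B R Q C X Y =
     (\<lambda>ij \<in> R \<times> C. \<Oplus>\<^bsub>B\<^esub>q\<in>Q. X (fst ij, q) \<otimes>\<^bsub>B\<^esub> Y (q, snd ij))"

definition mat_one :: "('b, 'm) ring_scheme \<Rightarrow> 'i set \<Rightarrow> 'i \<times> 'i \<Rightarrow> 'b" where
  "mat_one B R = (\<lambda>ij \<in> R \<times> R. if fst ij = snd ij then \<one>\<^bsub>B\<^esub> else \<zero>\<^bsub>B\<^esub>)"

definition is_mat_inv ::
    "('b, 'm) ring_scheme \<Rightarrow> 'i set \<Rightarrow> 'j set \<Rightarrow> ('i \<times> 'j \<Rightarrow> 'b) \<Rightarrow> ('j \<times> 'i \<Rightarrow> 'b) \<Rightarrow> bool" where
  "is_mat_inv B R C X Y \<longleftrightarrow>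
     X \<in> R \<times> C \<rightarrow>\<^sub>E carrier B \<and> Y \<in> C \<times> R \<rightarrow>\<^sub>E carrier B \<and>
     mat_mult B R C R X Y = mat_one B R \<and> mat_mult B C R C Y X = mat_one B C"

definition mat_invertible ::
    "('b, 'm) ring_scheme \<Rightarrow> 'i set \<Rightarrow> 'j set \<Rightarrow> ('i \<times> 'j \<Rightarrow> 'b) \<Rightarrow> bool" where
  "mat_invertible B R C X \<longleftrightarrow> (\<exists>Y. is_mat_inv B R C X Y)"

definition mat_inv ::
    "('b, 'm) ring_scheme \<Rightarrow> 'i set \<Rightarrow> 'j set \<Rightarrow> ('i \<times> 'j \<Rightarrow> 'b) \<Rightarrow> 'j \<times> 'i \<Rightarrow> 'b" where
  "mat_inv B R C X = (THE Y. is_mat_inv B R C X Y)"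

text \<open>Leibniz determinant of an \<open>R \<times> C\<close>-matrix, columns being matched with rows by a bijection
  \<open>\<sigma> : R \<rightarrow> C\<close>; changing \<open>\<sigma>\<close> changes it at most by a sign.\<close>

definition mat_det ::
    "('b, 'm) ring_scheme \<Rightarrow> 'i set \<Rightarrow> ('i \<Rightarrow> 'j) \<Rightarrow> ('i \<times> 'j \<Rightarrow> 'b) \<Rightarrow> 'b" where
  "mat_det B R \<sigma> X =
     (\<Oplus>\<^bsub>B\<^esub>p\<in>{p. p permutes R}.
        (if evenperm p then \<one>\<^bsub>B\<^esub> else \<ominus>\<^bsub>B\<^esub> \<one>\<^bsub>B\<^esub>) \<otimes>\<^bsub>B\<^esub> (\<Otimes>\<^bsub>B\<^esub>i\<in>R. X (i, \<sigma> (p i))))"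

definition lower_triangular ::
    "('i \<Rightarrow> 'i \<Rightarrow> bool) \<Rightarrow> ('b, 'm) ring_scheme \<Rightarrow> 'i set \<Rightarrow> 'i set \<Rightarrow> ('i \<times> 'i \<Rightarrow> 'b) \<Rightarrow> bool" where
  "lower_triangular prec B R C X \<longleftrightarrow>
     (\<forall>\<alpha> \<in> R. \<forall>\<beta> \<in> C. prec \<alpha> \<beta> \<longrightarrow> X (\<alpha>, \<beta>) = \<zero>\<^bsub>B\<^esub>)"

text \<open>
  The matrix with entries \<open>c\<^sub>\<alpha>\<^sub>\<beta>\<close>, \<open>\<alpha> \<in> Q\<close>, \<open>\<beta> \<in> D\<close>, where
  \<open>x\<^sup>\<alpha> \<equiv> \<Sum>\<^sub>\<beta> c\<^sub>\<alpha>\<^sub>\<beta> x\<^sup>\<beta>\<close> modulo \<open>I \<in> hilb D B\<close>: the value at the \<open>B\<close>-point \<open>I\<close> of the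
  matrix of coordinate functions.
\<close>

definition coord_matrix ::
    "'b ring \<Rightarrow> ('n::finite) expo set \<Rightarrow> 'n expo set \<Rightarrow> ('n expo \<Rightarrow> 'b) set
      \<Rightarrow> 'n expo \<times> 'n expo \<Rightarrow> 'b" where
  "coord_matrix B Q D I =
     (\<lambda>ij \<in> Q \<times> D.
        (THE c. c \<in> D \<rightarrow>\<^sub>E carrier B \<and>
           I +>\<^bsub>mpoly B\<^esub> term_poly B \<one>\<^bsub>B\<^esub> (fst ij) = I +>\<^bsub>mpoly B\<^esub> lincomb B D c) (snd ij))"

end

theory Submission
  imports Defs
begin

text \<open>
  A point \<open>I\<close> of the Hilbert scheme with monomial basis \<open>D\<close> is determined by the matrix \<open>X\<close> of
  normal forms of all monomials: \<open>X\<close> is the identity on \<open>D\<close> and \<open>I\<close> is the kernel of \<open>f \<mapsto> f X\<close>.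
  If \<open>X = U\<close> belongs to \<open>\<Xi>\<close> and the square block \<open>U\<^sup>\<box>\<close> is invertible, then \<open>T = U (U\<^sup>\<box>)\<^sup>-\<^sup>1\<close> has the
  same kernel and is the identity on \<open>\<Delta>\<close>, so \<open>\<Delta>\<close> is a basis as well; two bases always give inverse
  blocks.  The recursion \<open>T\<^sub>\<alpha>\<^sub>+\<^sub>e = \<Sum>\<^sub>\<beta> T\<^sub>\<alpha>\<^sub>\<beta> T\<^sub>\<beta>\<^sub>+\<^sub>e\<close> propagates triangularity from \<open>\<Delta>\<close> and its border to all
  exponents, and triangularity everywhere says precisely that \<open>I\<close> is monic with standard set \<open>\<Delta>\<close>.
  Representability follows because the coordinate matrix commutes with base change and a square
  matrix is invertible iff its determinant is a unit.
\<close>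

section \<open>Determinants over carrier-based rings\<close>

text \<open>Membership in \<open>I\<close> is a system of linear equations in the coefficients, one
  per basis element, so polynomials hardly ever have to be multiplied: the ideal property enters
  through the recurrence obtained by multiplying with a monomial. Since \<open>base_change\<close>
  is defined as a generated ideal, its elements are recognised by the same equations, which carry
  over along ring homomorphisms. No ring representing the \<Delta>-points is postulated: the
  universal \<Xi>-point becomes a \<Delta>-point over the localisation \<open>L\<close>, where the
  square block is invertible, and \<open>T\<close> is read off there. The coefficient rings are
  arbitrary, so a one-sided inverse cannot be made two-sided by a dimension count; determinants do
  this. The rows of a square block lie in one of the sets \<Delta>, \<Xi> and its columns in the
  other, hence determinants are first treated on a single index set and then moved along a
  bijection. The zero ring is a legitimate test ring without leading exponents, so arguments with
  leading terms assume \<open>\<one> \<noteq> \<zero>\<close> and the zero ring is handled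
  apart.\<close>

lemma (in comm_monoid) finprod_swap:
  assumes "finite A" "finite C" "\<And>x y. x \<in> A \<Longrightarrow> y \<in> C \<Longrightarrow> f x y \<in> carrier G"
  shows "(\<Otimes>x\<in>A. \<Otimes>y\<in>C. f x y) = (\<Otimes>y\<in>C. \<Otimes>x\<in>A. f x y)"
  using assms(1,3)
proof (induction A rule: finite_induct)
  case empty
  then show ?case by simp
next
  case (insert a A)
  have "(\<Otimes>x\<in>insert a A. \<Otimes>y\<in>C. f x y) = (\<Otimes>y\<in>C. f a y) \<otimes> (\<Otimes>y\<in>C. \<Otimes>x\<in>A. f x y)"
    using insert by (subst finprod_insert) (auto intro!: finprod_closed)
  also have "\<dots> = (\<Otimes>y\<in>C. f a y \<otimes> (\<Otimes>x\<in>A. f x y))"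
    using insert by (subst finprod_multf) (auto intro!: finprod_closed)
  also have "\<dots> = (\<Otimes>y\<in>C. \<Otimes>x\<in>insert a A. f x y)"
    using insert by (intro finprod_cong') (auto intro!: finprod_closed)
  finally show ?case .
qed

lemma (in comm_monoid) finprod_single:
  assumes "finite A" "i \<in> A" "f i \<in> carrier G" "\<And>j. j \<in> A \<Longrightarrow> j \<noteq> i \<Longrightarrow> f j = \<one>"
  shows "finprod G f A = f i"
proof -
  have "finprod G f (insert i (A - {i})) = f i \<otimes> finprod G f (A - {i})"
    using assms by (intro finprod_insert) (auto simp: Pi_def)
  also have "finprod G f (A - {i}) = \<one>"
    using assms by (intro finprod_one_eqI) auto
  finally show ?thesis using assms by (simp add: insert_absorb)
qed

lemma (in comm_monoid) finprod_Times:
  assumes "finite A" "finite C" "f \<in> A \<times> C \<rightarrow> carrier G"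
  shows "finprod G f (A \<times> C) = (\<Otimes>x\<in>A. \<Otimes>y\<in>C. f (x, y))"
  using assms(1,3)
proof (induction A rule: finite_induct)
  case empty
  then show ?case by simp
next
  case (insert a A)
  have eq: "insert a A \<times> C = Pair a ` C \<union> A \<times> C" by auto
  have "finprod G f (insert a A \<times> C) = finprod G f (Pair a ` C) \<otimes> finprod G f (A \<times> C)"
    unfolding eq using insert assms(2) by (intro finprod_Un_disjoint) (auto simp: Pi_def)
  also have "finprod G f (Pair a ` C) = (\<Otimes>y\<in>C. f (a, y))"
    using insert by (intro finprod_reindex) (auto simp: inj_on_def Pi_def)
  also have "finprod G f (A \<times> C) = (\<Otimes>x\<in>A. \<Otimes>y\<in>C. f (x, y))"
    using insert by (auto simp: Pi_def)
  finally show ?case using insert by (subst finprod_insert) (auto simp: Pi_def intro!: finprod_closed)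
qed

text \<open>The three product lemmas above are stated for commutative monoids so that one proof
  serves both the products and the sums of a ring.\<close>

lemmas (in abelian_monoid) finsum_swap = add.finprod_swap
lemmas (in abelian_monoid) finsum_single = add.finprod_single
lemmas (in abelian_monoid) finsum_Times = add.finprod_Times
lemmas (in abelian_monoid) finsum_cong_right = add.finprod_mono_neutral_cong_right

context cring
begin

text \<open>Associativity of the product row times matrix times column. The two index sets are
  independent because one of them will also be the support of a polynomial.\<close>

lemma finsum_mult_assoc:
  assumes "finite A" "finite C" "\<And>x. x \<in> A \<Longrightarrow> f x \<in> carrier R"
    "\<And>x y. x \<in> A \<Longrightarrow> y \<in> C \<Longrightarrow> g x y \<in> carrier R" "\<And>y. y \<in> C \<Longrightarrow> h y \<in> carrier R"
  shows "(\<Oplus>y\<in>C. (\<Oplus>x\<in>A. f x \<otimes> g x y) \<otimes> h y) = (\<Oplus>x\<in>A. f x \<otimes> (\<Oplus>y\<in>C. g x y \<otimes> h y))"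
proof -
  have "(\<Oplus>y\<in>C. (\<Oplus>x\<in>A. f x \<otimes> g x y) \<otimes> h y) = (\<Oplus>y\<in>C. \<Oplus>x\<in>A. f x \<otimes> g x y \<otimes> h y)"
    using assms by (intro finsum_cong' finsum_ldistr) (auto intro!: finsum_closed)
  also have "\<dots> = (\<Oplus>x\<in>A. \<Oplus>y\<in>C. f x \<otimes> g x y \<otimes> h y)"
    using assms by (intro finsum_swap) auto
  also have "\<dots> = (\<Oplus>x\<in>A. f x \<otimes> (\<Oplus>y\<in>C. g x y \<otimes> h y))"
    using assms by (intro finsum_cong') (auto simp: finsum_rdistr m_assoc intro!: finsum_closed finsum_cong')
  finally show ?thesis .
qed

text \<open>This expansion turns the determinant of a product matrix into a sum over all maps,
  permutations or not. In the induction a choice function on \<open>insert a S\<close> is split into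
  its value at \<open>a\<close> and its restriction to \<open>S\<close>.\<close>

lemma finprod_finsum:
  assumes "finite S" "finite C" "\<And>i q. i \<in> S \<Longrightarrow> q \<in> C \<Longrightarrow> g i q \<in> carrier R"
  shows "(\<Otimes>i\<in>S. \<Oplus>q\<in>C. g i q) = (\<Oplus>f\<in>S \<rightarrow>\<^sub>E C. \<Otimes>i\<in>S. g i (f i))"
  using assms(1,3)
proof (induction S rule: finite_induct)
  case empty
  then show ?case by simp
next
  case (insert a S)
  have fin: "finite (S \<rightarrow>\<^sub>E C)" using insert assms(2) by (intro finite_PiE) auto
  have cl: "(\<Otimes>i\<in>S. g i (f i)) \<in> carrier R" if "f \<in> S \<rightarrow>\<^sub>E C" for f
    using insert that by (intro finprod_closed) (auto simp: PiE_def Pi_def)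
  have inj: "inj_on (\<lambda>(y, g). g(a := y)) (C \<times> (S \<rightarrow>\<^sub>E C))"
    using insert(2) by (intro inj_combinator)
  have img: "insert a S \<rightarrow>\<^sub>E C = (\<lambda>(y, g). g(a := y)) ` (C \<times> (S \<rightarrow>\<^sub>E C))"
    by (rule PiE_insert_eq)
  have val: "(\<Otimes>i\<in>insert a S. g i ((f(a := y)) i)) = g a y \<otimes> (\<Otimes>i\<in>S. g i (f i))"
    if "f \<in> S \<rightarrow>\<^sub>E C" "y \<in> C" for f y
  proof -
    have "(\<Otimes>i\<in>insert a S. g i ((f(a := y)) i)) = g a ((f(a := y)) a) \<otimes> (\<Otimes>i\<in>S. g i ((f(a := y)) i))"
      using insert that by (subst finprod_insert) (auto simp: PiE_def Pi_def)
    also have "(\<Otimes>i\<in>S. g i ((f(a := y)) i)) = (\<Otimes>i\<in>S. g i (f i))"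
      using insert that by (intro finprod_cong') (auto simp: PiE_def Pi_def)
    finally show ?thesis by simp
  qed
  have "(\<Oplus>f\<in>insert a S \<rightarrow>\<^sub>E C. \<Otimes>i\<in>insert a S. g i (f i))
      = (\<Oplus>z\<in>C \<times> (S \<rightarrow>\<^sub>E C). \<Otimes>i\<in>insert a S. g i ((case z of (y, g) \<Rightarrow> g(a := y)) i))"
    unfolding img using inj insert
    by (intro finsum_reindex) (auto simp: PiE_def Pi_def split: if_splits intro!: finprod_closed)
  also have "\<dots> = (\<Oplus>z\<in>C \<times> (S \<rightarrow>\<^sub>E C). g a (fst z) \<otimes> (\<Otimes>i\<in>S. g i (snd z i)))"
    using insert cl val by (intro finsum_cong') auto
  also have "\<dots> = (\<Oplus>y\<in>C. \<Oplus>f\<in>S \<rightarrow>\<^sub>E C. g a y \<otimes> (\<Otimes>i\<in>S. g i (f i)))"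
    using insert cl fin assms(2) by (subst finsum_Times) auto
  also have "\<dots> = (\<Oplus>y\<in>C. g a y \<otimes> (\<Oplus>f\<in>S \<rightarrow>\<^sub>E C. \<Otimes>i\<in>S. g i (f i)))"
    using insert cl fin assms(2) by (intro finsum_cong') (auto simp: finsum_rdistr)
  also have "\<dots> = (\<Oplus>y\<in>C. g a y) \<otimes> (\<Oplus>f\<in>S \<rightarrow>\<^sub>E C. \<Otimes>i\<in>S. g i (f i))"
    using insert cl fin assms(2) by (subst finsum_ldistr) auto
  also have "\<dots> = (\<Otimes>i\<in>insert a S. \<Oplus>q\<in>C. g i q)"
    using insert by (subst finprod_insert) (auto intro!: finsum_closed)
  finally show ?case by simp
qed

section \<open>Leibniz determinants and adjugates on a single index set\<close>

definition perm_sign :: "('i \<Rightarrow> 'i) \<Rightarrow> 'a" where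
  "perm_sign p = (if evenperm p then \<one> else \<ominus> \<one>)"

lemma perm_sign_closed [simp]: "perm_sign p \<in> carrier R"
  by (simp add: perm_sign_def)

lemma perm_sign_comp:
  assumes "permutation p" "permutation q"
  shows "perm_sign (p \<circ> q) = perm_sign p \<otimes> perm_sign q"
  using assms by (auto simp: perm_sign_def evenperm_comp l_minus r_minus)

text \<open>Rows and columns share the set \<open>S\<close>, so permutations can act on both;
  \<open>mat_det\<close> reduces to this case by pulling columns back along \<sigma>.\<close>

definition leibniz :: "'i set \<Rightarrow> ('i \<Rightarrow> 'i \<Rightarrow> 'a) \<Rightarrow> 'a" where
  "leibniz S X = (\<Oplus>p\<in>{p. p permutes S}. perm_sign p \<otimes> (\<Otimes>i\<in>S. X i (p i)))"

lemma leibniz_term_closed: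
  assumes "\<And>i j. i \<in> S \<Longrightarrow> j \<in> S \<Longrightarrow> X i j \<in> carrier R" "p permutes S"
  shows "(\<Otimes>i\<in>S. X i (p i)) \<in> carrier R"
  using assms by (intro finprod_closed) (auto simp: permutes_in_image)

lemma leibniz_closed:
  assumes "\<And>i j. i \<in> S \<Longrightarrow> j \<in> S \<Longrightarrow> X i j \<in> carrier R"
  shows "leibniz S X \<in> carrier R"
  unfolding leibniz_def using assms by (intro finsum_closed) (auto intro!: leibniz_term_closed)

lemma leibniz_cong:
  assumes "\<And>i j. i \<in> S \<Longrightarrow> j \<in> S \<Longrightarrow> Y i j \<in> carrier R"
    "\<And>i j. i \<in> S \<Longrightarrow> j \<in> S \<Longrightarrow> X i j = Y i j"
  shows "leibniz S X = leibniz S Y"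
  unfolding leibniz_def using assms
  by (intro finsum_cong' arg_cong2[where f = "(\<otimes>)"] finprod_cong')
     (auto intro!: leibniz_term_closed simp: permutes_in_image)

text \<open>Substituting \<open>p \<circ> f\<close> for \<open>p\<close> in the outer sum makes row
  and column index both depend on \<open>f i\<close>; reindexing each product along \<open>f\<close>
  removes \<open>f\<close> again, and what remains is its sign.\<close>

lemma leibniz_permute_rows:
  assumes S: "finite S" and X: "\<And>i j. i \<in> S \<Longrightarrow> j \<in> S \<Longrightarrow> X i j \<in> carrier R"
    and f: "f permutes S"
  shows "leibniz S (\<lambda>i. X (f i)) = perm_sign f \<otimes> leibniz S X"
proof -
  have TX: "(\<Otimes>i\<in>S. X i (p i)) \<in> carrier R" if "p permutes S" for p
    using that X by (intro leibniz_term_closed)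
  have fin: "finite {p. p permutes S}" using S by (rule finite_permutations)
  have reidx: "(\<Otimes>i\<in>S. X (f i) (p (f i))) = (\<Otimes>i\<in>S. X i (p i))" if "p permutes S" for p
  proof -
    have "(\<Otimes>i\<in>f ` S. X i (p i)) = (\<Otimes>i\<in>S. X (f i) (p (f i)))"
      using f that X permutes_inj_on[OF f]
      by (intro finprod_reindex) (auto simp: permutes_in_image)
    then show ?thesis using permutes_image[OF f] by simp
  qed
  have bij: "{p. p permutes S} = (\<lambda>p. p \<circ> f) ` {p. p permutes S}"
  proof (intro equalityI subsetI)
    fix p assume "p \<in> {p. p permutes S}"
    then have "p \<circ> inv_into UNIV f permutes S" "p = (p \<circ> inv_into UNIV f) \<circ> f"
      using f by (auto simp: permutes_compose permutes_inv comp_assoc permutes_inv_o)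
    then show "p \<in> (\<lambda>p. p \<circ> f) ` {p. p permutes S}" by blast
  qed (use f in \<open>auto simp: permutes_compose\<close>)
  have inj: "inj_on (\<lambda>p. p \<circ> f) {p. p permutes S}"
    using permutes_surj[OF f] by (auto simp: inj_on_def fun_eq_iff surj_def) metis
  have "leibniz S (\<lambda>i. X (f i)) = (\<Oplus>p\<in>(\<lambda>p. p \<circ> f) ` {p. p permutes S}.
      perm_sign p \<otimes> (\<Otimes>i\<in>S. X (f i) (p i)))"
    unfolding leibniz_def bij[symmetric] ..
  also have "\<dots> = (\<Oplus>p\<in>{p. p permutes S}. perm_sign (p \<circ> f) \<otimes> (\<Otimes>i\<in>S. X (f i) ((p \<circ> f) i)))"
    using inj f X by (intro finsum_reindex)
      (auto intro!: finprod_closed simp: permutes_in_image permutes_compose)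
  also have "\<dots> = (\<Oplus>p\<in>{p. p permutes S}. perm_sign f \<otimes> (perm_sign p \<otimes> (\<Otimes>i\<in>S. X i (p i))))"
  proof (intro finsum_cong')
    fix p assume "p \<in> {p. p permutes S}"
    then have p: "p permutes S" by simp
    have "permutation p" "permutation f" using p f S permutation_permutes by blast+
    then show "perm_sign (p \<circ> f) \<otimes> (\<Otimes>i\<in>S. X (f i) ((p \<circ> f) i)) =
        perm_sign f \<otimes> (perm_sign p \<otimes> (\<Otimes>i\<in>S. X i (p i)))"
      using p reidx[OF p] TX[OF p]
      by (simp add: perm_sign_comp m_ac)
  qed (use TX in auto)
  also have "\<dots> = perm_sign f \<otimes> leibniz S X"
    unfolding leibniz_def using fin X
    by (intro finsum_rdistr[symmetric]) (auto intro!: TX)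
  finally show ?thesis .
qed

text \<open>The sign-reversing involution \<open>p \<mapsto> p \<circ> (i j)\<close> matches the even with the odd permutations;
  in characteristic 2 an antisymmetry argument would not suffice.\<close>

lemma leibniz_equal_rows:
  assumes S: "finite S" and X: "\<And>i j. i \<in> S \<Longrightarrow> j \<in> S \<Longrightarrow> X i j \<in> carrier R"
    and ij: "i \<in> S" "j \<in> S" "i \<noteq> j" and eq: "\<And>l. l \<in> S \<Longrightarrow> X i l = X j l"
  shows "leibniz S X = \<zero>"
proof -
  have TX: "(\<Otimes>i\<in>S. X i (p i)) \<in> carrier R" if "p permutes S" for p
    using that X by (intro leibniz_term_closed)
  define t where "t = Transposition.transpose i j"
  define E where "E = {p. p permutes S \<and> evenperm p}"
  define D where "D = {p. p permutes S \<and> \<not> evenperm p}"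
  have t: "t permutes S" using ij by (simp add: t_def permutes_swap_id)
  have tt: "t \<circ> t = id" by (simp add: t_def)
  have Xt: "X (t k) l = X k l" if "k \<in> S" "l \<in> S" for k l
    unfolding t_def using eq[OF that(2)] by (cases "k = i"; cases "k = j") simp_all
  have fin: "finite E" "finite D"
    using finite_permutations[OF S] by (auto simp: E_def D_def)
  have ED: "{p. p permutes S} = E \<union> D" "E \<inter> D = {}" by (auto simp: E_def D_def)
  have perm: "permutation p" if "p permutes S" for p using that S permutation_permutes by blast
  have even: "evenperm (p \<circ> t) \<longleftrightarrow> \<not> evenperm p" if "p permutes S" for p
    using that ij evenperm_comp[OF perm perm[OF t], of p] by (simp add: t_def evenperm_swap)
  have DE: "D = (\<lambda>p. p \<circ> t) ` E"
  proof (intro equalityI subsetI)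
    fix p assume p: "p \<in> D"
    then have "p \<circ> t \<in> E" using even[of p] t by (auto simp: E_def D_def permutes_compose)
    moreover have "p = (p \<circ> t) \<circ> t" by (simp add: comp_assoc tt)
    ultimately show "p \<in> (\<lambda>p. p \<circ> t) ` E" by blast
  qed (use even t in \<open>auto simp: E_def D_def permutes_compose\<close>)
  have inj: "inj_on (\<lambda>p. p \<circ> t) E"
    using permutes_surj[OF t] by (auto simp: inj_on_def fun_eq_iff surj_def) metis
  have term_t: "(\<Otimes>k\<in>S. X k ((p \<circ> t) k)) = (\<Otimes>k\<in>S. X k (p k))" if p: "p permutes S" for p
  proof -
    have "(\<Otimes>k\<in>S. X k ((p \<circ> t) k)) = (\<Otimes>k\<in>t ` S. X k ((p \<circ> t) k))"
      using permutes_image[OF t] by simp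
    also have "\<dots> = (\<Otimes>k\<in>S. X (t k) ((p \<circ> t) (t k)))"
      using X p t permutes_inj_on[OF t]
      by (intro finprod_reindex) (auto simp: permutes_in_image)
    also have "\<dots> = (\<Otimes>k\<in>S. X k (p k))"
    proof (intro finprod_cong')
      fix k assume k: "k \<in> S"
      have "(p \<circ> t) (t k) = p k" using tt by (simp add: fun_eq_iff)
      then show "X (t k) ((p \<circ> t) (t k)) = X k (p k)" using k p by (simp add: Xt permutes_in_image)
    qed (use X p in \<open>auto simp: permutes_in_image\<close>)
    finally show ?thesis .
  qed
  define s where "s = (\<Oplus>p\<in>E. \<Otimes>k\<in>S. X k (p k))"
  have s: "s \<in> carrier R"
    unfolding s_def using TX by (intro finsum_closed) (auto simp: E_def)
  have cl: "perm_sign p \<otimes> (\<Otimes>k\<in>S. X k (p k)) \<in> carrier R" if "p permutes S" for p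
    using TX[OF that] by simp
  have "leibniz S X = (\<Oplus>p\<in>E. perm_sign p \<otimes> (\<Otimes>k\<in>S. X k (p k))) \<oplus>
      (\<Oplus>p\<in>D. perm_sign p \<otimes> (\<Otimes>k\<in>S. X k (p k)))"
    unfolding leibniz_def ED(1) using cl
    by (intro finsum_Un_disjoint[OF fin ED(2)]) (auto simp: E_def D_def)
  also have "(\<Oplus>p\<in>E. perm_sign p \<otimes> (\<Otimes>k\<in>S. X k (p k))) = s"
    unfolding s_def using TX
    by (intro finsum_cong') (auto simp: E_def perm_sign_def)
  also have "(\<Oplus>p\<in>D. perm_sign p \<otimes> (\<Otimes>k\<in>S. X k (p k))) =
      (\<Oplus>p\<in>E. perm_sign (p \<circ> t) \<otimes> (\<Otimes>k\<in>S. X k ((p \<circ> t) k)))"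
  proof -
    have "p permutes S" if "p \<in> (\<lambda>p. p \<circ> t) ` E" for p
      using that unfolding DE[symmetric] D_def by simp
    then show ?thesis unfolding DE using inj cl by (intro finsum_reindex) blast+
  qed
  also have "\<dots> = (\<Oplus>p\<in>E. (\<ominus> \<one>) \<otimes> (\<Otimes>k\<in>S. X k (p k)))"
    using TX term_t even
    by (intro finsum_cong') (auto simp: E_def perm_sign_def)
  also have "\<dots> = (\<ominus> \<one>) \<otimes> s"
    unfolding s_def using fin TX
    by (intro finsum_rdistr[symmetric]) (auto simp: E_def)
  finally show ?thesis using s by (simp add: l_minus r_neg)
qed

text \<open>After each product of sums is multiplied out and the two outer sums are exchanged, a map
  \<open>f\<close> contributes a product of entries of \<open>X\<close> times the determinant of
  \<open>Y\<close> with rows selected by \<open>f\<close>. A map that is not injective repeats a row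
  and contributes nothing; a permutation contributes its sign times the determinant of
  \<open>Y\<close>.\<close>

lemma leibniz_mult:
  assumes S: "finite S" and X: "\<And>i j. i \<in> S \<Longrightarrow> j \<in> S \<Longrightarrow> X i j \<in> carrier R"
    and Y: "\<And>i j. i \<in> S \<Longrightarrow> j \<in> S \<Longrightarrow> Y i j \<in> carrier R"
  shows "leibniz S (\<lambda>i j. \<Oplus>q\<in>S. X i q \<otimes> Y q j) = leibniz S X \<otimes> leibniz S Y"
proof -
  have TX: "(\<Otimes>i\<in>S. X i (p i)) \<in> carrier R" if "p permutes S" for p
    using that X by (intro leibniz_term_closed)
  have LX: "leibniz S X \<in> carrier R" and LY: "leibniz S Y \<in> carrier R"
    using X Y by (auto intro!: leibniz_closed)
  let ?P = "{p. p permutes S}"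
  have finP: "finite ?P" using S by (rule finite_permutations)
  have finF: "finite (S \<rightarrow>\<^sub>E S)" using S by (intro finite_PiE) auto
  have Xf: "(\<Otimes>i\<in>S. X i (f i)) \<in> carrier R" if "f \<in> S \<rightarrow>\<^sub>E S" for f
    using that X by (intro finprod_closed) (auto simp: PiE_def Pi_def)
  have Yf: "(\<Otimes>i\<in>S. Y (f i) (p i)) \<in> carrier R" if "f \<in> S \<rightarrow>\<^sub>E S" "p \<in> ?P" for f p
    using that Y by (intro finprod_closed) (auto simp: PiE_def Pi_def permutes_in_image)
  have Lf: "leibniz S (\<lambda>i. Y (f i)) \<in> carrier R" if "f \<in> S \<rightarrow>\<^sub>E S" for f
    using that Y by (intro leibniz_closed) (auto simp: PiE_def Pi_def)
  have "leibniz S (\<lambda>i j. \<Oplus>q\<in>S. X i q \<otimes> Y q j) =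
      (\<Oplus>p\<in>?P. perm_sign p \<otimes> (\<Oplus>f\<in>S \<rightarrow>\<^sub>E S. (\<Otimes>i\<in>S. X i (f i)) \<otimes> (\<Otimes>i\<in>S. Y (f i) (p i))))"
    unfolding leibniz_def
  proof (intro finsum_cong' arg_cong2[where f = "(\<otimes>)"])
    fix p assume p: "p \<in> ?P"
    have "(\<Otimes>i\<in>S. \<Oplus>q\<in>S. X i q \<otimes> Y q (p i)) = (\<Oplus>f\<in>S \<rightarrow>\<^sub>E S. \<Otimes>i\<in>S. X i (f i) \<otimes> Y (f i) (p i))"
      using S X Y p by (intro finprod_finsum) (auto simp: permutes_in_image)
    also have "\<dots> = (\<Oplus>f\<in>S \<rightarrow>\<^sub>E S. (\<Otimes>i\<in>S. X i (f i)) \<otimes> (\<Otimes>i\<in>S. Y (f i) (p i)))"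
      using X Y p Xf Yf by (intro finsum_cong' finprod_multf)
        (auto simp: permutes_in_image PiE_def Pi_def)
    finally show "(\<Otimes>i\<in>S. \<Oplus>q\<in>S. X i q \<otimes> Y q (p i)) =
      (\<Oplus>f\<in>S \<rightarrow>\<^sub>E S. (\<Otimes>i\<in>S. X i (f i)) \<otimes> (\<Otimes>i\<in>S. Y (f i) (p i)))" .
  qed (use Xf Yf in \<open>auto intro!: finsum_closed\<close>)
  also have "\<dots> = (\<Oplus>p\<in>?P. \<Oplus>f\<in>S \<rightarrow>\<^sub>E S. (\<Otimes>i\<in>S. X i (f i)) \<otimes> (perm_sign p \<otimes> (\<Otimes>i\<in>S. Y (f i) (p i))))"
    using finF Xf Yf
    by (intro finsum_cong') (auto simp: finsum_rdistr m_lcomm intro!: finsum_closed finsum_cong')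
  also have "\<dots> = (\<Oplus>f\<in>S \<rightarrow>\<^sub>E S. \<Oplus>p\<in>?P. (\<Otimes>i\<in>S. X i (f i)) \<otimes> (perm_sign p \<otimes> (\<Otimes>i\<in>S. Y (f i) (p i))))"
    using finF finP Xf Yf by (intro finsum_swap) auto
  also have "\<dots> = (\<Oplus>f\<in>S \<rightarrow>\<^sub>E S. (\<Otimes>i\<in>S. X i (f i)) \<otimes> leibniz S (\<lambda>i. Y (f i)))"
    unfolding leibniz_def using finP Xf Yf
    by (intro finsum_cong') (auto simp: finsum_rdistr intro!: finsum_closed)
  \<comment> \<open>Choice functions are undefined off \<open>S\<close>, while permutations are the
    identity there, so a permutation occurs in this sum through its restriction.\<close>
  also have "\<dots> = (\<Oplus>f\<in>(\<lambda>p. restrict p S) ` ?P. (\<Otimes>i\<in>S. X i (f i)) \<otimes> leibniz S (\<lambda>i. Y (f i)))"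
  proof (rule finsum_cong_right)
    show "(\<lambda>p. restrict p S) ` ?P \<subseteq> S \<rightarrow>\<^sub>E S" by (auto simp: permutes_in_image)
    fix f assume f: "f \<in> (S \<rightarrow>\<^sub>E S) - (\<lambda>p. restrict p S) ` ?P"
    have "\<not> inj_on f S"
    proof
      assume inj: "inj_on f S"
      have "f ` S = S" using f inj S by (intro endo_inj_surj) auto
      then have "(\<lambda>x. if x \<in> S then f x else x) permutes S"
        using inj by (intro bij_imp_permutes) (auto simp: bij_betw_def inj_on_def)
      moreover have "f = restrict (\<lambda>x. if x \<in> S then f x else x) S"
        using f by (auto simp: fun_eq_iff PiE_def extensional_def)
      ultimately show False using f by blast
    qed
    then obtain i j where "i \<in> S" "j \<in> S" "i \<noteq> j" "f i = f j" by (auto simp: inj_on_def)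
    then have "leibniz S (\<lambda>i. Y (f i)) = \<zero>"
      using f Y S by (intro leibniz_equal_rows[of _ _ i j]) (auto simp: PiE_def Pi_def)
    then show "(\<Otimes>i\<in>S. X i (f i)) \<otimes> leibniz S (\<lambda>i. Y (f i)) = \<zero>"
      using Xf f by simp
  qed (use finF Xf Lf in auto)
  also have "\<dots> = (\<Oplus>p\<in>?P. (\<Otimes>i\<in>S. X i (restrict p S i)) \<otimes> leibniz S (\<lambda>i. Y (restrict p S i)))"
  proof (intro finsum_reindex)
    show "inj_on (\<lambda>p. restrict p S) ?P"
    proof (rule inj_onI)
      fix p q assume pq: "p \<in> ?P" "q \<in> ?P" "restrict p S = restrict q S"
      show "p = q"
      proof
        fix x show "p x = q x"
          using pq permutes_not_in[of p S x] permutes_not_in[of q S x]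
          by (cases "x \<in> S") (auto dest: fun_cong[of _ _ x])
      qed
    qed
    have "(\<lambda>p. restrict p S) ` ?P \<subseteq> S \<rightarrow>\<^sub>E S"
      by (auto simp: permutes_in_image)
    then show "(\<lambda>f. (\<Otimes>i\<in>S. X i (f i)) \<otimes> leibniz S (\<lambda>i. Y (f i))) \<in> (\<lambda>p. restrict p S) ` ?P \<rightarrow> carrier R"
      using Xf Lf by blast
  qed
  also have "\<dots> = (\<Oplus>p\<in>?P. perm_sign p \<otimes> (\<Otimes>i\<in>S. X i (p i)) \<otimes> leibniz S Y)"
  proof (intro finsum_cong')
    fix p assume "p \<in> ?P"
    then have p: "p permutes S" by simp
    have "(\<Otimes>i\<in>S. X i (restrict p S i)) = (\<Otimes>i\<in>S. X i (p i))"
      using X p by (intro finprod_cong') (auto simp: permutes_in_image)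
    moreover have "leibniz S (\<lambda>i. Y (restrict p S i)) = leibniz S (\<lambda>i. Y (p i))"
      using Y p by (intro leibniz_cong) (auto simp: permutes_in_image)
    moreover have L: "leibniz S (\<lambda>i. Y (p i)) = perm_sign p \<otimes> leibniz S Y"
      by (rule leibniz_permute_rows[OF S Y p])
    ultimately show "(\<Otimes>i\<in>S. X i (restrict p S i)) \<otimes> leibniz S (\<lambda>i. Y (restrict p S i)) =
        perm_sign p \<otimes> (\<Otimes>i\<in>S. X i (p i)) \<otimes> leibniz S Y"
      using L TX[OF p] LY
      by (simp add: m_ac del: restrict_apply restrict_apply')
  qed (use TX LY in auto)
  also have "\<dots> = leibniz S X \<otimes> leibniz S Y"
    unfolding leibniz_def[of S X] using finP TX LY
    by (intro finsum_ldistr[symmetric]) auto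
  finally show ?thesis .
qed

lemma leibniz_one:
  fixes S :: "'i set"
  assumes S: "finite S"
  shows "leibniz S (\<lambda>i j. if i = j then \<one> else \<zero>) = \<one>"
proof -
  have "leibniz S (\<lambda>i j. if i = j then \<one> else \<zero>) =
      perm_sign (id :: 'i \<Rightarrow> 'i) \<otimes> (\<Otimes>i\<in>S. if i = id i then \<one> else \<zero>)"
    unfolding leibniz_def
  proof (rule finsum_single[where i = id and f = "\<lambda>p. perm_sign p \<otimes> (\<Otimes>i\<in>S. if i = p i then \<one> else \<zero>)"])
    show "finite {p. p permutes S}" using S by (rule finite_permutations)
    fix p assume p: "p \<in> {p. p permutes S}" "p \<noteq> id"
    then obtain i where i: "i \<in> S" "i \<noteq> p i"
      using permutes_not_in[of p S] by (metis (no_types) eq_id_iff mem_Collect_eq)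
    have "(\<Otimes>i\<in>insert i (S - {i}). if i = p i then \<one> else \<zero>) = \<zero>"
      using S i by (subst finprod_insert) (auto intro!: l_null finprod_closed)
    then show "perm_sign p \<otimes> (\<Otimes>i\<in>S. if i = p i then \<one> else \<zero>) = \<zero>"
      using i by (simp add: insert_absorb)
  qed (auto simp: permutes_id)
  then show ?thesis by (simp add: perm_sign_def)
qed

text \<open>The signed minor, encoded as the part of the Leibniz sum with \<open>p i = j\<close>
  from which the factor in row \<open>i\<close> is removed. No matrix with a deleted row and column
  has to be formed.\<close>

definition cofactor :: "'i set \<Rightarrow> ('i \<Rightarrow> 'i \<Rightarrow> 'a) \<Rightarrow> 'i \<Rightarrow> 'i \<Rightarrow> 'a" where
  "cofactor S X i j =
     (\<Oplus>p\<in>{p. p permutes S}. if p i = j then perm_sign p \<otimes> (\<Otimes>k\<in>S - {i}. X k (p k)) else \<zero>)"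

lemma cofactor_closed:
  assumes "\<And>i j. i \<in> S \<Longrightarrow> j \<in> S \<Longrightarrow> X i j \<in> carrier R"
  shows "cofactor S X i j \<in> carrier R"
  unfolding cofactor_def using assms
  by (intro finsum_closed) (auto simp: permutes_in_image intro!: finprod_closed)

text \<open>Each permutation occurs in exactly one cofactor of row \<open>i\<close>, the one with
  \<open>j = p i\<close>, and \<open>w (p i)\<close> fills the removed factor. The freedom in
  \<open>w\<close> is the point: row \<open>i\<close> itself yields the determinant, another row
  yields a matrix with two equal rows.\<close>

lemma cofactor_expansion:
  assumes S: "finite S" and X: "\<And>i j. i \<in> S \<Longrightarrow> j \<in> S \<Longrightarrow> X i j \<in> carrier R"
    and i: "i \<in> S" and w: "\<And>j. j \<in> S \<Longrightarrow> w j \<in> carrier R"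
  shows "(\<Oplus>j\<in>S. w j \<otimes> cofactor S X i j) = leibniz S (X(i := w))"
proof -
  let ?P = "{p. p permutes S}"
  let ?c = "\<lambda>p. perm_sign p \<otimes> (\<Otimes>k\<in>S - {i}. X k (p k))"
  have fin: "finite ?P" using S by (rule finite_permutations)
  have cl: "(\<Otimes>k\<in>S - {i}. X k (p k)) \<in> carrier R" if "p permutes S" for p
    using that X by (intro finprod_closed) (auto simp: permutes_in_image)
  have "(\<Oplus>j\<in>S. w j \<otimes> cofactor S X i j) = (\<Oplus>j\<in>S. \<Oplus>p\<in>?P. w j \<otimes> (if p i = j then ?c p else \<zero>))"
    unfolding cofactor_def using fin cl w
    by (intro finsum_cong' finsum_rdistr) (auto intro!: finsum_closed)
  also have "\<dots> = (\<Oplus>p\<in>?P. \<Oplus>j\<in>S. w j \<otimes> (if p i = j then ?c p else \<zero>))"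
    using fin cl w S by (intro finsum_swap) auto
  also have "\<dots> = (\<Oplus>p\<in>?P. w (p i) \<otimes> ?c p)"
  proof (intro finsum_cong')
    fix p assume "p \<in> ?P"
    then have p: "p permutes S" by simp
    have "(\<Oplus>j\<in>S. w j \<otimes> (if p i = j then ?c p else \<zero>)) =
        w (p i) \<otimes> (if p i = p i then ?c p else \<zero>)"
      using S p i w cl[OF p] by (intro finsum_single) (auto simp: permutes_in_image)
    then show "(\<Oplus>j\<in>S. w j \<otimes> (if p i = j then ?c p else \<zero>)) = w (p i) \<otimes> ?c p" by simp
  qed (use w cl i in \<open>auto simp: permutes_in_image\<close>)
  also have "\<dots> = leibniz S (X(i := w))"
    unfolding leibniz_def
  proof (intro finsum_cong')
    fix p assume "p \<in> ?P"
    then have p: "p permutes S" by simp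
    have "(\<Otimes>k\<in>insert i (S - {i}). (X(i := w)) k (p k)) =
        w (p i) \<otimes> (\<Otimes>k\<in>S - {i}. (X(i := w)) k (p k))"
      using S i w X p by (subst finprod_insert) (auto simp: permutes_in_image)
    also have "(\<Otimes>k\<in>S - {i}. (X(i := w)) k (p k)) = (\<Otimes>k\<in>S - {i}. X k (p k))"
      using X p by (intro finprod_cong') (auto simp: permutes_in_image)
    finally show "w (p i) \<otimes> ?c p = perm_sign p \<otimes> (\<Otimes>k\<in>S. (X(i := w)) k (p k))"
      using i w p cl[OF p] by (simp add: insert_absorb m_lcomm permutes_in_image)
  next
    show "(\<lambda>p. perm_sign p \<otimes> (\<Otimes>k\<in>S. (X(i := w)) k (p k))) \<in> ?P \<rightarrow> carrier R"
      using w X by (auto intro!: finprod_closed simp: permutes_in_image)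
  qed auto
  finally show ?thesis .
qed

text \<open>The inverse is the adjugate divided by the determinant: pairing row \<open>i\<close>
  with the cofactors of row \<open>j\<close> puts row \<open>i\<close> in place of row
  \<open>j\<close>, which leaves the determinant or creates equal rows.\<close>

lemma leibniz_right_inverse:
  assumes S: "finite S" and X: "\<And>i j. i \<in> S \<Longrightarrow> j \<in> S \<Longrightarrow> X i j \<in> carrier R"
    and u: "leibniz S X \<in> Units R"
  obtains Y where "\<And>i j. Y i j \<in> carrier R"
    "\<And>i j. i \<in> S \<Longrightarrow> j \<in> S \<Longrightarrow> (\<Oplus>q\<in>S. X i q \<otimes> Y q j) = (if i = j then \<one> else \<zero>)"
proof
  let ?v = "inv (leibniz S X)"
  let ?Y = "\<lambda>q j. cofactor S X j q \<otimes> ?v"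
  note C = cofactor_closed[of S X, OF X]
  show "?Y i j \<in> carrier R" for i j using C u by simp
  fix i j assume ij: "i \<in> S" "j \<in> S"
  have "(\<Oplus>q\<in>S. X i q \<otimes> ?Y q j) = (\<Oplus>q\<in>S. X i q \<otimes> cofactor S X j q \<otimes> ?v)"
    using C u X ij by (intro finsum_cong') (auto simp: m_assoc)
  also have "\<dots> = (\<Oplus>q\<in>S. X i q \<otimes> cofactor S X j q) \<otimes> ?v"
    using C u X ij S by (intro finsum_ldistr[symmetric]) auto
  also have "(\<Oplus>q\<in>S. X i q \<otimes> cofactor S X j q) = leibniz S (X(j := X i))"
    using S X ij by (intro cofactor_expansion) auto
  also have "\<dots> = (if i = j then leibniz S X else \<zero>)"
    using S X ij leibniz_equal_rows[of S "X(j := X i)" i j] by auto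
  finally show "(\<Oplus>q\<in>S. X i q \<otimes> ?Y q j) = (if i = j then \<one> else \<zero>)"
    using u by auto
qed

text \<open>The two determinants multiply to \<open>\<one>\<close>. The claim about \<open>Y\<close>
  is what allows \<open>Y\<close> to be given a right inverse of its own in the next lemma.\<close>

lemma leibniz_unit_if_right_inverse:
  assumes S: "finite S" and X: "\<And>i j. i \<in> S \<Longrightarrow> j \<in> S \<Longrightarrow> X i j \<in> carrier R"
    and Y: "\<And>i j. i \<in> S \<Longrightarrow> j \<in> S \<Longrightarrow> Y i j \<in> carrier R"
    and inv: "\<And>i j. i \<in> S \<Longrightarrow> j \<in> S \<Longrightarrow> (\<Oplus>q\<in>S. X i q \<otimes> Y q j) = (if i = j then \<one> else \<zero>)"
  shows "leibniz S X \<in> Units R" "leibniz S Y \<in> Units R"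
proof -
  have "leibniz S X \<otimes> leibniz S Y = leibniz S (\<lambda>i j. \<Oplus>q\<in>S. X i q \<otimes> Y q j)"
    using leibniz_mult[OF S X Y] by simp
  also have "\<dots> = leibniz S (\<lambda>i j. if i = j then \<one> else \<zero>)"
    using inv by (intro leibniz_cong) auto
  finally have 1: "leibniz S X \<otimes> leibniz S Y = \<one>" using leibniz_one[OF S] by simp
  have cl: "leibniz S X \<in> carrier R" "leibniz S Y \<in> carrier R"
    using leibniz_closed X Y by blast+
  have "leibniz S Y \<otimes> leibniz S X = \<one>" using 1 m_comm[OF cl] by simp
  then show "leibniz S X \<in> Units R" "leibniz S Y \<in> Units R"
    using 1 cl unfolding Units_def by blast+
qed

text \<open>The determinant of \<open>Y\<close> is a unit, so \<open>Y\<close> has a right inverse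
  \<open>Z\<close>. Then X = X (Y Z) = (X Y) Z = Z, and therefore Y X = Y Z is the identity.\<close>

lemma right_inverse_imp_left_inverse:
  assumes S: "finite S" and X: "\<And>i j. i \<in> S \<Longrightarrow> j \<in> S \<Longrightarrow> X i j \<in> carrier R"
    and Y: "\<And>i j. i \<in> S \<Longrightarrow> j \<in> S \<Longrightarrow> Y i j \<in> carrier R"
    and inv: "\<And>i j. i \<in> S \<Longrightarrow> j \<in> S \<Longrightarrow> (\<Oplus>q\<in>S. X i q \<otimes> Y q j) = (if i = j then \<one> else \<zero>)"
    and ij: "i \<in> S" "j \<in> S"
  shows "(\<Oplus>q\<in>S. Y i q \<otimes> X q j) = (if i = j then \<one> else \<zero>)"
proof -
  obtain Z where Z: "\<And>i j. Z i j \<in> carrier R"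
    and YZ: "\<And>i j. i \<in> S \<Longrightarrow> j \<in> S \<Longrightarrow> (\<Oplus>q\<in>S. Y i q \<otimes> Z q j) = (if i = j then \<one> else \<zero>)"
    using leibniz_right_inverse[OF S Y leibniz_unit_if_right_inverse(2)[OF S X Y inv]] by metis
  have XZ: "X a c = Z a c" if ac: "a \<in> S" "c \<in> S" for a c
  proof -
    have "X a c = X a c \<otimes> (if c = c then \<one> else \<zero>)" using X ac by simp
    also have "\<dots> = (\<Oplus>q\<in>S. X a q \<otimes> (if q = c then \<one> else \<zero>))"
      using S X ac by (intro finsum_single[symmetric]) auto
    also have "\<dots> = (\<Oplus>q\<in>S. X a q \<otimes> (\<Oplus>r\<in>S. Y q r \<otimes> Z r c))"
      using X ac by (intro finsum_cong') (auto simp: YZ)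
    also have "\<dots> = (\<Oplus>r\<in>S. (\<Oplus>q\<in>S. X a q \<otimes> Y q r) \<otimes> Z r c)"
      using S X Y Z ac by (intro finsum_mult_assoc[symmetric]) auto
    also have "\<dots> = (\<Oplus>r\<in>S. (if a = r then \<one> else \<zero>) \<otimes> Z r c)"
      using Z ac by (intro finsum_cong') (auto simp: inv)
    also have "\<dots> = (if a = a then \<one> else \<zero>) \<otimes> Z a c"
      using S Z ac by (intro finsum_single) auto
    finally show ?thesis using Z by simp
  qed
  have "(\<Oplus>q\<in>S. Y i q \<otimes> X q j) = (\<Oplus>q\<in>S. Y i q \<otimes> Z q j)"
    using Y Z ij XZ by (intro finsum_cong') auto
  then show ?thesis using YZ ij by simp
qed

end

section \<open>Matrices whose row and column sets differ\<close>

lemma mat_det_leibniz: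
  assumes "cring B"
  shows "mat_det B R \<sigma> X = cring.leibniz B R (\<lambda>i j. X (i, \<sigma> j))"
  using assms by (simp add: mat_det_def cring.leibniz_def cring.perm_sign_def)

lemma is_mat_inv_iff:
  assumes "cring B"
  shows "is_mat_inv B R C X Y \<longleftrightarrow>
     X \<in> R \<times> C \<rightarrow>\<^sub>E carrier B \<and> Y \<in> C \<times> R \<rightarrow>\<^sub>E carrier B \<and>
     (\<forall>i\<in>R. \<forall>j\<in>R. (\<Oplus>\<^bsub>B\<^esub>q\<in>C. X (i, q) \<otimes>\<^bsub>B\<^esub> Y (q, j)) = (if i = j then \<one>\<^bsub>B\<^esub> else \<zero>\<^bsub>B\<^esub>)) \<and>
     (\<forall>i\<in>C. \<forall>j\<in>C. (\<Oplus>\<^bsub>B\<^esub>q\<in>R. Y (i, q) \<otimes>\<^bsub>B\<^esub> X (q, j)) = (if i = j then \<one>\<^bsub>B\<^esub> else \<zero>\<^bsub>B\<^esub>))"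
  unfolding is_mat_inv_def mat_mult_def mat_one_def restrict_def fun_eq_iff by auto

lemma is_mat_inv_unique:
  assumes "cring B" "finite R" "finite C" "is_mat_inv B R C X Y" "is_mat_inv B R C X Z"
  shows "Y = Z"
proof -
  interpret cring B by fact
  note Y = assms(4)[unfolded is_mat_inv_iff[OF assms(1)]]
  note Z = assms(5)[unfolded is_mat_inv_iff[OF assms(1)]]
  have X: "X (a, q) \<in> carrier B" if "a \<in> R" "q \<in> C" for a q using Y that by auto
  have Yc: "Y (q, a) \<in> carrier B" if "a \<in> R" "q \<in> C" for a q using Y that by auto
  have Zc: "Z (q, a) \<in> carrier B" if "a \<in> R" "q \<in> C" for a q using Z that by auto
  show ?thesis
  proof (rule PiE_ext)
    show "Y \<in> C \<times> R \<rightarrow>\<^sub>E carrier B" "Z \<in> C \<times> R \<rightarrow>\<^sub>E carrier B" using Y Z by auto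
    fix x assume "x \<in> C \<times> R"
    then obtain c a where x: "x = (c, a)" and ca: "c \<in> C" "a \<in> R" by auto
    have "Y (c, a) = Y (c, a) \<otimes>\<^bsub>B\<^esub> (if a = a then \<one>\<^bsub>B\<^esub> else \<zero>\<^bsub>B\<^esub>)" using Yc ca by simp
    also have "\<dots> = (\<Oplus>\<^bsub>B\<^esub>r\<in>R. Y (c, r) \<otimes>\<^bsub>B\<^esub> (if r = a then \<one>\<^bsub>B\<^esub> else \<zero>\<^bsub>B\<^esub>))"
      using assms Yc ca by (intro finsum_single[symmetric]) auto
    also have "\<dots> = (\<Oplus>\<^bsub>B\<^esub>r\<in>R. Y (c, r) \<otimes>\<^bsub>B\<^esub> (\<Oplus>\<^bsub>B\<^esub>q\<in>C. X (r, q) \<otimes>\<^bsub>B\<^esub> Z (q, a)))"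
      using Yc ca Z by (intro finsum_cong') auto
    also have "\<dots> = (\<Oplus>\<^bsub>B\<^esub>q\<in>C. (\<Oplus>\<^bsub>B\<^esub>r\<in>R. Y (c, r) \<otimes>\<^bsub>B\<^esub> X (r, q)) \<otimes>\<^bsub>B\<^esub> Z (q, a))"
      using assms X Yc Zc ca by (intro finsum_mult_assoc[symmetric]) auto
    also have "\<dots> = (\<Oplus>\<^bsub>B\<^esub>q\<in>C. (if c = q then \<one>\<^bsub>B\<^esub> else \<zero>\<^bsub>B\<^esub>) \<otimes>\<^bsub>B\<^esub> Z (q, a))"
      using Y Zc ca by (intro finsum_cong') auto
    also have "\<dots> = (if c = c then \<one>\<^bsub>B\<^esub> else \<zero>\<^bsub>B\<^esub>) \<otimes>\<^bsub>B\<^esub> Z (c, a)"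
      using assms Zc ca by (intro finsum_single) auto
    finally show "Y x = Z x" using Zc ca x by simp
  qed
qed

lemma mat_inv_eqI:
  assumes "cring B" "finite R" "finite C" "is_mat_inv B R C X Y"
  shows "mat_inv B R C X = Y"
  unfolding mat_inv_def using assms is_mat_inv_unique by blast

lemma mat_inv_is_mat_inv:
  assumes "cring B" "finite R" "finite C" "mat_invertible B R C X"
  shows "is_mat_inv B R C X (mat_inv B R C X)"
  using assms mat_inv_eqI unfolding mat_invertible_def by fastforce

lemma is_mat_inv_sym: "is_mat_inv B R C X Y \<longleftrightarrow> is_mat_inv B C R Y X"
  by (auto simp: is_mat_inv_def)

text \<open>Relabelling columns by \<sigma> leads to a single index set, where the adjugate gives
  one direction and multiplicativity of the determinant the other. The right side does not mention
  \<sigma>, so the open locus defined by the determinant is independent of that choice.\<close>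

lemma mat_det_unit_iff:
  assumes B: "cring B" and R: "finite R" and \<sigma>: "bij_betw \<sigma> R C"
    and X: "X \<in> R \<times> C \<rightarrow>\<^sub>E carrier B"
  shows "mat_det B R \<sigma> X \<in> Units B \<longleftrightarrow> mat_invertible B R C X"
proof -
  interpret cring B by fact
  let ?X = "\<lambda>i j. X (i, \<sigma> j)"
  have C: "C = \<sigma> ` R" and inj: "inj_on \<sigma> R" using \<sigma> by (auto simp: bij_betw_def)
  have Xc: "?X i j \<in> carrier B" if "i \<in> R" "j \<in> R" for i j
    using that X C by auto
  have sum_C: "(\<Oplus>\<^bsub>B\<^esub>q\<in>C. f q) = (\<Oplus>\<^bsub>B\<^esub>q\<in>R. f (\<sigma> q))" if "\<And>q. q \<in> C \<Longrightarrow> f q \<in> carrier B" for f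
    unfolding C using inj that by (intro finsum_reindex) (auto simp: C)
  show ?thesis
  proof
    assume "mat_det B R \<sigma> X \<in> Units B"
    then have u: "leibniz R ?X \<in> Units B" using mat_det_leibniz[OF B, of R \<sigma> X] by simp
    obtain Y where Y: "\<And>i j. Y i j \<in> carrier B"
      and XY: "\<And>i j. i \<in> R \<Longrightarrow> j \<in> R \<Longrightarrow> (\<Oplus>\<^bsub>B\<^esub>q\<in>R. ?X i q \<otimes>\<^bsub>B\<^esub> Y q j) = (if i = j then \<one>\<^bsub>B\<^esub> else \<zero>\<^bsub>B\<^esub>)"
      using leibniz_right_inverse[of R ?X, OF R Xc u] by metis
    have YX: "(\<Oplus>\<^bsub>B\<^esub>q\<in>R. Y i q \<otimes>\<^bsub>B\<^esub> ?X q j) = (if i = j then \<one>\<^bsub>B\<^esub> else \<zero>\<^bsub>B\<^esub>)" if "i \<in> R" "j \<in> R" for i j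
      using right_inverse_imp_left_inverse[of R ?X Y, OF R Xc Y XY that] .
    define Z where "Z = (\<lambda>(c, a)\<in>C \<times> R. Y (inv_into R \<sigma> c) a)"
    have Z: "Z (\<sigma> q, j) = Y q j" if "q \<in> R" "j \<in> R" for q j
      using that inj by (auto simp: Z_def C inv_into_f_f)
    have "is_mat_inv B R C X Z"
      unfolding is_mat_inv_iff[OF B]
    proof (intro conjI ballI)
      show "Z \<in> C \<times> R \<rightarrow>\<^sub>E carrier B" using Y by (auto simp: Z_def)
      fix i j assume ij: "i \<in> R" "j \<in> R"
      have "(\<Oplus>\<^bsub>B\<^esub>q\<in>C. X (i, q) \<otimes>\<^bsub>B\<^esub> Z (q, j)) = (\<Oplus>\<^bsub>B\<^esub>q\<in>R. ?X i q \<otimes>\<^bsub>B\<^esub> Z (\<sigma> q, j))"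
        using ij Xc Y Z by (intro sum_C) (auto simp: C)
      also have "\<dots> = (\<Oplus>\<^bsub>B\<^esub>q\<in>R. ?X i q \<otimes>\<^bsub>B\<^esub> Y q j)"
        using ij Xc Y Z by (intro finsum_cong') auto
      finally show "(\<Oplus>\<^bsub>B\<^esub>q\<in>C. X (i, q) \<otimes>\<^bsub>B\<^esub> Z (q, j)) = (if i = j then \<one>\<^bsub>B\<^esub> else \<zero>\<^bsub>B\<^esub>)"
        using XY ij by simp
    next
      fix i j assume "i \<in> C" "j \<in> C"
      then obtain i' j' where ij: "i = \<sigma> i'" "j = \<sigma> j'" "i' \<in> R" "j' \<in> R" by (auto simp: C)
      have "(\<Oplus>\<^bsub>B\<^esub>q\<in>R. Z (i, q) \<otimes>\<^bsub>B\<^esub> X (q, j)) = (\<Oplus>\<^bsub>B\<^esub>q\<in>R. Y i' q \<otimes>\<^bsub>B\<^esub> ?X q j')"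
        using ij Xc Y Z by (intro finsum_cong') auto
      also have "\<dots> = (if i' = j' then \<one>\<^bsub>B\<^esub> else \<zero>\<^bsub>B\<^esub>)" using YX ij by simp
      finally show "(\<Oplus>\<^bsub>B\<^esub>q\<in>R. Z (i, q) \<otimes>\<^bsub>B\<^esub> X (q, j)) = (if i = j then \<one>\<^bsub>B\<^esub> else \<zero>\<^bsub>B\<^esub>)"
        using ij inj by (auto simp: inj_on_def)
    qed (use X in auto)
    then show "mat_invertible B R C X" by (auto simp: mat_invertible_def)
  next
    assume "mat_invertible B R C X"
    then obtain Z where Z: "is_mat_inv B R C X Z" by (auto simp: mat_invertible_def)
    note Z = this[unfolded is_mat_inv_iff[OF B]]
    have Zc: "Z (\<sigma> i, j) \<in> carrier B" if "i \<in> R" "j \<in> R" for i j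
      using Z that C by auto
    have "(\<Oplus>\<^bsub>B\<^esub>q\<in>R. ?X i q \<otimes>\<^bsub>B\<^esub> Z (\<sigma> q, j)) = (if i = j then \<one>\<^bsub>B\<^esub> else \<zero>\<^bsub>B\<^esub>)"
      if "i \<in> R" "j \<in> R" for i j
    proof -
      have "(\<Oplus>\<^bsub>B\<^esub>q\<in>R. ?X i q \<otimes>\<^bsub>B\<^esub> Z (\<sigma> q, j)) = (\<Oplus>\<^bsub>B\<^esub>q\<in>C. X (i, q) \<otimes>\<^bsub>B\<^esub> Z (q, j))"
        using that Xc Zc by (intro sum_C[symmetric]) (auto simp: C)
      then show ?thesis using Z that by simp
    qed
    then show "mat_det B R \<sigma> X \<in> Units B"
      using leibniz_unit_if_right_inverse(1)[of R ?X "\<lambda>i j. Z (\<sigma> i, j)", OF R Xc Zc]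
      by (simp add: mat_det_leibniz[OF B])
  qed
qed

text \<open>A determinant is an integer polynomial in the entries. This will identify the image in
  \<open>B\<close> of the universal determinant with the determinant at a
  \<open>B\<close>-point.\<close>

lemma (in ring_hom_cring) hom_mat_det:
  assumes "finite I" "bij_betw \<sigma> I C" "X \<in> I \<times> C \<rightarrow> carrier R"
    "\<And>i. i \<in> I \<times> C \<Longrightarrow> Y i = h (X i)"
  shows "h (mat_det R I \<sigma> X) = mat_det S I \<sigma> Y"
proof -
  have X: "X (i, \<sigma> (p i)) \<in> carrier R" "Y (i, \<sigma> (p i)) = h (X (i, \<sigma> (p i)))"
    if "p permutes I" "i \<in> I" for p i
    using that assms by (auto simp: bij_betw_def permutes_in_image)
  have "h (mat_det R I \<sigma> X) = (\<Oplus>\<^bsub>S\<^esub>p\<in>{p. p permutes I}. h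
        ((if evenperm p then \<one> else \<ominus> \<one>) \<otimes> (\<Otimes>i\<in>I. X (i, \<sigma> (p i)))))"
    unfolding mat_det_def using X by (subst hom_finsum) (auto intro!: R.finprod_closed simp: o_def)
  also have "\<dots> = mat_det S I \<sigma> Y"
    unfolding mat_det_def
  proof (intro S.finsum_cong')
    fix p assume "p \<in> {p. p permutes I}"
    then have p: "p permutes I" by simp
    have "h (\<Otimes>i\<in>I. X (i, \<sigma> (p i))) = (\<Otimes>\<^bsub>S\<^esub>i\<in>I. h (X (i, \<sigma> (p i))))"
      using X p by (subst hom_finprod) (auto simp: o_def)
    also have "\<dots> = (\<Otimes>\<^bsub>S\<^esub>i\<in>I. Y (i, \<sigma> (p i)))"
      using X p by (intro S.finprod_cong') auto
    finally show "h ((if evenperm p then \<one> else \<ominus> \<one>) \<otimes> (\<Otimes>i\<in>I. X (i, \<sigma> (p i)))) =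
      (if evenperm p then \<one>\<^bsub>S\<^esub> else \<ominus>\<^bsub>S\<^esub> \<one>\<^bsub>S\<^esub>) \<otimes>\<^bsub>S\<^esub> (\<Otimes>\<^bsub>S\<^esub>i\<in>I. Y (i, \<sigma> (p i)))"
      using X p by (subst hom_mult) (auto intro!: R.finprod_closed)
  qed (use X in \<open>auto intro!: S.finprod_closed\<close>)
  finally show ?thesis .
qed

section \<open>Normal forms modulo an ideal with a monomial basis\<close>

lemma finite_expo_le: "finite {\<alpha> :: ('n::finite) expo. \<forall>i. \<alpha> $ i \<le> \<gamma> $ i}"
proof -
  have "{\<alpha> :: 'n expo. \<forall>i. \<alpha> $ i \<le> \<gamma> $ i} \<subseteq> vec_lambda ` (\<Pi>\<^sub>E i\<in>UNIV. {..\<gamma> $ i})"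
  proof
    fix \<alpha> :: "'n expo" assume "\<alpha> \<in> {\<alpha>. \<forall>i. \<alpha> $ i \<le> \<gamma> $ i}"
    then have "\<alpha> = vec_lambda (\<lambda>i. \<alpha> $ i)" "(\<lambda>i. \<alpha> $ i) \<in> (\<Pi>\<^sub>E i\<in>UNIV. {..\<gamma> $ i})"
      by (auto simp: PiE_def)
    then show "\<alpha> \<in> vec_lambda ` (\<Pi>\<^sub>E i\<in>UNIV. {..\<gamma> $ i})" by blast
  qed
  then show ?thesis
    by (rule finite_subset) (intro finite_imageI finite_PiE, auto)
qed

text \<open>The convolution in \<open>mpoly\<close> sums over this set; a \<open>finsum\<close> over
  an infinite set would silently be zero.\<close>

lemma finite_expo_sums: "finite {p :: ('n::finite) expo \<times> 'n expo. fst p + snd p = \<gamma>}"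
proof -
  have "{p :: 'n expo \<times> 'n expo. fst p + snd p = \<gamma>} \<subseteq>
      {\<alpha>. \<forall>i. \<alpha> $ i \<le> \<gamma> $ i} \<times> {\<alpha>. \<forall>i. \<alpha> $ i \<le> \<gamma> $ i}"
    by auto
  then show ?thesis
    by (rule finite_subset) (intro finite_SigmaI finite_expo_le)
qed

lemma mpoly_simps [simp]:
  "zero (mpoly B) = (\<lambda>\<alpha>. zero B)"
  "add (mpoly B) f g = (\<lambda>\<alpha>. add B (f \<alpha>) (g \<alpha>))"
  by (simp_all add: mpoly_def)

lemma carrier_mpoly:
  "f \<in> carrier (mpoly B) \<longleftrightarrow> (\<forall>\<alpha>. f \<alpha> \<in> carrier B) \<and> finite {\<alpha>. f \<alpha> \<noteq> zero B}"
  by (simp add: mpoly_def)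

lemma (in abelian_group) minus_eq_zero_iff:
  "x \<in> carrier G \<Longrightarrow> y \<in> carrier G \<Longrightarrow> x \<ominus> y = \<zero> \<longleftrightarrow> x = y"
  by (metis a_minus_def add.inv_closed add.inv_solve_right' l_zero zero_closed)

lemma (in abelian_group) eq_minusI:
  assumes "x \<oplus> y = z" "x \<in> carrier G" "y \<in> carrier G"
  shows "x = z \<ominus> y"
  using assms by (auto simp: a_minus_def a_assoc r_neg)

locale coeff_ring = cring B for B :: "'b ring" (structure)
begin

text \<open>The coefficient function of \<open>lincomb B D c\<close>, with no sum to evaluate. The
  two are exchanged by \<open>lincomb_eq\<close>.\<close>

definition lin :: "('n::finite) expo set \<Rightarrow> ('n expo \<Rightarrow> 'b) \<Rightarrow> 'n expo \<Rightarrow> 'b" where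
  "lin D c = (\<lambda>\<gamma>. if \<gamma> \<in> D then c \<gamma> else \<zero>)"

text \<open>The linear extension to B[x] of the assignment sending the monomial with exponent
  \<alpha> to \<open>x \<alpha>\<close>. With a column of a normal-form matrix as \<open>x\<close>,
  it computes one coordinate of the normal form of \<open>f\<close>.\<close>

definition linext :: "(('n::finite) expo \<Rightarrow> 'b) \<Rightarrow> ('n expo \<Rightarrow> 'b) \<Rightarrow> 'b" where
  "linext f x = (\<Oplus>\<alpha>\<in>{\<alpha>. f \<alpha> \<noteq> \<zero>}. f \<alpha> \<otimes> x \<alpha>)"

lemma carrier_mpolyD:
  assumes "f \<in> carrier (mpoly B)"
  shows "f \<alpha> \<in> carrier B" "finite {\<alpha>. f \<alpha> \<noteq> \<zero>}"
  using assms by (auto simp: carrier_mpoly)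

lemma term_poly_carrier: "c \<in> carrier B \<Longrightarrow> term_poly B c \<alpha> \<in> carrier (mpoly B)"
  by (auto simp: carrier_mpoly term_poly_def intro: finite_subset[of _ "{\<alpha>}"])

lemma lin_carrier:
  "finite D \<Longrightarrow> (\<And>\<beta>. \<beta> \<in> D \<Longrightarrow> c \<beta> \<in> carrier B) \<Longrightarrow> lin D c \<in> carrier (mpoly B)"
  by (auto simp: carrier_mpoly lin_def intro: finite_subset[of _ D])

lemma minus_carrier:
  assumes "f \<in> carrier (mpoly B)" "g \<in> carrier (mpoly B)"
  shows "(\<lambda>\<alpha>. f \<alpha> \<ominus> g \<alpha>) \<in> carrier (mpoly B)"
  using assms unfolding carrier_mpoly
  by (auto simp: a_minus_def intro: finite_subset[of _ "{\<alpha>. f \<alpha> \<noteq> \<zero>} \<union> {\<alpha>. g \<alpha> \<noteq> \<zero>}"])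

text \<open>Supports change under addition, shifts and ring homomorphisms; a common finite superset
  lets such sums be compared.\<close>

lemma linext_superset:
  assumes "finite S" "{\<alpha>. f \<alpha> \<noteq> \<zero>} \<subseteq> S" "\<And>\<alpha>. f \<alpha> \<in> carrier B" "\<And>\<alpha>. x \<alpha> \<in> carrier B"
  shows "linext f x = (\<Oplus>\<alpha>\<in>S. f \<alpha> \<otimes> x \<alpha>)"
  unfolding linext_def using assms
  by (intro finsum_cong_right[symmetric]) auto

lemma linext_closed [simp]:
  "(\<And>\<alpha>. f \<alpha> \<in> carrier B) \<Longrightarrow> (\<And>\<alpha>. x \<alpha> \<in> carrier B) \<Longrightarrow> linext f x \<in> carrier B"
  unfolding linext_def by (intro finsum_closed) auto

lemma linext_add:
  assumes f: "f \<in> carrier (mpoly B)" and g: "g \<in> carrier (mpoly B)" and x: "\<And>\<alpha>. x \<alpha> \<in> carrier B"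
  shows "linext (\<lambda>\<alpha>. f \<alpha> \<oplus> g \<alpha>) x = linext f x \<oplus> linext g x"
proof -
  let ?S = "{\<alpha>. f \<alpha> \<noteq> \<zero>} \<union> {\<alpha>. g \<alpha> \<noteq> \<zero>}"
  note [simp] = carrier_mpolyD[OF f] carrier_mpolyD[OF g] x
  have "linext (\<lambda>\<alpha>. f \<alpha> \<oplus> g \<alpha>) x = (\<Oplus>\<alpha>\<in>?S. (f \<alpha> \<oplus> g \<alpha>) \<otimes> x \<alpha>)"
    by (intro linext_superset) auto
  also have "\<dots> = (\<Oplus>\<alpha>\<in>?S. f \<alpha> \<otimes> x \<alpha> \<oplus> g \<alpha> \<otimes> x \<alpha>)"
    by (intro finsum_cong') (auto simp: l_distr)
  also have "\<dots> = (\<Oplus>\<alpha>\<in>?S. f \<alpha> \<otimes> x \<alpha>) \<oplus> (\<Oplus>\<alpha>\<in>?S. g \<alpha> \<otimes> x \<alpha>)"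
    by (intro finsum_addf) auto
  also have "(\<Oplus>\<alpha>\<in>?S. f \<alpha> \<otimes> x \<alpha>) = linext f x" by (intro linext_superset[symmetric]) auto
  also have "(\<Oplus>\<alpha>\<in>?S. g \<alpha> \<otimes> x \<alpha>) = linext g x" by (intro linext_superset[symmetric]) auto
  finally show ?thesis .
qed

lemma linext_minus:
  assumes f: "f \<in> carrier (mpoly B)" and g: "g \<in> carrier (mpoly B)" and x: "\<And>\<alpha>. x \<alpha> \<in> carrier B"
  shows "linext (\<lambda>\<alpha>. f \<alpha> \<ominus> g \<alpha>) x = linext f x \<ominus> linext g x"
proof -
  note fg = carrier_mpolyD[OF f] carrier_mpolyD[OF g]
  have "linext (\<lambda>\<alpha>. f \<alpha> \<ominus> g \<alpha> \<oplus> g \<alpha>) x = linext (\<lambda>\<alpha>. f \<alpha> \<ominus> g \<alpha>) x \<oplus> linext g x"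
    by (intro linext_add minus_carrier f g x)
  moreover have "(\<lambda>\<alpha>. f \<alpha> \<ominus> g \<alpha> \<oplus> g \<alpha>) = f"
    using fg by (auto simp: a_minus_def a_assoc l_neg)
  ultimately show ?thesis
    using linext_closed[of f x] linext_closed[of g x] linext_closed[of "\<lambda>\<alpha>. f \<alpha> \<ominus> g \<alpha>" x] fg x
    by (auto simp: a_minus_def a_assoc r_neg)
qed

lemma linext_term_poly:
  assumes "c \<in> carrier B" "\<And>\<alpha>. x \<alpha> \<in> carrier B"
  shows "linext (term_poly B c \<alpha>) x = c \<otimes> x \<alpha>"
proof -
  have "linext (term_poly B c \<alpha>) x = (\<Oplus>\<gamma>\<in>{\<alpha>}. term_poly B c \<alpha> \<gamma> \<otimes> x \<gamma>)"
    using assms by (intro linext_superset) (auto simp: term_poly_def)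
  then show ?thesis using assms by (simp add: term_poly_def)
qed

lemma linext_lin:
  assumes "finite D" "\<And>\<beta>. \<beta> \<in> D \<Longrightarrow> c \<beta> \<in> carrier B" "\<And>\<alpha>. x \<alpha> \<in> carrier B"
  shows "linext (lin D c) x = (\<Oplus>\<beta>\<in>D. c \<beta> \<otimes> x \<beta>)"
proof -
  have "linext (lin D c) x = (\<Oplus>\<beta>\<in>D. lin D c \<beta> \<otimes> x \<beta>)"
    using assms by (intro linext_superset) (auto simp: lin_def)
  also have "\<dots> = (\<Oplus>\<beta>\<in>D. c \<beta> \<otimes> x \<beta>)"
    using assms by (intro finsum_cong') (auto simp: lin_def)
  finally show ?thesis .
qed

text \<open>Subtraction of exponents is truncated, so \<delta> - \<gamma> is the cofactor of
  \<gamma> in \<delta> only if \<gamma> divides \<delta>, which the existential tests. In that case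
  a single pair survives in the convolution.\<close>

lemma term_poly_mult_apply:
  assumes f: "f \<in> carrier (mpoly B)" and c: "c \<in> carrier B"
  shows "(term_poly B c \<gamma> \<otimes>\<^bsub>mpoly B\<^esub> f) \<delta> = (if \<exists>\<epsilon>. \<delta> = \<gamma> + \<epsilon> then c \<otimes> f (\<delta> - \<gamma>) else \<zero>)"
proof -
  note [simp] = carrier_mpolyD[OF f] c
  have eq: "(term_poly B c \<gamma> \<otimes>\<^bsub>mpoly B\<^esub> f) \<delta> =
      (\<Oplus>p\<in>{p. fst p + snd p = \<delta>}. term_poly B c \<gamma> (fst p) \<otimes> f (snd p))"
    by (simp add: mpoly_def)
  show ?thesis
  proof (cases "\<exists>\<epsilon>. \<delta> = \<gamma> + \<epsilon>")
    case True
    then obtain \<epsilon> where \<epsilon>: "\<delta> = \<gamma> + \<epsilon>" by blast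
    have "(\<Oplus>p\<in>{p. fst p + snd p = \<delta>}. term_poly B c \<gamma> (fst p) \<otimes> f (snd p)) =
        term_poly B c \<gamma> (fst (\<gamma>, \<epsilon>)) \<otimes> f (snd (\<gamma>, \<epsilon>))"
      by (rule finsum_single[where f = "\<lambda>p. term_poly B c \<gamma> (fst p) \<otimes> f (snd p)"])
         (auto simp: finite_expo_sums \<epsilon> term_poly_def)
    then show ?thesis using True eq \<epsilon> by (simp add: term_poly_def)
  next
    case False
    then have "(\<Oplus>p\<in>{p. fst p + snd p = \<delta>}. term_poly B c \<gamma> (fst p) \<otimes> f (snd p)) = \<zero>"
      by (intro add.finprod_one_eqI) (auto simp: term_poly_def)
    then show ?thesis using False eq by simp
  qed
qed

end

section \<open>Ideals of the polynomial ring\<close>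

locale mpoly_ideal = coeff_ring B for B :: "'b ring" (structure) +
  fixes I :: "(('n::finite) expo \<Rightarrow> 'b) set"
  assumes ideal: "ideal I (mpoly B)"
begin

text \<open>That \<open>mpoly B\<close> is a ring never has to be proved: it is part of the predicate \<open>ideal\<close>.\<close>

lemma ring_mpoly: "ring (mpoly B :: ('n expo \<Rightarrow> 'b) ring)"
  using ideal by (rule ideal.axioms(2))

lemma ideal_carrier: "f \<in> I \<Longrightarrow> f \<in> carrier (mpoly B)"
  using ideal by (meson additive_subgroup.a_Hcarr ideal_def)

lemma mpoly_a_inv:
  fixes f :: "'n expo \<Rightarrow> 'b"
  assumes "f \<in> carrier (mpoly B)"
  shows "\<ominus>\<^bsub>mpoly B\<^esub> f = (\<lambda>\<alpha>. \<ominus> f \<alpha>)"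
proof -
  interpret P: ring "mpoly B :: ('n expo \<Rightarrow> 'b) ring" by (rule ring_mpoly)
  note f = carrier_mpolyD[OF assms]
  have "(\<lambda>\<alpha>. \<ominus> f \<alpha>) \<in> carrier (mpoly B)"
    using f by (auto simp: carrier_mpoly intro: finite_subset[OF _ f(2)])
  then show ?thesis
    using f assms by (intro P.minus_equality) (auto simp: l_neg)
qed

lemma mpoly_minus:
  fixes f g :: "'n expo \<Rightarrow> 'b"
  assumes "f \<in> carrier (mpoly B)" "g \<in> carrier (mpoly B)"
  shows "f \<ominus>\<^bsub>mpoly B\<^esub> g = (\<lambda>\<alpha>. f \<alpha> \<ominus> g \<alpha>)"
  using assms by (simp add: a_minus_def mpoly_a_inv)

lemma ideal_zero: "(\<lambda>\<alpha>. \<zero>) \<in> I"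
  using additive_subgroup.zero_closed[OF ideal.axioms(1)[OF ideal]] by simp

lemma ideal_add: "f \<in> I \<Longrightarrow> g \<in> I \<Longrightarrow> (\<lambda>\<alpha>. f \<alpha> \<oplus> g \<alpha>) \<in> I"
  using additive_subgroup.a_closed[OF ideal.axioms(1)[OF ideal], of f g] by simp

text \<open>Multiplication by a term is the product that gets evaluated in what follows: \<gamma> =
  0 gives scaling, and c = \<open>\<one>\<close> gives the shift behind
  \<open>nf_matrix_recurrence\<close>.\<close>

lemma ideal_term_mult:
  assumes "f \<in> I" "c \<in> carrier B"
  shows "(\<lambda>\<delta>. if \<exists>\<epsilon>. \<delta> = \<gamma> + \<epsilon> then c \<otimes> f (\<delta> - \<gamma>) else \<zero>) \<in> I"
proof -
  interpret ideal I "mpoly B" by (rule ideal)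
  have "term_poly B c \<gamma> \<otimes>\<^bsub>mpoly B\<^esub> f \<in> I"
    using assms by (intro I_l_closed term_poly_carrier)
  moreover have "term_poly B c \<gamma> \<otimes>\<^bsub>mpoly B\<^esub> f =
      (\<lambda>\<delta>. if \<exists>\<epsilon>. \<delta> = \<gamma> + \<epsilon> then c \<otimes> f (\<delta> - \<gamma>) else \<zero>)"
    using term_poly_mult_apply[OF ideal_carrier[OF assms(1)] assms(2)] by auto
  ultimately show ?thesis by simp
qed

lemma ideal_scale: "f \<in> I \<Longrightarrow> c \<in> carrier B \<Longrightarrow> (\<lambda>\<delta>. c \<otimes> f \<delta>) \<in> I"
  using ideal_term_mult[of f c 0] by simp

lemma ideal_minus:
  assumes "f \<in> I" "g \<in> I"
  shows "(\<lambda>\<alpha>. f \<alpha> \<ominus> g \<alpha>) \<in> I"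
proof -
  have "(\<lambda>\<alpha>. f \<alpha> \<oplus> (\<ominus> \<one>) \<otimes> g \<alpha>) \<in> I"
    using assms by (intro ideal_add ideal_scale) auto
  moreover have "(\<lambda>\<alpha>. f \<alpha> \<oplus> (\<ominus> \<one>) \<otimes> g \<alpha>) = (\<lambda>\<alpha>. f \<alpha> \<ominus> g \<alpha>)"
    using carrier_mpolyD[OF ideal_carrier[OF assms(2)]] by (simp add: a_minus_def l_minus)
  ultimately show ?thesis by simp
qed

lemma ideal_minus_cancel:
  assumes f: "f \<in> carrier (mpoly B)" and g: "g \<in> carrier (mpoly B)"
    and fg: "(\<lambda>\<alpha>. f \<alpha> \<ominus> g \<alpha>) \<in> I"
  shows "f \<in> I \<longleftrightarrow> g \<in> I"
proof -
  note c = carrier_mpolyD[OF f] carrier_mpolyD[OF g]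
  have 1: "(\<lambda>\<alpha>. (f \<alpha> \<ominus> g \<alpha>) \<oplus> g \<alpha>) = f"
    using c by (auto simp: a_minus_def a_assoc l_neg)
  have 2: "(\<lambda>\<alpha>. f \<alpha> \<ominus> (f \<alpha> \<ominus> g \<alpha>)) = g"
  proof
    fix \<alpha>
    have "f \<alpha> \<ominus> (f \<alpha> \<ominus> g \<alpha>) = (f \<alpha> \<oplus> \<ominus> f \<alpha>) \<oplus> g \<alpha>"
      using c by (simp add: a_minus_def minus_add a_assoc del: r_neg)
    then show "f \<alpha> \<ominus> (f \<alpha> \<ominus> g \<alpha>) = g \<alpha>" using c by (simp add: r_neg)
  qed
  show ?thesis
    using ideal_add[OF fg, of g] ideal_minus[OF _ fg, of f] 1 2 by auto
qed

lemma linext_shift: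
  assumes f: "f \<in> carrier (mpoly B)" and x: "\<And>\<alpha>. x \<alpha> \<in> carrier B"
  shows "linext (\<lambda>\<delta>. if \<exists>\<epsilon>. \<delta> = \<gamma> + \<epsilon> then \<one> \<otimes> f (\<delta> - \<gamma>) else \<zero>) x = linext f (\<lambda>\<alpha>. x (\<gamma> + \<alpha>))"
proof -
  note [simp] = carrier_mpolyD[OF f] x
  let ?S = "{\<alpha>. f \<alpha> \<noteq> \<zero>}"
  let ?g = "\<lambda>\<delta>. if \<exists>\<epsilon>. \<delta> = \<gamma> + \<epsilon> then \<one> \<otimes> f (\<delta> - \<gamma>) else \<zero>"
  have "linext ?g x = (\<Oplus>\<delta>\<in>(\<lambda>\<alpha>. \<gamma> + \<alpha>) ` ?S. ?g \<delta> \<otimes> x \<delta>)"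
    by (intro linext_superset) auto
  also have "\<dots> = (\<Oplus>\<alpha>\<in>?S. ?g (\<gamma> + \<alpha>) \<otimes> x (\<gamma> + \<alpha>))"
    by (intro finsum_reindex) (auto simp: inj_on_def)
  also have "\<dots> = linext f (\<lambda>\<alpha>. x (\<gamma> + \<alpha>))"
    unfolding linext_def by (intro finsum_cong') auto
  finally show ?thesis .
qed

lemma ideal_finsum:
  assumes "finite S" "\<And>s. s \<in> S \<Longrightarrow> F s \<in> I"
  shows "(\<lambda>\<delta>. \<Oplus>s\<in>S. F s \<delta>) \<in> I"
  using assms
proof (induction S rule: finite_induct)
  case empty
  then show ?case using ideal_zero by simp
next
  case (insert s S)
  have F: "F r \<delta> \<in> carrier B" if "r \<in> insert s S" for r \<delta>
    using carrier_mpolyD(1)[OF ideal_carrier[OF insert.prems[OF that]]] .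
  have "(\<lambda>\<delta>. F s \<delta> \<oplus> (\<Oplus>s\<in>S. F s \<delta>)) \<in> I" using insert by (intro ideal_add) auto
  moreover have "(\<lambda>\<delta>. \<Oplus>s\<in>insert s S. F s \<delta>) = (\<lambda>\<delta>. F s \<delta> \<oplus> (\<Oplus>s\<in>S. F s \<delta>))"
    using F insert.hyps by (intro ext finsum_insert) auto
  ultimately show ?case by simp
qed

lemma coset_eq_iff:
  fixes f g :: "'n expo \<Rightarrow> 'b"
  assumes "f \<in> carrier (mpoly B)" "g \<in> carrier (mpoly B)"
  shows "I +>\<^bsub>mpoly B\<^esub> f = I +>\<^bsub>mpoly B\<^esub> g \<longleftrightarrow> (\<lambda>\<alpha>. f \<alpha> \<ominus> g \<alpha>) \<in> I"
proof -
  interpret P: ring "mpoly B :: ('n expo \<Rightarrow> 'b) ring" by (rule ring_mpoly)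
  show ?thesis
    using P.quotient_eq_iff_same_a_r_cos[OF ideal assms] mpoly_minus[OF assms] by simp
qed

lemma lincomb_eq:
  fixes D :: "'n expo set"
  assumes "finite D" "\<And>\<beta>. \<beta> \<in> D \<Longrightarrow> c \<beta> \<in> carrier B"
  shows "lincomb B D c = lin D c"
proof -
  interpret P: ring "mpoly B :: ('n expo \<Rightarrow> 'b) ring" by (rule ring_mpoly)
  show ?thesis
    using assms
  proof (induction D rule: finite_induct)
    case empty
    then show ?case by (simp add: lincomb_def lin_def)
  next
    case (insert \<beta> D)
    then have "lincomb B (insert \<beta> D) c = term_poly B (c \<beta>) \<beta> \<oplus>\<^bsub>mpoly B\<^esub> lin D c"
      unfolding lincomb_def by (subst P.finsum_insert) (auto intro!: term_poly_carrier)
    also have "\<dots> = lin (insert \<beta> D) c"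
      using insert by (auto simp: term_poly_def lin_def)
    finally show ?case .
  qed
qed

text \<open>Neither existence nor uniqueness of \<open>c\<close> is built in, because
  \<open>monic_basis\<close> has to construct reductions before \<open>D\<close> is known to be a
  basis.\<close>

definition reduces_to :: "'n expo set \<Rightarrow> 'n expo \<Rightarrow> ('n expo \<Rightarrow> 'b) \<Rightarrow> bool" where
  "reduces_to D \<alpha> c \<longleftrightarrow> (\<forall>\<beta>\<in>D. c \<beta> \<in> carrier B) \<and> (\<lambda>\<gamma>. term_poly B \<one> \<alpha> \<gamma> \<ominus> lin D c \<gamma>) \<in> I"

text \<open>Unique existence is separated into spanning and linear independence. Two representations
  \<open>c\<close> and \<open>e\<close> of one class differ by \<open>lin D\<close> of their
  difference, which lies in \<open>I\<close>, so uniqueness need only be tested at the zero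
  class.\<close>

lemma is_monomial_basis_iff:
  assumes D: "finite D"
  shows "is_monomial_basis B D I \<longleftrightarrow>
    (\<forall>f\<in>carrier (mpoly B). \<exists>c. (\<forall>\<beta>\<in>D. c \<beta> \<in> carrier B) \<and> (\<lambda>\<gamma>. f \<gamma> \<ominus> lin D c \<gamma>) \<in> I) \<and>
    (\<forall>c. (\<forall>\<beta>\<in>D. c \<beta> \<in> carrier B) \<longrightarrow> lin D c \<in> I \<longrightarrow> (\<forall>\<beta>\<in>D. c \<beta> = \<zero>))" (is "_ \<longleftrightarrow> ?S \<and> ?U")
proof -
  have lin_restrict: "lin D (restrict c D) = lin D c" for c by (auto simp: lin_def)
  have "is_monomial_basis B D I \<longleftrightarrow> (\<forall>f\<in>carrier (mpoly B). \<exists>!c. c \<in> D \<rightarrow>\<^sub>E carrier B \<and>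
     I +>\<^bsub>mpoly B\<^esub> f = I +>\<^bsub>mpoly B\<^esub> lincomb B D c)"
    unfolding is_monomial_basis_def by (auto simp: FactRing_def A_RCOSETS_def')
  also have "\<dots> \<longleftrightarrow> (\<forall>f\<in>carrier (mpoly B). \<exists>!c. c \<in> D \<rightarrow>\<^sub>E carrier B \<and> (\<lambda>\<gamma>. f \<gamma> \<ominus> lin D c \<gamma>) \<in> I)"
  proof (intro ball_cong refl arg_cong[where f = Ex1] ext conj_cong)
    fix f c :: "'n expo \<Rightarrow> 'b"
    assume f: "f \<in> carrier (mpoly B)" and "c \<in> D \<rightarrow>\<^sub>E carrier B"
    then have c: "\<And>\<beta>. \<beta> \<in> D \<Longrightarrow> c \<beta> \<in> carrier B" by auto
    show "(I +>\<^bsub>mpoly B\<^esub> f = I +>\<^bsub>mpoly B\<^esub> lincomb B D c) = ((\<lambda>\<gamma>. f \<gamma> \<ominus> lin D c \<gamma>) \<in> I)"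
      using coset_eq_iff[OF f lin_carrier[OF D c]] lincomb_eq[OF D c] by simp
  qed
  also have "\<dots> \<longleftrightarrow> ?S \<and> ?U"
  proof (intro iffI conjI)
    assume *: "\<forall>f\<in>carrier (mpoly B). \<exists>!c. c \<in> D \<rightarrow>\<^sub>E carrier B \<and> (\<lambda>\<gamma>. f \<gamma> \<ominus> lin D c \<gamma>) \<in> I"
    show ?S
    proof
      fix f :: "'n expo \<Rightarrow> 'b" assume "f \<in> carrier (mpoly B)"
      then obtain c where "c \<in> D \<rightarrow>\<^sub>E carrier B" "(\<lambda>\<gamma>. f \<gamma> \<ominus> lin D c \<gamma>) \<in> I" using * by blast
      then show "\<exists>c. (\<forall>\<beta>\<in>D. c \<beta> \<in> carrier B) \<and> (\<lambda>\<gamma>. f \<gamma> \<ominus> lin D c \<gamma>) \<in> I"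
        by (intro exI[of _ c]) auto
    qed
    show ?U
    proof (intro allI impI)
      fix c assume c: "\<forall>\<beta>\<in>D. c \<beta> \<in> carrier B" "lin D c \<in> I"
      have cl: "lin D c \<in> carrier (mpoly B)" using c by (intro ideal_carrier)
      \<comment> \<open>As \<open>lin D c\<close> lies in \<open>I\<close>, its class is represented
        both by \<open>c\<close> and by zero coefficients; uniqueness identifies the two.\<close>
      let ?z = "\<lambda>\<beta>\<in>D. \<zero>"
      have "(\<lambda>\<gamma>. lin D c \<gamma> \<ominus> lin D (restrict c D) \<gamma>) = (\<lambda>\<gamma>. \<zero>)"
        using carrier_mpolyD[OF cl] by (auto simp: lin_restrict a_minus_def r_neg)
      then have 1: "restrict c D \<in> D \<rightarrow>\<^sub>E carrier B \<and> (\<lambda>\<gamma>. lin D c \<gamma> \<ominus> lin D (restrict c D) \<gamma>) \<in> I"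
        using ideal_zero c by auto
      have "(\<lambda>\<gamma>. lin D c \<gamma> \<ominus> lin D ?z \<gamma>) = lin D c"
        using carrier_mpolyD[OF cl] by (auto simp: lin_def a_minus_def)
      then have 2: "?z \<in> D \<rightarrow>\<^sub>E carrier B \<and> (\<lambda>\<gamma>. lin D c \<gamma> \<ominus> lin D ?z \<gamma>) \<in> I"
        using c by auto
      have "restrict c D = ?z" using *[rule_format, OF cl] 1 2 by (elim ex1E) metis
      then show "\<forall>\<beta>\<in>D. c \<beta> = \<zero>" by (metis restrict_apply')
    qed
  next
    assume *: "?S \<and> ?U"
    show "\<forall>f\<in>carrier (mpoly B). \<exists>!c. c \<in> D \<rightarrow>\<^sub>E carrier B \<and> (\<lambda>\<gamma>. f \<gamma> \<ominus> lin D c \<gamma>) \<in> I"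
    proof
      fix f :: "'n expo \<Rightarrow> 'b" assume f: "f \<in> carrier (mpoly B)"
      note fc = carrier_mpolyD[OF f]
      from * f obtain c where c: "\<forall>\<beta>\<in>D. c \<beta> \<in> carrier B" "(\<lambda>\<gamma>. f \<gamma> \<ominus> lin D c \<gamma>) \<in> I" by blast
      show "\<exists>!c. c \<in> D \<rightarrow>\<^sub>E carrier B \<and> (\<lambda>\<gamma>. f \<gamma> \<ominus> lin D c \<gamma>) \<in> I"
      proof (rule ex1I)
        show "restrict c D \<in> D \<rightarrow>\<^sub>E carrier B \<and> (\<lambda>\<gamma>. f \<gamma> \<ominus> lin D (restrict c D) \<gamma>) \<in> I"
          using c by (auto simp: lin_restrict)
        fix e assume e: "e \<in> D \<rightarrow>\<^sub>E carrier B \<and> (\<lambda>\<gamma>. f \<gamma> \<ominus> lin D e \<gamma>) \<in> I"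
        have lc: "lin D c \<gamma> \<in> carrier B" and le: "lin D e \<gamma> \<in> carrier B" for \<gamma>
          using c e by (auto simp: lin_def)
        have "(\<lambda>\<gamma>. (f \<gamma> \<ominus> lin D e \<gamma>) \<ominus> (f \<gamma> \<ominus> lin D c \<gamma>)) \<in> I"
          by (rule ideal_minus[OF conjunct2[OF e] c(2)])
        moreover have "(f \<gamma> \<ominus> lin D e \<gamma>) \<ominus> (f \<gamma> \<ominus> lin D c \<gamma>) = lin D c \<gamma> \<ominus> lin D e \<gamma>" for \<gamma>
          using fc(1)[of \<gamma>] lc[of \<gamma>] le[of \<gamma>] by algebra
        moreover have "(\<lambda>\<gamma>. lin D c \<gamma> \<ominus> lin D e \<gamma>) = lin D (\<lambda>\<beta>. c \<beta> \<ominus> e \<beta>)"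
          by (auto simp: lin_def a_minus_def)
        ultimately have "lin D (\<lambda>\<beta>. c \<beta> \<ominus> e \<beta>) \<in> I" by simp
        moreover have cc: "c \<beta> \<in> carrier B" "e \<beta> \<in> carrier B" if "\<beta> \<in> D" for \<beta>
          using c(1) e that by auto
        then have "\<forall>\<beta>\<in>D. c \<beta> \<ominus> e \<beta> \<in> carrier B" by simp
        ultimately have "\<forall>\<beta>\<in>D. c \<beta> \<ominus> e \<beta> = \<zero>"
          using conjunct2[OF *, rule_format, of "\<lambda>\<beta>. c \<beta> \<ominus> e \<beta>"] by blast
        then have "\<forall>\<beta>\<in>D. c \<beta> = e \<beta>" using cc by (simp add: minus_eq_zero_iff)
        then show "e = restrict c D" using e by (auto simp: fun_eq_iff PiE_def extensional_def)
      qed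
    qed
  qed
  finally show ?thesis .
qed

text \<open>For every monomial in the support of \<open>h\<close>, its difference from its reduction
  lies in \<open>I\<close>; scale by the coefficient of \<open>h\<close> and add up. Off the support
  \<open>C\<close> is not tied to \<open>I\<close>, but its values must lie in the ring for
  \<open>linext\<close> to be well behaved.\<close>

lemma reduces_sum:
  assumes D: "finite D" and h: "h \<in> carrier (mpoly B)"
    and C: "\<And>\<gamma>. h \<gamma> \<noteq> \<zero> \<Longrightarrow> reduces_to D \<gamma> (C \<gamma>)"
    and Cc: "\<And>\<gamma> \<beta>. \<beta> \<in> D \<Longrightarrow> C \<gamma> \<beta> \<in> carrier B"
  shows "(\<lambda>\<delta>. h \<delta> \<ominus> lin D (\<lambda>\<beta>. linext h (\<lambda>\<gamma>. C \<gamma> \<beta>)) \<delta>) \<in> I"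
proof -
  note hc = carrier_mpolyD[OF h]
  let ?S = "{\<gamma>. h \<gamma> \<noteq> \<zero>}"
  have lc: "lin D (C \<gamma>) \<delta> \<in> carrier B" for \<gamma> \<delta> :: "'n expo" using Cc by (auto simp: lin_def)
  have tc: "term_poly B \<one> \<gamma> \<delta> \<in> carrier B" for \<gamma> \<delta> :: "'n expo"
    by (auto simp: term_poly_def)
  have "(\<lambda>\<delta>. \<Oplus>\<gamma>\<in>?S. h \<gamma> \<otimes> (term_poly B \<one> \<gamma> \<delta> \<ominus> lin D (C \<gamma>) \<delta>)) \<in> I"
    using C hc unfolding reduces_to_def by (intro ideal_finsum ideal_scale) auto
  moreover have "(\<Oplus>\<gamma>\<in>?S. h \<gamma> \<otimes> (term_poly B \<one> \<gamma> \<delta> \<ominus> lin D (C \<gamma>) \<delta>)) =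
      h \<delta> \<ominus> lin D (\<lambda>\<beta>. linext h (\<lambda>\<gamma>. C \<gamma> \<beta>)) \<delta>" for \<delta>
  proof -
    have 1: "(\<Oplus>\<gamma>\<in>?S. h \<gamma> \<otimes> term_poly B \<one> \<gamma> \<delta>) = h \<delta>"
    proof (cases "\<delta> \<in> ?S")
      case True
      then have "(\<Oplus>\<gamma>\<in>?S. h \<gamma> \<otimes> term_poly B \<one> \<gamma> \<delta>) = h \<delta> \<otimes> term_poly B \<one> \<delta> \<delta>"
        using hc by (intro finsum_single) (auto simp: term_poly_def)
      then show ?thesis using hc by (simp add: term_poly_def)
    next
      case False
      then have "(\<Oplus>\<gamma>\<in>?S. h \<gamma> \<otimes> term_poly B \<one> \<gamma> \<delta>) = \<zero>"
        using hc by (intro add.finprod_one_eqI) (auto simp: term_poly_def)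
      then show ?thesis using False by simp
    qed
    have 2: "(\<Oplus>\<gamma>\<in>?S. h \<gamma> \<otimes> lin D (C \<gamma>) \<delta>) = lin D (\<lambda>\<beta>. linext h (\<lambda>\<gamma>. C \<gamma> \<beta>)) \<delta>"
      using hc by (auto simp: lin_def linext_def intro!: add.finprod_one_eqI)
    have 3: "(\<Oplus>\<gamma>\<in>?S. h \<gamma> \<otimes> lin D (C \<gamma>) \<delta>) \<in> carrier B"
      using hc lc by (intro finsum_closed) auto
    have "(\<Oplus>\<gamma>\<in>?S. h \<gamma> \<otimes> (term_poly B \<one> \<gamma> \<delta> \<ominus> lin D (C \<gamma>) \<delta>) \<oplus> h \<gamma> \<otimes> lin D (C \<gamma>) \<delta>) =
       (\<Oplus>\<gamma>\<in>?S. h \<gamma> \<otimes> (term_poly B \<one> \<gamma> \<delta> \<ominus> lin D (C \<gamma>) \<delta>)) \<oplus> (\<Oplus>\<gamma>\<in>?S. h \<gamma> \<otimes> lin D (C \<gamma>) \<delta>)"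
      using hc lc tc by (intro finsum_addf) auto
    moreover have "(\<Oplus>\<gamma>\<in>?S. h \<gamma> \<otimes> (term_poly B \<one> \<gamma> \<delta> \<ominus> lin D (C \<gamma>) \<delta>) \<oplus> h \<gamma> \<otimes> lin D (C \<gamma>) \<delta>) =
       (\<Oplus>\<gamma>\<in>?S. h \<gamma> \<otimes> term_poly B \<one> \<gamma> \<delta>)"
    proof (intro finsum_cong')
      fix \<gamma>
      show "h \<gamma> \<otimes> (term_poly B \<one> \<gamma> \<delta> \<ominus> lin D (C \<gamma>) \<delta>) \<oplus> h \<gamma> \<otimes> lin D (C \<gamma>) \<delta> = h \<gamma> \<otimes> term_poly B \<one> \<gamma> \<delta>"
        using hc(1)[of \<gamma>] lc[of \<gamma> \<delta>] tc[of \<gamma> \<delta>] by algebra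
    qed (use hc tc in auto)
    moreover have "(\<Oplus>\<gamma>\<in>?S. h \<gamma> \<otimes> (term_poly B \<one> \<gamma> \<delta> \<ominus> lin D (C \<gamma>) \<delta>)) \<in> carrier B"
      using hc lc tc by (intro finsum_closed) auto
    ultimately show ?thesis
      using 1 2 3 by (intro eq_minusI) simp_all
  qed
  ultimately show ?thesis by simp
qed

text \<open>Row \<open>\<alpha>\<close> of \<open>X\<close> is the normal form of \<open>x\<^sup>\<alpha>\<close>; entries in columns outside \<open>D\<close> are junk.\<close>

definition nf_matrix :: "'n expo set \<Rightarrow> ('n expo \<Rightarrow> 'n expo \<Rightarrow> 'b) \<Rightarrow> bool" where
  "nf_matrix D X \<longleftrightarrow> (\<forall>\<alpha>. \<forall>\<beta>\<in>D. X \<alpha> \<beta> \<in> carrier B) \<and>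
     (\<forall>\<alpha>\<in>D. \<forall>\<beta>\<in>D. X \<alpha> \<beta> = (if \<alpha> = \<beta> then \<one> else \<zero>)) \<and>
     (\<forall>f\<in>carrier (mpoly B). f \<in> I \<longleftrightarrow> (\<forall>\<beta>\<in>D. linext f (\<lambda>\<alpha>. X \<alpha> \<beta>) = \<zero>))"

lemma nf_matrix_carrier: "nf_matrix D X \<Longrightarrow> \<beta> \<in> D \<Longrightarrow> X \<alpha> \<beta> \<in> carrier B"
  and nf_matrix_diag: "nf_matrix D X \<Longrightarrow> \<alpha> \<in> D \<Longrightarrow> \<beta> \<in> D \<Longrightarrow> X \<alpha> \<beta> = (if \<alpha> = \<beta> then \<one> else \<zero>)"
  and nf_matrix_kernel: "nf_matrix D X \<Longrightarrow> f \<in> carrier (mpoly B) \<Longrightarrow>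
    f \<in> I \<longleftrightarrow> (\<forall>\<beta>\<in>D. linext f (\<lambda>\<alpha>. X \<alpha> \<beta>) = \<zero>)"
  by (auto simp: nf_matrix_def)

lemma nf_matrix_lin:
  assumes D: "finite D" and X: "nf_matrix D X" and c: "\<And>\<beta>. \<beta> \<in> D \<Longrightarrow> c \<beta> \<in> carrier B" and \<beta>: "\<beta> \<in> D"
  shows "linext (lin D c) (\<lambda>\<alpha>. X \<alpha> \<beta>) = c \<beta>"
proof -
  have "linext (lin D c) (\<lambda>\<alpha>. X \<alpha> \<beta>) = (\<Oplus>\<gamma>\<in>D. c \<gamma> \<otimes> X \<gamma> \<beta>)"
    using D c nf_matrix_carrier[OF X] \<beta> by (intro linext_lin) auto
  also have "\<dots> = c \<beta> \<otimes> X \<beta> \<beta>"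
    using D c nf_matrix_carrier[OF X] nf_matrix_diag[OF X] \<beta> by (intro finsum_single) auto
  finally show ?thesis using c \<beta> nf_matrix_diag[OF X] by simp
qed

text \<open>Pairing with column \<beta> recovers \<open>c \<beta>\<close> from
  \<open>lin D c\<close>, because \<open>X\<close> is the identity on \<open>D\<close>. The kernel
  condition thus becomes an equality of coordinates.\<close>

lemma nf_matrix_minus_lin:
  assumes D: "finite D" and X: "nf_matrix D X" and c: "\<And>\<beta>. \<beta> \<in> D \<Longrightarrow> c \<beta> \<in> carrier B"
    and f: "f \<in> carrier (mpoly B)"
  shows "(\<lambda>\<gamma>. f \<gamma> \<ominus> lin D c \<gamma>) \<in> I \<longleftrightarrow> (\<forall>\<beta>\<in>D. linext f (\<lambda>\<alpha>. X \<alpha> \<beta>) = c \<beta>)"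
proof -
  note fc = carrier_mpolyD[OF f]
  have lc: "lin D c \<in> carrier (mpoly B)" using D c by (rule lin_carrier)
  have "(\<lambda>\<gamma>. f \<gamma> \<ominus> lin D c \<gamma>) \<in> I \<longleftrightarrow>
      (\<forall>\<beta>\<in>D. linext (\<lambda>\<gamma>. f \<gamma> \<ominus> lin D c \<gamma>) (\<lambda>\<alpha>. X \<alpha> \<beta>) = \<zero>)"
    by (intro nf_matrix_kernel[OF X] minus_carrier f lc)
  also have "\<dots> \<longleftrightarrow> (\<forall>\<beta>\<in>D. linext f (\<lambda>\<alpha>. X \<alpha> \<beta>) \<ominus> c \<beta> = \<zero>)"
    using f lc nf_matrix_carrier[OF X] nf_matrix_lin[OF D X c] by (simp add: linext_minus)
  also have "\<dots> \<longleftrightarrow> (\<forall>\<beta>\<in>D. linext f (\<lambda>\<alpha>. X \<alpha> \<beta>) = c \<beta>)"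
    using fc nf_matrix_carrier[OF X] c by (intro ball_cong refl minus_eq_zero_iff linext_closed) auto
  finally show ?thesis .
qed

text \<open>Uniqueness of normal forms: any reduction found by other means, in particular after a
  base change, must be the corresponding row of \<open>X\<close>.\<close>

lemma reduces_to_iff:
  assumes D: "finite D" and X: "nf_matrix D X"
  shows "reduces_to D \<alpha> c \<longleftrightarrow> (\<forall>\<beta>\<in>D. X \<alpha> \<beta> = c \<beta>)"
proof (cases "\<forall>\<beta>\<in>D. c \<beta> \<in> carrier B")
  case True
  have "linext (term_poly B \<one> \<alpha>) (\<lambda>\<alpha>. X \<alpha> \<beta>) = X \<alpha> \<beta>" if "\<beta> \<in> D" for \<beta>
    using nf_matrix_carrier[OF X that] by (simp add: linext_term_poly)
  then show ?thesis
    unfolding reduces_to_def using True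
    by (subst nf_matrix_minus_lin[OF D X _ term_poly_carrier]) auto
next
  case False
  then have "\<not> (\<forall>\<beta>\<in>D. X \<alpha> \<beta> = c \<beta>)" using nf_matrix_carrier[OF X] by metis
  then show ?thesis unfolding reduces_to_def using False by blast
qed

text \<open>This reduces the proof that \<open>D\<close> is a basis to exhibiting a matrix, which is
  how a second basis will be obtained from a first one. Spanning supplies the rows, independence
  forces the identity on \<open>D\<close>, and \<open>f\<close> agrees modulo \<open>I\<close> with
  the combination of its coordinates, so \<open>I\<close> is their common kernel.\<close>

lemma is_monomial_basis_iff_nf_matrix:
  assumes D: "finite D"
  shows "is_monomial_basis B D I \<longleftrightarrow> (\<exists>X. nf_matrix D X)"
proof
  assume "is_monomial_basis B D I"
  then have S: "\<exists>c. (\<forall>\<beta>\<in>D. c \<beta> \<in> carrier B) \<and> (\<lambda>\<gamma>. f \<gamma> \<ominus> lin D c \<gamma>) \<in> I"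
    if "f \<in> carrier (mpoly B)" for f
    using that unfolding is_monomial_basis_iff[OF D] by blast
  from \<open>is_monomial_basis B D I\<close> have U: "\<forall>\<beta>\<in>D. c \<beta> = \<zero>" if "\<forall>\<beta>\<in>D. c \<beta> \<in> carrier B" "lin D c \<in> I" for c
    using that unfolding is_monomial_basis_iff[OF D] by blast
  have "\<exists>c. reduces_to D \<alpha> c" for \<alpha>
    using S[OF term_poly_carrier[OF one_closed]] unfolding reduces_to_def by blast
  then obtain X where X: "\<And>\<alpha>. reduces_to D \<alpha> (X \<alpha>)" by metis
  then have Xc: "X \<alpha> \<beta> \<in> carrier B" if "\<beta> \<in> D" for \<alpha> \<beta> using that by (auto simp: reduces_to_def)
  have "nf_matrix D X"
    unfolding nf_matrix_def
  proof (intro conjI allI ballI)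
    fix \<alpha> \<beta> assume \<alpha>: "\<alpha> \<in> D" and \<beta>: "\<beta> \<in> D"
    \<comment> \<open>Unit row minus row \<alpha> of \<open>X\<close>. For \<alpha> in
      \<open>D\<close> the monomial is itself a combination over \<open>D\<close>, so the relation
      for \<alpha> is one among basis elements.\<close>
    let ?c = "\<lambda>\<beta>. (if \<beta> = \<alpha> then \<one> else \<zero>) \<ominus> X \<alpha> \<beta>"
    have "(\<lambda>\<gamma>. term_poly B \<one> \<alpha> \<gamma> \<ominus> lin D (X \<alpha>) \<gamma>) = lin D ?c"
      using \<alpha> by (auto simp: term_poly_def lin_def a_minus_def)
    then have "lin D ?c \<in> I" using X[of \<alpha>] by (simp add: reduces_to_def)
    moreover have "\<forall>\<beta>\<in>D. ?c \<beta> \<in> carrier B" using Xc by simp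
    ultimately have "?c \<beta> = \<zero>" using U[of ?c] \<beta> by blast
    then show "X \<alpha> \<beta> = (if \<alpha> = \<beta> then \<one> else \<zero>)"
      using Xc[OF \<beta>] by (cases "\<alpha> = \<beta>") (auto simp: minus_eq_zero_iff)
  next
    fix f :: "'n expo \<Rightarrow> 'b" assume f: "f \<in> carrier (mpoly B)"
    let ?c = "\<lambda>\<beta>. linext f (\<lambda>\<gamma>. X \<gamma> \<beta>)"
    have c: "?c \<beta> \<in> carrier B" if "\<beta> \<in> D" for \<beta>
      using carrier_mpolyD[OF f] Xc that by auto
    have "(\<lambda>\<delta>. f \<delta> \<ominus> lin D ?c \<delta>) \<in> I"
      using D f X Xc by (intro reduces_sum) auto
    then have "f \<in> I \<longleftrightarrow> lin D ?c \<in> I"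
      using D f c by (intro ideal_minus_cancel lin_carrier) auto
    also have "\<dots> \<longleftrightarrow> (\<forall>\<beta>\<in>D. ?c \<beta> = \<zero>)"
    proof
      assume "\<forall>\<beta>\<in>D. ?c \<beta> = \<zero>"
      then have "lin D ?c = (\<lambda>\<gamma>. \<zero>)" by (auto simp: lin_def)
      then show "lin D ?c \<in> I" using ideal_zero by simp
    qed (use U[of ?c] c in blast)
    finally show "f \<in> I \<longleftrightarrow> (\<forall>\<beta>\<in>D. ?c \<beta> = \<zero>)" .
  qed (use Xc in auto)
  then show "\<exists>X. nf_matrix D X" by blast
next
  assume "\<exists>X. nf_matrix D X"
  then obtain X where X: "nf_matrix D X" by blast
  show "is_monomial_basis B D I"
    unfolding is_monomial_basis_iff[OF D]
  proof (intro conjI ballI allI impI)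
    fix f :: "'n expo \<Rightarrow> 'b" assume f: "f \<in> carrier (mpoly B)"
    show "\<exists>c. (\<forall>\<beta>\<in>D. c \<beta> \<in> carrier B) \<and> (\<lambda>\<gamma>. f \<gamma> \<ominus> lin D c \<gamma>) \<in> I"
      using nf_matrix_carrier[OF X] carrier_mpolyD[OF f]
      by (intro exI[of _ "\<lambda>\<beta>. linext f (\<lambda>\<gamma>. X \<gamma> \<beta>)"] conjI)
         (auto simp: nf_matrix_minus_lin[OF D X _ f])
  next
    fix c \<beta> assume c: "\<forall>\<beta>\<in>D. c \<beta> \<in> carrier B" "lin D c \<in> I" and \<beta>: "\<beta> \<in> D"
    then have "linext (lin D c) (\<lambda>\<alpha>. X \<alpha> \<beta>) = \<zero>"
      using nf_matrix_kernel[OF X ideal_carrier] by blast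
    then show "c \<beta> = \<zero>" using nf_matrix_lin[OF D X _ \<beta>, of c] c by simp
  qed
qed

lemma coord_matrix_eq:
  assumes D: "finite D" and X: "nf_matrix D X"
  shows "coord_matrix B Q D I = (\<lambda>ij\<in>Q \<times> D. X (fst ij) (snd ij))"
  unfolding coord_matrix_def
proof (intro restrict_ext)
  fix ij assume "ij \<in> Q \<times> D"
  then have \<beta>: "snd ij \<in> D" by auto
  let ?\<alpha> = "fst ij"
  have "(THE c. c \<in> D \<rightarrow>\<^sub>E carrier B \<and>
      I +>\<^bsub>mpoly B\<^esub> term_poly B \<one> ?\<alpha> = I +>\<^bsub>mpoly B\<^esub> lincomb B D c) = restrict (X ?\<alpha>) D"
  proof (rule the_equality)
    have eq: "c \<in> D \<rightarrow>\<^sub>E carrier B \<and> I +>\<^bsub>mpoly B\<^esub> term_poly B \<one> ?\<alpha> = I +>\<^bsub>mpoly B\<^esub> lincomb B D c \<longleftrightarrow>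
        c \<in> extensional D \<and> reduces_to D ?\<alpha> c" for c
    proof (cases "c \<in> D \<rightarrow>\<^sub>E carrier B")
      case True
      then have "c \<beta> \<in> carrier B" if "\<beta> \<in> D" for \<beta> using that by auto
      then show ?thesis
        using True D
        by (auto simp: reduces_to_def lincomb_eq coset_eq_iff lin_carrier term_poly_carrier PiE_def)
    qed (auto simp: reduces_to_def PiE_def)
    show "restrict (X ?\<alpha>) D \<in> D \<rightarrow>\<^sub>E carrier B \<and>
        I +>\<^bsub>mpoly B\<^esub> term_poly B \<one> ?\<alpha> = I +>\<^bsub>mpoly B\<^esub> lincomb B D (restrict (X ?\<alpha>) D)"
      unfolding eq reduces_to_iff[OF D X] by auto
    fix c assume "c \<in> D \<rightarrow>\<^sub>E carrier B \<and>
        I +>\<^bsub>mpoly B\<^esub> term_poly B \<one> ?\<alpha> = I +>\<^bsub>mpoly B\<^esub> lincomb B D c"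
    then show "c = restrict (X ?\<alpha>) D"
      unfolding eq reduces_to_iff[OF D X] by (auto simp: extensional_def fun_eq_iff)
  qed
  then show "(THE c. c \<in> D \<rightarrow>\<^sub>E carrier B \<and>
      I +>\<^bsub>mpoly B\<^esub> term_poly B \<one> ?\<alpha> = I +>\<^bsub>mpoly B\<^esub> lincomb B D c) (snd ij) = X ?\<alpha> (snd ij)"
    using \<beta> by simp
qed

end

section \<open>Monomial orders and triangularity\<close>

lemma mono_subsequence_nat:
  fixes f :: "nat \<Rightarrow> nat"
  obtains r :: "nat \<Rightarrow> nat" where "strict_mono r" "mono (\<lambda>n. f (r n))"
proof -
  obtain s :: "nat \<Rightarrow> nat" where s: "strict_mono s" "monoseq (\<lambda>n. f (s n))"
    using seq_monosub by blast
  show ?thesis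
  proof (cases "mono (\<lambda>n. f (s n))")
    case True
    then show ?thesis using s that by blast
  next
    case False
    then have dec: "f (s n) \<le> f (s m)" if "m \<le> n" for m n
      using s(2) that unfolding monoseq_def mono_def by blast
    \<comment> \<open>A decreasing sequence of naturals is constant from the place where it attains
      its minimum, so its tail is also increasing.\<close>
    obtain N where N: "\<And>n. f (s N) \<le> f (s n)"
      using ex_has_least_nat[of "\<lambda>_. True" 0 "\<lambda>n. f (s n)"] by auto
    then have "f (s (N + n)) = f (s N)" for n using dec[of N "N + n"] by (simp add: le_antisym)
    then have "mono (\<lambda>n. f (s (N + n)))" by (simp add: mono_def)
    moreover have "strict_mono (\<lambda>n. s (N + n))"
      using s(1) by (simp add: strict_mono_def)
    ultimately show ?thesis using that by blast
  qed
qed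

text \<open>With \<open>S = UNIV\<close> this is Dickson's lemma.\<close>

lemma mono_subsequence_coordinates:
  fixes f :: "nat \<Rightarrow> ('n::finite) expo"
  assumes "finite S"
  shows "\<exists>r :: nat \<Rightarrow> nat. strict_mono r \<and> (\<forall>i\<in>S. mono (\<lambda>n. f (r n) $ i))"
  using assms
proof (induction S rule: finite_induct)
  case empty
  show ?case by (intro exI[of _ id]) (simp add: strict_mono_def)
next
  case (insert i S)
  then obtain r :: "nat \<Rightarrow> nat" where r: "strict_mono r" "\<And>j. j \<in> S \<Longrightarrow> mono (\<lambda>n. f (r n) $ j)" by blast
  obtain s :: "nat \<Rightarrow> nat" where s: "strict_mono s" "mono (\<lambda>n. f (r (s n)) $ i)"
    using mono_subsequence_nat[of "\<lambda>n. f (r n) $ i"] by blast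
  have "mono (\<lambda>n. f (r (s n)) $ j)" if "j \<in> S" for j
    using r(2)[OF that] s(1) by (simp add: mono_def strict_mono_less_eq)
  then show ?case
    using r(1) s by (intro exI[of _ "r \<circ> s"]) (auto simp: strict_mono_def)
qed

text \<open>In an infinite descent two terms can be chosen such that the earlier one divides the
  later one. Since 0 precedes every other exponent and the order is compatible with addition, a
  proper divisor precedes its multiple, against the descent.\<close>

lemma monomial_order_wfp:
  assumes prec: "monomial_order prec"
  shows "wfp prec"
proof (rule ccontr)
  assume "\<not> wfp prec"
  then obtain f where f: "\<And>i. prec (f (Suc i)) (f i)"
    unfolding wfp_def wf_iff_no_infinite_down_chain by auto
  have tr: "transp prec" and irr: "irreflp prec" using prec by (auto simp: monomial_order_def)
  have desc: "prec (f n) (f m)" if "m < n" for m n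
    using that
  proof (induction n)
    case (Suc n)
    then show ?case using f[of n] transpD[OF tr] by (cases "m = n") auto
  qed simp
  obtain r :: "nat \<Rightarrow> nat" where r: "strict_mono r" "\<And>i. mono (\<lambda>n. f (r n) $ i)"
    using mono_subsequence_coordinates[of UNIV f] by auto
  have le: "f (r 0) $ i \<le> f (r 1) $ i" for i using r(2)[of i] by (simp add: mono_def)
  define \<gamma> where "\<gamma> = f (r 1) - f (r 0)"
  have eq: "f (r 1) = \<gamma> + f (r 0)" using le by (simp add: \<gamma>_def vec_eq_iff)
  have less: "prec (f (r 1)) (f (r 0))" using desc r(1) by (simp add: strict_mono_def)
  show False
  proof (cases "\<gamma> = 0")
    case True
    then show False using less eq irr by (simp add: irreflp_def)
  next
    case False
    then have "prec 0 \<gamma>" using prec by (simp add: monomial_order_def)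
    then have "prec (0 + f (r 0)) (\<gamma> + f (r 0))" using prec unfolding monomial_order_def by blast
    then have "prec (f (r 0)) (f (r 0))" using transpD[OF tr _ less] eq by simp
    then show False using irr by (simp add: irreflp_def)
  qed
qed

text \<open>Peels off one variable; the drop in total degree drives the induction in
  \<open>triangular_everywhere\<close>.\<close>

lemma expo_cases:
  fixes \<alpha> :: "('n::finite) expo"
  obtains "\<alpha> = 0" | \<alpha>' i where "\<alpha> = axis i 1 + \<alpha>'" "(\<Sum>j\<in>UNIV. \<alpha>' $ j) < (\<Sum>j\<in>UNIV. \<alpha> $ j)"
proof (cases "\<alpha> = 0")
  case False
  then obtain i where i: "\<alpha> $ i \<noteq> 0" by (auto simp: vec_eq_iff)
  have eq: "\<alpha> = axis i 1 + (\<alpha> - axis i 1)" using i by (auto simp: vec_eq_iff axis_def)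
  moreover have "(\<Sum>j\<in>UNIV. (\<alpha> - axis i 1) $ j) < (\<Sum>j\<in>UNIV. \<alpha> $ j)"
    using i by (intro sum_strict_mono_ex1) (auto simp: axis_def)
  ultimately show ?thesis using that by blast
qed (use that in blast)

lemma zero_in_standard_set:
  assumes "standard_set D" "D \<noteq> {}"
  shows "0 \<in> D"
proof (rule ccontr)
  assume "0 \<notin> D"
  then have "0 + \<gamma> \<notin> D" for \<gamma> using assms(1) unfolding standard_set_def by blast
  then show False using assms(2) by auto
qed

text \<open>The property described by \<open>lead_exp\<close>, kept apart so that it can be used
  without the description operator, whose value is meaningless for the zero polynomial.\<close>

definition is_lead :: "('n expo \<Rightarrow> 'n expo \<Rightarrow> bool) \<Rightarrow> ('b, 'm) ring_scheme \<Rightarrow>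
    (('n::finite) expo \<Rightarrow> 'b) \<Rightarrow> 'n expo \<Rightarrow> bool" where
  "is_lead prec B f \<alpha> \<longleftrightarrow> f \<alpha> \<noteq> \<zero>\<^bsub>B\<^esub> \<and> (\<forall>\<beta>. f \<beta> \<noteq> \<zero>\<^bsub>B\<^esub> \<longrightarrow> \<beta> = \<alpha> \<or> prec \<beta> \<alpha>)"

lemma lead_exp_eq:
  assumes prec: "monomial_order prec" and "is_lead prec B f \<alpha>"
  shows "lead_exp prec B f = \<alpha>"
proof -
  have "\<not> prec \<alpha> \<beta> \<or> \<not> prec \<beta> \<alpha>" for \<alpha> \<beta>
    using prec unfolding monomial_order_def irreflp_def transp_def by blast
  then show ?thesis using assms(2) unfolding is_lead_def lead_exp_def by blast
qed

lemma lead_exp_is_lead: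
  assumes prec: "monomial_order prec" and f: "f \<in> carrier (mpoly B)" "f \<noteq> \<zero>\<^bsub>mpoly B\<^esub>"
  shows "is_lead prec B f (lead_exp prec B f)"
proof -
  let ?A = "{\<alpha>. f \<alpha> \<noteq> \<zero>\<^bsub>B\<^esub>}"
  have A: "finite ?A" "?A \<noteq> {}" using f by (auto simp: carrier_mpoly)
  have "irreflp prec" "transp prec" "totalp prec" using prec by (auto simp: monomial_order_def)
  then have "asymp_on ?A prec" "transp_on ?A prec"
    unfolding asymp_on_def irreflp_def transp_on_def by blast+
  then obtain m where "m \<in> ?A" "\<forall>x\<in>?A. x \<noteq> m \<longrightarrow> \<not> prec m x"
    using Finite_Set.bex_max_element[OF A(1) _ _ A(2)] by blast
  then have "is_lead prec B f m"
    using \<open>totalp prec\<close> unfolding is_lead_def totalp_on_def by blast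
  then show ?thesis using lead_exp_eq[OF prec] by metis
qed

section \<open>Change of basis, the recurrence, and monic ideals\<close>

context mpoly_ideal
begin

lemma nf_matrix_reduces: "finite D \<Longrightarrow> nf_matrix D X \<Longrightarrow> reduces_to D \<alpha> (X \<alpha>)"
  by (simp add: reduces_to_iff)

text \<open>Pair the difference of a monomial and its normal form over \<open>D\<close>, an element
  of \<open>I\<close>, with the \<eta>-column of \<open>Y\<close>. For \<alpha> in \<open>E\<close>
  the left side is an entry of the identity, so the square blocks are inverse to each other.\<close>

lemma nf_matrix_change:
  assumes D: "finite D" "nf_matrix D X" and E: "finite E" "nf_matrix E Y" and \<eta>: "\<eta> \<in> E"
  shows "Y \<alpha> \<eta> = (\<Oplus>\<beta>\<in>D. X \<alpha> \<beta> \<otimes> Y \<beta> \<eta>)"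
proof -
  note Xc = nf_matrix_carrier[OF D(2)] and Yc = nf_matrix_carrier[OF E(2) \<eta>]
  have tc: "term_poly B \<one> \<alpha> \<in> carrier (mpoly B)" by (simp add: term_poly_carrier)
  have lc: "lin D (X \<alpha>) \<in> carrier (mpoly B)" using D(1) Xc by (intro lin_carrier)
  have "(\<lambda>\<gamma>. term_poly B \<one> \<alpha> \<gamma> \<ominus> lin D (X \<alpha>) \<gamma>) \<in> I"
    using nf_matrix_reduces[OF D] by (auto simp: reduces_to_def)
  then have "linext (\<lambda>\<gamma>. term_poly B \<one> \<alpha> \<gamma> \<ominus> lin D (X \<alpha>) \<gamma>) (\<lambda>\<alpha>. Y \<alpha> \<eta>) = \<zero>"
    using nf_matrix_kernel[OF E(2) minus_carrier[OF tc lc]] \<eta> by blast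
  then have "linext (term_poly B \<one> \<alpha>) (\<lambda>\<alpha>. Y \<alpha> \<eta>) \<ominus> linext (lin D (X \<alpha>)) (\<lambda>\<alpha>. Y \<alpha> \<eta>) = \<zero>"
    using linext_minus[OF tc lc Yc] by simp
  then have "Y \<alpha> \<eta> \<ominus> (\<Oplus>\<beta>\<in>D. X \<alpha> \<beta> \<otimes> Y \<beta> \<eta>) = \<zero>"
    using D(1) Xc Yc by (simp add: linext_term_poly linext_lin)
  moreover have "(\<Oplus>\<beta>\<in>D. X \<alpha> \<beta> \<otimes> Y \<beta> \<eta>) \<in> carrier B" using Xc Yc by (intro finsum_closed) auto
  ultimately show ?thesis using Yc by (simp add: minus_eq_zero_iff)
qed

text \<open>The relation expressing the normal form of the monomial \<alpha> is multiplied by the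
  monomial \<gamma>, stays in \<open>I\<close>, and is then paired with column \<eta>. This is where
  closure of \<open>I\<close> under multiplication by monomials enters.\<close>

lemma nf_matrix_recurrence:
  assumes D: "finite D" and X: "nf_matrix D X" and \<eta>: "\<eta> \<in> D"
  shows "X (\<gamma> + \<alpha>) \<eta> = (\<Oplus>\<beta>\<in>D. X \<alpha> \<beta> \<otimes> X (\<gamma> + \<beta>) \<eta>)"
proof -
  note Xc = nf_matrix_carrier[OF X]
  have tc: "term_poly B \<one> \<alpha> \<in> carrier (mpoly B)" by (simp add: term_poly_carrier)
  have lc: "lin D (X \<alpha>) \<in> carrier (mpoly B)" using D Xc by (intro lin_carrier)
  let ?f = "\<lambda>\<gamma>. term_poly B \<one> \<alpha> \<gamma> \<ominus> lin D (X \<alpha>) \<gamma>"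
  have f: "?f \<in> I" using nf_matrix_reduces[OF D X] by (auto simp: reduces_to_def)
  have s: "(\<lambda>\<delta>. if \<exists>\<epsilon>. \<delta> = \<gamma> + \<epsilon> then \<one> \<otimes> ?f (\<delta> - \<gamma>) else \<zero>) \<in> I"
    by (rule ideal_term_mult[OF f one_closed])
  then have "linext (\<lambda>\<delta>. if \<exists>\<epsilon>. \<delta> = \<gamma> + \<epsilon> then \<one> \<otimes> ?f (\<delta> - \<gamma>) else \<zero>) (\<lambda>\<alpha>. X \<alpha> \<eta>) = \<zero>"
    using nf_matrix_kernel[OF X ideal_carrier[OF s]] \<eta> by blast
  then have "linext ?f (\<lambda>\<alpha>. X (\<gamma> + \<alpha>) \<eta>) = \<zero>"
    using linext_shift[OF ideal_carrier[OF f] Xc[OF \<eta>]] by simp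
  then have "linext (term_poly B \<one> \<alpha>) (\<lambda>\<alpha>. X (\<gamma> + \<alpha>) \<eta>) \<ominus> linext (lin D (X \<alpha>)) (\<lambda>\<alpha>. X (\<gamma> + \<alpha>) \<eta>) = \<zero>"
    using linext_minus[OF tc lc, of "\<lambda>\<alpha>. X (\<gamma> + \<alpha>) \<eta>"] Xc \<eta> by simp
  then have "X (\<gamma> + \<alpha>) \<eta> \<ominus> (\<Oplus>\<beta>\<in>D. X \<alpha> \<beta> \<otimes> X (\<gamma> + \<beta>) \<eta>) = \<zero>"
    using D Xc \<eta> by (simp add: linext_term_poly linext_lin)
  moreover have "(\<Oplus>\<beta>\<in>D. X \<alpha> \<beta> \<otimes> X (\<gamma> + \<beta>) \<eta>) \<in> carrier B" using Xc \<eta> by (intro finsum_closed) auto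
  ultimately show ?thesis using Xc \<eta> by (simp add: minus_eq_zero_iff)
qed

text \<open>The coordinates u of \<open>f\<close> over \<open>E\<close> turn into u V. The identity
  for V Y makes u recoverable from u V, so the common kernel is still \<open>I\<close>; the identity
  for Y V makes the new matrix the identity on \<open>D\<close>.\<close>

lemma nf_matrix_mult_inverse:
  assumes D: "finite D" and E: "finite E" "nf_matrix E Y"
    and V: "\<And>\<xi> \<beta>. \<xi> \<in> E \<Longrightarrow> \<beta> \<in> D \<Longrightarrow> V \<xi> \<beta> \<in> carrier B"
    and YV: "\<And>\<alpha> \<beta>. \<alpha> \<in> D \<Longrightarrow> \<beta> \<in> D \<Longrightarrow> (\<Oplus>\<xi>\<in>E. Y \<alpha> \<xi> \<otimes> V \<xi> \<beta>) = (if \<alpha> = \<beta> then \<one> else \<zero>)"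
    and VY: "\<And>\<xi> \<eta>. \<xi> \<in> E \<Longrightarrow> \<eta> \<in> E \<Longrightarrow> (\<Oplus>\<beta>\<in>D. V \<xi> \<beta> \<otimes> Y \<beta> \<eta>) = (if \<xi> = \<eta> then \<one> else \<zero>)"
  shows "nf_matrix D (\<lambda>\<alpha> \<beta>. \<Oplus>\<xi>\<in>E. Y \<alpha> \<xi> \<otimes> V \<xi> \<beta>)"
  unfolding nf_matrix_def
proof (intro conjI allI ballI)
  note Yc = nf_matrix_carrier[OF E(2)]
  fix f :: "'n expo \<Rightarrow> 'b" assume f: "f \<in> carrier (mpoly B)"
  note fc = carrier_mpolyD[OF f]
  let ?u = "\<lambda>\<xi>. linext f (\<lambda>\<alpha>. Y \<alpha> \<xi>)"
  have uc: "?u \<xi> \<in> carrier B" if "\<xi> \<in> E" for \<xi> using fc Yc that by simp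
  have uV: "linext f (\<lambda>\<alpha>. \<Oplus>\<xi>\<in>E. Y \<alpha> \<xi> \<otimes> V \<xi> \<beta>) = (\<Oplus>\<xi>\<in>E. ?u \<xi> \<otimes> V \<xi> \<beta>)" if "\<beta> \<in> D" for \<beta>
    unfolding linext_def using fc Yc V E(1) that by (intro finsum_mult_assoc[symmetric]) auto
  have uVY: "?u \<eta> = (\<Oplus>\<beta>\<in>D. (\<Oplus>\<xi>\<in>E. ?u \<xi> \<otimes> V \<xi> \<beta>) \<otimes> Y \<beta> \<eta>)" if \<eta>: "\<eta> \<in> E" for \<eta>
  proof -
    have "(\<Oplus>\<beta>\<in>D. (\<Oplus>\<xi>\<in>E. ?u \<xi> \<otimes> V \<xi> \<beta>) \<otimes> Y \<beta> \<eta>) = (\<Oplus>\<xi>\<in>E. ?u \<xi> \<otimes> (\<Oplus>\<beta>\<in>D. V \<xi> \<beta> \<otimes> Y \<beta> \<eta>))"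
      using uc V Yc E(1) D \<eta> by (intro finsum_mult_assoc) auto
    also have "\<dots> = (\<Oplus>\<xi>\<in>E. ?u \<xi> \<otimes> (if \<xi> = \<eta> then \<one> else \<zero>))"
      using uc VY \<eta> by (intro finsum_cong') auto
    also have "\<dots> = ?u \<eta> \<otimes> (if \<eta> = \<eta> then \<one> else \<zero>)"
      using uc \<eta> E(1) by (intro finsum_single) auto
    finally show ?thesis using uc[OF \<eta>] by simp
  qed
  have "f \<in> I \<longleftrightarrow> (\<forall>\<xi>\<in>E. ?u \<xi> = \<zero>)" by (rule nf_matrix_kernel[OF E(2) f])
  also have "\<dots> \<longleftrightarrow> (\<forall>\<beta>\<in>D. (\<Oplus>\<xi>\<in>E. ?u \<xi> \<otimes> V \<xi> \<beta>) = \<zero>)"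
  proof (intro iffI ballI)
    fix \<beta> assume "\<forall>\<xi>\<in>E. ?u \<xi> = \<zero>" "\<beta> \<in> D"
    then show "(\<Oplus>\<xi>\<in>E. ?u \<xi> \<otimes> V \<xi> \<beta>) = \<zero>" using V by (intro add.finprod_one_eqI) auto
  next
    fix \<eta> assume *: "\<forall>\<beta>\<in>D. (\<Oplus>\<xi>\<in>E. ?u \<xi> \<otimes> V \<xi> \<beta>) = \<zero>" and \<eta>: "\<eta> \<in> E"
    have "(\<Oplus>\<beta>\<in>D. (\<Oplus>\<xi>\<in>E. ?u \<xi> \<otimes> V \<xi> \<beta>) \<otimes> Y \<beta> \<eta>) = \<zero>"
      using * Yc \<eta> by (intro add.finprod_one_eqI) auto
    then show "?u \<eta> = \<zero>" using uVY[OF \<eta>] by simp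
  qed
  finally show "f \<in> I \<longleftrightarrow> (\<forall>\<beta>\<in>D. linext f (\<lambda>\<alpha>. \<Oplus>\<xi>\<in>E. Y \<alpha> \<xi> \<otimes> V \<xi> \<beta>) = \<zero>)"
    using uV by simp
qed (use V YV nf_matrix_carrier[OF E(2)] in \<open>auto intro!: finsum_closed\<close>)

text \<open>Write \<alpha> as \<alpha>' plus a unit vector e and expand by the recurrence. If
  \<alpha>' precedes \<gamma>, the induction hypothesis kills the entry at (\<alpha>', \<gamma>).
  Otherwise \<gamma> is at most \<alpha>', so e + \<gamma> is at most \<alpha> and precedes \<beta>;
  as e + \<gamma> lies in \<open>D\<close> or its border, the hypothesis kills the other factor. The
  induction is on total degree, with \<beta> left free.\<close>

lemma triangular_everywhere:
  assumes D: "finite D" "standard_set D" "D \<noteq> {}" and X: "nf_matrix D X"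
    and prec: "monomial_order prec"
    and tri: "\<And>\<alpha> \<beta>. \<alpha> \<in> D \<union> border D \<Longrightarrow> \<beta> \<in> D \<Longrightarrow> prec \<alpha> \<beta> \<Longrightarrow> X \<alpha> \<beta> = \<zero>"
    and \<beta>: "\<beta> \<in> D" "prec \<alpha> \<beta>"
  shows "X \<alpha> \<beta> = \<zero>"
  using \<beta>
proof (induction "\<Sum>j\<in>UNIV. \<alpha> $ j" arbitrary: \<alpha> \<beta> rule: less_induct)
  case less
  show ?case
  proof (cases \<alpha> rule: expo_cases)
    case 1
    then show ?thesis using tri zero_in_standard_set[OF D(2,3)] less.prems by auto
  next
    case (2 \<alpha>' i)
    have "X \<alpha>' \<gamma> \<otimes> X (axis i 1 + \<gamma>) \<beta> = \<zero>" if \<gamma>: "\<gamma> \<in> D" for \<gamma>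
    proof (cases "prec \<alpha>' \<gamma>")
      case True
      then show ?thesis
        using less.hyps[OF 2(2) \<gamma>] nf_matrix_carrier[OF X less.prems(1)] by simp
    next
      case False
      then have "\<gamma> = \<alpha>' \<or> prec \<gamma> \<alpha>'"
        using prec unfolding monomial_order_def totalp_on_def by blast
      then have "axis i 1 + \<gamma> = \<alpha> \<or> prec (axis i 1 + \<gamma>) \<alpha>"
        using prec 2(1) unfolding monomial_order_def by (metis add.commute)
      then have "prec (axis i 1 + \<gamma>) \<beta>"
        using less.prems(2) prec unfolding monomial_order_def transp_def by metis
      moreover have "axis i 1 + \<gamma> \<in> D \<union> border D"
        using \<gamma> by (auto simp: border_def add.commute)
      ultimately show ?thesis
        using tri less.prems(1) nf_matrix_carrier[OF X \<gamma>] by simp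
    qed
    then have "(\<Oplus>\<gamma>\<in>D. X \<alpha>' \<gamma> \<otimes> X (axis i 1 + \<gamma>) \<beta>) = \<zero>"
      by (intro add.finprod_one_eqI)
    then show ?thesis using nf_matrix_recurrence[OF D(1) X less.prems(1), of "axis i 1" \<alpha>'] 2(1) by simp
  qed
qed

lemma reduced_monomial_apply:
  assumes X: "nf_matrix D X" and \<alpha>: "\<alpha> \<notin> D"
  shows "term_poly B \<one> \<alpha> \<gamma> \<ominus> lin D (X \<alpha>) \<gamma> =
    (if \<gamma> = \<alpha> then \<one> else if \<gamma> \<in> D then \<ominus> X \<alpha> \<gamma> else \<zero>)"
  using \<alpha> nf_matrix_carrier[OF X] by (auto simp: term_poly_def lin_def a_minus_def)

text \<open>Outside \<open>D\<close>, a monomial minus its normal form has that monomial as leading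
  term by triangularity, and scaling it produces every nonzero leading coefficient. Inside
  \<open>D\<close> no leading exponent can occur, because the normal form of such an element would
  have a nonzero coordinate.\<close>

lemma monic_if_triangular:
  assumes D: "finite D" and X: "nf_matrix D X" and prec: "monomial_order prec"
    and tri: "\<And>\<alpha> \<beta>. \<beta> \<in> D \<Longrightarrow> prec \<alpha> \<beta> \<Longrightarrow> X \<alpha> \<beta> = \<zero>" and nz: "\<one> \<noteq> \<zero>"
  shows "monic_ideal prec B I" "attached_set prec B I = D"
proof -
  note Xc = nf_matrix_carrier[OF X]
  have lead_in: "\<exists>f\<in>I - {\<zero>\<^bsub>mpoly B\<^esub>}. lead_exp prec B f = \<alpha> \<and> f \<alpha> = c"
    if \<alpha>: "\<alpha> \<notin> D" and c: "c \<in> carrier B" "c \<noteq> \<zero>" for \<alpha> c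
  proof
    let ?f = "\<lambda>\<gamma>. c \<otimes> (term_poly B \<one> \<alpha> \<gamma> \<ominus> lin D (X \<alpha>) \<gamma>)"
    have fI: "?f \<in> I"
      using nf_matrix_reduces[OF D X] c by (intro ideal_scale) (auto simp: reduces_to_def)
    have f\<alpha>: "?f \<alpha> = c" using reduced_monomial_apply[OF X \<alpha>] c by simp
    have "is_lead prec B ?f \<alpha>"
      unfolding is_lead_def
    proof (intro conjI allI impI)
      show "?f \<alpha> \<noteq> \<zero>" using f\<alpha> c by simp
      fix \<beta> assume "?f \<beta> \<noteq> \<zero>"
      then have "\<beta> = \<alpha> \<or> (\<beta> \<in> D \<and> X \<alpha> \<beta> \<noteq> \<zero>)"
        using c by (auto simp: reduced_monomial_apply[OF X \<alpha>] split: if_splits)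
      then show "\<beta> = \<alpha> \<or> prec \<beta> \<alpha>"
        using tri prec unfolding monomial_order_def totalp_on_def by blast
    qed
    then have "lead_exp prec B ?f = \<alpha>" by (rule lead_exp_eq[OF prec])
    then show "lead_exp prec B ?f = \<alpha> \<and> ?f \<alpha> = c" using f\<alpha> by simp
    have "?f \<noteq> (\<lambda>\<gamma>. \<zero>)" using f\<alpha> c(2) by (metis)
    then show "?f \<in> I - {\<zero>\<^bsub>mpoly B\<^esub>}" using fI by simp
  qed
  have lead_out: "lead_exp prec B f \<notin> D" if f: "f \<in> I" "f \<noteq> \<zero>\<^bsub>mpoly B\<^esub>" for f
  proof
    let ?\<alpha> = "lead_exp prec B f"
    assume \<alpha>: "?\<alpha> \<in> D"
    note fc = carrier_mpolyD[OF ideal_carrier[OF f(1)]]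
    have lead: "is_lead prec B f ?\<alpha>" using lead_exp_is_lead[OF prec ideal_carrier f(2)] f(1) by simp
    \<comment> \<open>All other exponents of \<open>f\<close> precede the leading one, and there
      this column vanishes by triangularity; the leading coefficient is all that remains.\<close>
    have "linext f (\<lambda>\<gamma>. X \<gamma> ?\<alpha>) = f ?\<alpha> \<otimes> X ?\<alpha> ?\<alpha>"
      unfolding linext_def
    proof (rule finsum_single)
      fix \<gamma> assume "\<gamma> \<in> {\<alpha>. f \<alpha> \<noteq> \<zero>}" "\<gamma> \<noteq> ?\<alpha>"
      then show "f \<gamma> \<otimes> X \<gamma> ?\<alpha> = \<zero>"
        using lead tri[OF \<alpha>] fc(1) unfolding is_lead_def by auto
    qed (use fc Xc \<alpha> lead in \<open>auto simp: is_lead_def\<close>)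
    moreover have "linext f (\<lambda>\<gamma>. X \<gamma> ?\<alpha>) = \<zero>"
      using nf_matrix_kernel[OF X ideal_carrier[OF f(1)]] f(1) \<alpha> by blast
    ultimately have "f ?\<alpha> = \<zero>" using nf_matrix_diag[OF X \<alpha> \<alpha>] fc(1) by simp
    then show False using lead by (simp add: is_lead_def)
  qed
  show "monic_ideal prec B I"
    unfolding monic_ideal_def
  proof
    fix \<alpha>
    show "lead_coeffs prec B I \<alpha> = {\<zero>} \<or> lead_coeffs prec B I \<alpha> = carrier B"
    proof (cases "\<alpha> \<in> D")
      case True
      then show ?thesis using lead_out unfolding lead_coeffs_def by blast
    next
      case False
      have "lead_coeffs prec B I \<alpha> = carrier B"
      proof (intro equalityI subsetI)
        fix c assume "c \<in> lead_coeffs prec B I \<alpha>"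
        then show "c \<in> carrier B"
          using carrier_mpolyD(1)[OF ideal_carrier] by (auto simp: lead_coeffs_def)
      next
        fix c assume c: "c \<in> carrier B"
        show "c \<in> lead_coeffs prec B I \<alpha>"
        proof (cases "c = \<zero>")
          case False
          then show ?thesis using lead_in[OF \<open>\<alpha> \<notin> D\<close> c False] unfolding lead_coeffs_def by auto
        qed (simp add: lead_coeffs_def)
      qed
      then show ?thesis ..
    qed
  qed
  show "attached_set prec B I = D"
  proof (intro equalityI subsetI)
    fix \<alpha> assume "\<alpha> \<in> attached_set prec B I"
    then show "\<alpha> \<in> D" using lead_in[of \<alpha>, OF _ one_closed nz] unfolding attached_set_def by blast
  next
    fix \<alpha> assume "\<alpha> \<in> D"
    then show "\<alpha> \<in> attached_set prec B I" using lead_out unfolding attached_set_def by blast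
  qed
qed

text \<open>Division with remainder as a well-founded induction: for \<alpha> outside
  \<open>D\<close>, monicity provides an element of \<open>I\<close> with leading coefficient
  \<open>\<one>\<close> at \<alpha>, and the negatives of its lower terms reduce by induction.
  Independence holds because a nonzero combination over \<open>D\<close> has its leading exponent in
  \<open>D\<close>, which elements of \<open>I\<close> cannot have.\<close>

lemma monic_basis:
  assumes D: "finite D" and prec: "monomial_order prec" and nz: "\<one> \<noteq> \<zero>"
    and monic: "monic_ideal prec B I" and att: "attached_set prec B I = D"
  shows "is_monomial_basis B D I"
proof -
  have red: "\<exists>c. reduces_to D \<alpha> c" for \<alpha>
    using monomial_order_wfp[OF prec]
  proof (induction \<alpha> rule: wfp_induct_rule)
    case (less \<alpha>)
    show ?case
    proof (cases "\<alpha> \<in> D")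
      case True
      have "(\<lambda>\<gamma>. term_poly B \<one> \<alpha> \<gamma> \<ominus> lin D (\<lambda>\<beta>. if \<beta> = \<alpha> then \<one> else \<zero>) \<gamma>) = (\<lambda>\<gamma>. \<zero>)"
        using True by (auto simp: term_poly_def lin_def a_minus_def r_neg)
      then have "reduces_to D \<alpha> (\<lambda>\<beta>. if \<beta> = \<alpha> then \<one> else \<zero>)"
        using ideal_zero by (simp add: reduces_to_def)
      then show ?thesis by blast
    next
      case False
      then obtain f where f: "f \<in> I" "f \<noteq> \<zero>\<^bsub>mpoly B\<^esub>" "lead_exp prec B f = \<alpha>"
        using att unfolding attached_set_def by blast
      have "f \<alpha> \<noteq> \<zero>" using lead_exp_is_lead[OF prec ideal_carrier f(2)] f by (simp add: is_lead_def)
      moreover have "f \<alpha> \<in> lead_coeffs prec B I \<alpha>" using f unfolding lead_coeffs_def by blast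
      ultimately have "lead_coeffs prec B I \<alpha> = carrier B" using monic unfolding monic_ideal_def by blast
      then have "\<one> \<in> lead_coeffs prec B I \<alpha>" by simp
      then obtain g where g: "g \<in> I" "g \<noteq> \<zero>\<^bsub>mpoly B\<^esub>" "lead_exp prec B g = \<alpha>" "g \<alpha> = \<one>"
        using nz unfolding lead_coeffs_def by auto
      note gc = carrier_mpolyD[OF ideal_carrier[OF g(1)]]
      have lead: "is_lead prec B g \<alpha>" using lead_exp_is_lead[OF prec ideal_carrier g(2)] g by simp
      define h where "h = (\<lambda>\<gamma>. term_poly B \<one> \<alpha> \<gamma> \<ominus> g \<gamma>)"
      have h: "h \<in> carrier (mpoly B)"
        unfolding h_def by (intro minus_carrier term_poly_carrier ideal_carrier g one_closed)
      have supp: "prec \<gamma> \<alpha>" if "h \<gamma> \<noteq> \<zero>" for \<gamma>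
      proof -
        have "\<gamma> \<noteq> \<alpha>" using that g(4) by (auto simp: h_def term_poly_def a_minus_def r_neg)
        moreover from this have "g \<gamma> \<noteq> \<zero>" using that by (auto simp: h_def term_poly_def a_minus_def)
        ultimately show ?thesis using lead unfolding is_lead_def by blast
      qed
      \<comment> \<open>Rows off the support of \<open>h\<close> get zeros as default, so that
        \<open>C\<close> is defined everywhere with values in the ring, as
        \<open>reduces_sum\<close> requires.\<close>
      have "\<forall>\<gamma>. \<exists>c. (h \<gamma> \<noteq> \<zero> \<longrightarrow> reduces_to D \<gamma> c) \<and> (\<forall>\<beta>\<in>D. c \<beta> \<in> carrier B)"
      proof
        fix \<gamma>
        show "\<exists>c. (h \<gamma> \<noteq> \<zero> \<longrightarrow> reduces_to D \<gamma> c) \<and> (\<forall>\<beta>\<in>D. c \<beta> \<in> carrier B)"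
        proof (cases "h \<gamma> = \<zero>")
          case True
          then show ?thesis by (intro exI[of _ "\<lambda>\<beta>. \<zero>"]) simp
        next
          case False
          then show ?thesis using less[OF supp[OF False]] by (auto simp: reduces_to_def)
        qed
      qed
      then obtain C where C: "\<And>\<gamma>. h \<gamma> \<noteq> \<zero> \<Longrightarrow> reduces_to D \<gamma> (C \<gamma>)"
        "\<And>\<gamma> \<beta>. \<beta> \<in> D \<Longrightarrow> C \<gamma> \<beta> \<in> carrier B" by metis
      let ?c = "\<lambda>\<beta>. linext h (\<lambda>\<gamma>. C \<gamma> \<beta>)"
      have cc: "?c \<beta> \<in> carrier B" if "\<beta> \<in> D" for \<beta>
        using carrier_mpolyD(1)[OF h] C(2) that by simp
      have "(\<lambda>\<delta>. (h \<delta> \<ominus> lin D ?c \<delta>) \<oplus> g \<delta>) \<in> I"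
        by (intro ideal_add reduces_sum D h C g) auto
      moreover have "(h \<delta> \<ominus> lin D ?c \<delta>) \<oplus> g \<delta> = term_poly B \<one> \<alpha> \<delta> \<ominus> lin D ?c \<delta>" for \<delta>
      proof -
        have "term_poly B \<one> \<alpha> \<delta> \<in> carrier B" "lin D ?c \<delta> \<in> carrier B"
          using cc by (auto simp: term_poly_def lin_def)
        moreover have "((x \<ominus> y) \<ominus> z) \<oplus> y = x \<ominus> z"
          if "x \<in> carrier B" "y \<in> carrier B" "z \<in> carrier B" for x y z
          using that by algebra
        ultimately show ?thesis unfolding h_def using gc(1)[of \<delta>] by blast
      qed
      ultimately have "reduces_to D \<alpha> ?c" using cc by (simp add: reduces_to_def)
      then show ?thesis by blast
    qed
  qed
  then obtain C where C: "\<And>\<alpha>. reduces_to D \<alpha> (C \<alpha>)" by metis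
  then have Cc: "C \<gamma> \<beta> \<in> carrier B" if "\<beta> \<in> D" for \<gamma> \<beta> using that by (auto simp: reduces_to_def)
  show ?thesis
    unfolding is_monomial_basis_iff[OF D]
  proof (intro conjI ballI allI impI)
    fix f :: "'n expo \<Rightarrow> 'b" assume f: "f \<in> carrier (mpoly B)"
    show "\<exists>c. (\<forall>\<beta>\<in>D. c \<beta> \<in> carrier B) \<and> (\<lambda>\<gamma>. f \<gamma> \<ominus> lin D c \<gamma>) \<in> I"
      using carrier_mpolyD(1)[OF f] Cc
      by (intro exI[of _ "\<lambda>\<beta>. linext f (\<lambda>\<gamma>. C \<gamma> \<beta>)"] conjI reduces_sum D f C) auto
  next
    fix c \<beta> assume c: "\<forall>\<beta>\<in>D. c \<beta> \<in> carrier B" "lin D c \<in> I" and \<beta>: "\<beta> \<in> D"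
    have "lin D c = \<zero>\<^bsub>mpoly B\<^esub>"
    proof (rule ccontr)
      assume nz: "lin D c \<noteq> \<zero>\<^bsub>mpoly B\<^esub>"
      then have "is_lead prec B (lin D c) (lead_exp prec B (lin D c))"
        using lead_exp_is_lead[OF prec ideal_carrier] c(2) by blast
      then have "lead_exp prec B (lin D c) \<in> D" by (auto simp: is_lead_def lin_def split: if_splits)
      then show False using att c(2) nz unfolding attached_set_def by blast
    qed
    then have "lin D c \<beta> = \<zero>" by simp
    then show "c \<beta> = \<zero>" using \<beta> by (simp add: lin_def)
  qed
qed

text \<open>For \<alpha> outside \<open>D\<close>, the monomial minus its normal form is supported
  in \<open>D\<close> and \<alpha>, while its leading exponent avoids \<open>D\<close>. So \<alpha>
  leads, and no exponent above \<alpha> can occur in the normal form.\<close>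

lemma triangular_if_attached:
  assumes D: "finite D" and X: "nf_matrix D X" and prec: "monomial_order prec"
    and att: "attached_set prec B I = D" and \<beta>: "\<beta> \<in> D" "prec \<alpha> \<beta>"
  shows "X \<alpha> \<beta> = \<zero>"
proof (cases "\<alpha> \<in> D")
  case True
  moreover have "\<alpha> \<noteq> \<beta>" using \<beta> prec unfolding monomial_order_def irreflp_def by blast
  ultimately show ?thesis using nf_matrix_diag[OF X] \<beta> by simp
next
  case False
  let ?f = "\<lambda>\<gamma>. term_poly B \<one> \<alpha> \<gamma> \<ominus> lin D (X \<alpha>) \<gamma>"
  note app = reduced_monomial_apply[OF X False]
  show ?thesis
  proof (rule ccontr)
    assume X\<alpha>\<beta>: "X \<alpha> \<beta> \<noteq> \<zero>"
    have "\<alpha> \<noteq> \<beta>" using False \<beta> by blast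
    then have f\<beta>: "?f \<beta> \<noteq> \<zero>"
      using X\<alpha>\<beta> \<beta> nf_matrix_carrier[OF X \<beta>(1), of \<alpha>] by (auto simp: app)
    have fI: "?f \<in> I" using nf_matrix_reduces[OF D X] by (auto simp: reduces_to_def)
    have nz: "?f \<noteq> \<zero>\<^bsub>mpoly B\<^esub>" using f\<beta> by (metis mpoly_simps(1))
    define l where "l = lead_exp prec B ?f"
    have lead: "is_lead prec B ?f l"
      unfolding l_def by (rule lead_exp_is_lead[OF prec ideal_carrier[OF fI] nz])
    have "l \<notin> D" using att fI nz unfolding attached_set_def l_def by blast
    moreover have "?f l \<noteq> \<zero>" using lead by (simp add: is_lead_def)
    ultimately have "l = \<alpha>" by (auto simp: app split: if_splits)
    then have "\<beta> = \<alpha> \<or> prec \<beta> \<alpha>" using lead f\<beta> unfolding is_lead_def by blast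
    then show False
      using \<beta>(2) prec unfolding monomial_order_def irreflp_def transp_def by blast
  qed
qed

end

section \<open>Localisations and quotients\<close>

lemma ring_hom_cringI': "cring R \<Longrightarrow> cring S \<Longrightarrow> h \<in> ring_hom R S \<Longrightarrow> ring_hom_cring R S h"
  by (simp add: ring_hom_cring_def ring_hom_cring_axioms_def)

lemma (in ring_hom_cring) hom_nat_pow [simp]:
  "x \<in> carrier R \<Longrightarrow> h (x [^] (n::nat)) = h x [^]\<^bsub>S\<^esub> n"
  by (induction n) simp_all

lemma (in ring_hom_cring) hom_minus:
  "x \<in> carrier R \<Longrightarrow> y \<in> carrier R \<Longrightarrow> h (x \<ominus> y) = h x \<ominus>\<^bsub>S\<^esub> h y"
  by (simp add: a_minus_def R.minus_eq S.minus_eq)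

lemma (in ring_hom_cring) hom_minus_eq_zero_iff:
  assumes "x \<in> carrier R" "y \<in> carrier R"
  shows "h (x \<ominus> y) = \<zero>\<^bsub>S\<^esub> \<longleftrightarrow> h x = h y"
  unfolding hom_minus[OF assms]
  by (intro S.minus_eq_zero_iff hom_closed assms)

lemma (in ring_hom_cring) hom_Units: "u \<in> Units R \<Longrightarrow> h u \<in> Units S"
proof -
  assume u: "u \<in> Units R"
  then have uc: "u \<in> carrier R" by (rule R.Units_closed)
  then have "h (inv u) \<otimes>\<^bsub>S\<^esub> h u = \<one>\<^bsub>S\<^esub>" "h u \<otimes>\<^bsub>S\<^esub> h (inv u) = \<one>\<^bsub>S\<^esub>"
    using hom_mult[of "inv u" u] hom_mult[of u "inv u"] u uc by simp_all
  moreover have "h u \<in> carrier S" "h (inv u) \<in> carrier S" using u uc by simp_all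
  ultimately show "h u \<in> Units S" unfolding Units_def by blast
qed

lemma (in monoid) Units_r_cancel:
  "x \<in> Units G \<Longrightarrow> y \<in> carrier G \<Longrightarrow> z \<in> carrier G \<Longrightarrow> y \<otimes> x = z \<otimes> x \<longleftrightarrow> y = z"
  by (metis Units_closed Units_inv_closed Units_r_inv m_assoc r_one)

lemma (in monoid) Units_nat_pow: "x \<in> Units G \<Longrightarrow> x [^] (n::nat) \<in> Units G"
  by (induction n) (simp_all add: Units_m_closed)

text \<open>The value at \<open>y = x / f\<^sup>m\<close> is the solution \<open>z\<close> of \<open>z \<cdot> \<phi>(f)\<^sup>m = \<phi>(x)\<close>; it does not
  depend on the chosen fraction.\<close>

lemma localization_lift:
  assumes A: "cring A" and B: "cring B" and loc: "localization_away A f L \<iota>"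
    and \<phi>: "\<phi> \<in> ring_hom A B" and u: "\<phi> f \<in> Units B"
  obtains \<psi> where "\<psi> \<in> ring_hom L B" "\<And>x. x \<in> carrier A \<Longrightarrow> \<psi> (\<iota> x) = \<phi> x"
proof -
  have L: "cring L" and \<iota>: "\<iota> \<in> ring_hom A L" and f: "f \<in> carrier A"
    and frac: "\<And>y. y \<in> carrier L \<Longrightarrow> \<exists>x \<in> carrier A. \<exists>m::nat. y \<otimes>\<^bsub>L\<^esub> (\<iota> f [^]\<^bsub>L\<^esub> m) = \<iota> x"
    and ker: "\<And>x. x \<in> carrier A \<Longrightarrow> \<iota> x = \<zero>\<^bsub>L\<^esub> \<Longrightarrow> \<exists>m::nat. (f [^]\<^bsub>A\<^esub> m) \<otimes>\<^bsub>A\<^esub> x = \<zero>\<^bsub>A\<^esub>"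
    using loc unfolding localization_away_def by blast+
  interpret A: cring A by fact
  interpret B: cring B by fact
  interpret L: cring L by fact
  interpret i: ring_hom_cring A L \<iota> using A L \<iota> by (rule ring_hom_cringI')
  interpret p: ring_hom_cring A B \<phi> using A B \<phi> by (rule ring_hom_cringI')
  have upow: "\<phi> f [^]\<^bsub>B\<^esub> (m::nat) \<in> Units B" for m using u by (rule B.Units_nat_pow)
  define rel where "rel y z \<longleftrightarrow> z \<in> carrier B \<and>
    (\<exists>x\<in>carrier A. \<exists>m::nat. y \<otimes>\<^bsub>L\<^esub> (\<iota> f [^]\<^bsub>L\<^esub> m) = \<iota> x \<and> z \<otimes>\<^bsub>B\<^esub> (\<phi> f [^]\<^bsub>B\<^esub> m) = \<phi> x)" for y z
  have indep: "z \<otimes>\<^bsub>B\<^esub> (\<phi> f [^]\<^bsub>B\<^esub> n) = \<phi> x'"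
    if y: "y \<in> carrier L" and z: "z \<in> carrier B" and x: "x \<in> carrier A" "x' \<in> carrier A"
      and yx: "y \<otimes>\<^bsub>L\<^esub> (\<iota> f [^]\<^bsub>L\<^esub> m) = \<iota> x" and yx': "y \<otimes>\<^bsub>L\<^esub> (\<iota> f [^]\<^bsub>L\<^esub> n) = \<iota> x'"
      and zx: "z \<otimes>\<^bsub>B\<^esub> (\<phi> f [^]\<^bsub>B\<^esub> m) = \<phi> x" for y z x x' and m n :: nat
  proof -
    let ?p = "f [^]\<^bsub>A\<^esub> m" and ?q = "f [^]\<^bsub>A\<^esub> n"
    \<comment> \<open>The difference of the cross-multiplied fractions. It vanishes in
      \<open>L\<close>, hence is killed by a power of \<open>f\<close> in \<open>A\<close>, and the
      image of that power can be cancelled in \<open>B\<close>.\<close>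
    let ?w = "x \<otimes>\<^bsub>A\<^esub> ?q \<ominus>\<^bsub>A\<^esub> x' \<otimes>\<^bsub>A\<^esub> ?p"
    have pq: "?p \<in> carrier A" "?q \<in> carrier A" using f by auto
    have "\<iota> x \<otimes>\<^bsub>L\<^esub> \<iota> ?q = (y \<otimes>\<^bsub>L\<^esub> \<iota> f [^]\<^bsub>L\<^esub> m) \<otimes>\<^bsub>L\<^esub> \<iota> f [^]\<^bsub>L\<^esub> n"
      using yx f by simp
    also have "\<dots> = (y \<otimes>\<^bsub>L\<^esub> \<iota> f [^]\<^bsub>L\<^esub> n) \<otimes>\<^bsub>L\<^esub> \<iota> f [^]\<^bsub>L\<^esub> m"
      using f y by (simp add: L.m_ac)
    also have "\<dots> = \<iota> x' \<otimes>\<^bsub>L\<^esub> \<iota> ?p"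
      using yx' f by simp
    finally have "\<iota> ?w = \<zero>\<^bsub>L\<^esub>" using i.hom_minus_eq_zero_iff x pq by simp
    moreover have w: "?w \<in> carrier A" using x pq by simp
    ultimately obtain N :: nat where N: "(f [^]\<^bsub>A\<^esub> N) \<otimes>\<^bsub>A\<^esub> ?w = \<zero>\<^bsub>A\<^esub>" using ker by blast
    have "\<phi> f [^]\<^bsub>B\<^esub> N \<otimes>\<^bsub>B\<^esub> \<phi> ?w = \<phi> f [^]\<^bsub>B\<^esub> N \<otimes>\<^bsub>B\<^esub> \<zero>\<^bsub>B\<^esub>"
      using arg_cong[OF N, of \<phi>] f w by simp
    then have "\<phi> ?w = \<zero>\<^bsub>B\<^esub>"
      using B.Units_l_cancel[OF upow p.hom_closed[OF w] B.zero_closed] by blast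
    then have "\<phi> x \<otimes>\<^bsub>B\<^esub> \<phi> ?q = \<phi> x' \<otimes>\<^bsub>B\<^esub> \<phi> ?p"
      using p.hom_minus_eq_zero_iff x pq by (simp del: p.hom_nat_pow)
    then have eq: "\<phi> x \<otimes>\<^bsub>B\<^esub> \<phi> f [^]\<^bsub>B\<^esub> n = \<phi> x' \<otimes>\<^bsub>B\<^esub> \<phi> f [^]\<^bsub>B\<^esub> m" using f by simp
    have "(z \<otimes>\<^bsub>B\<^esub> \<phi> f [^]\<^bsub>B\<^esub> n) \<otimes>\<^bsub>B\<^esub> \<phi> f [^]\<^bsub>B\<^esub> m = (z \<otimes>\<^bsub>B\<^esub> \<phi> f [^]\<^bsub>B\<^esub> m) \<otimes>\<^bsub>B\<^esub> \<phi> f [^]\<^bsub>B\<^esub> n"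
      using f z by (simp add: B.m_ac)
    then have "(z \<otimes>\<^bsub>B\<^esub> \<phi> f [^]\<^bsub>B\<^esub> n) \<otimes>\<^bsub>B\<^esub> \<phi> f [^]\<^bsub>B\<^esub> m = \<phi> x' \<otimes>\<^bsub>B\<^esub> \<phi> f [^]\<^bsub>B\<^esub> m"
      unfolding zx eq .
    then show ?thesis using B.Units_r_cancel[OF upow] z f x by simp
  qed
  have ex: "\<exists>z. rel y z" if y: "y \<in> carrier L" for y
  proof -
    obtain x and m :: nat where x: "x \<in> carrier A" "y \<otimes>\<^bsub>L\<^esub> (\<iota> f [^]\<^bsub>L\<^esub> m) = \<iota> x" using frac[OF y] by blast
    have "\<phi> x \<otimes>\<^bsub>B\<^esub> inv\<^bsub>B\<^esub> (\<phi> f [^]\<^bsub>B\<^esub> m) \<otimes>\<^bsub>B\<^esub> (\<phi> f [^]\<^bsub>B\<^esub> m) = \<phi> x"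
      using upow x f by (simp add: B.m_assoc B.Units_l_inv)
    then show ?thesis using x upow unfolding rel_def by (meson B.Units_inv_closed B.m_closed p.hom_closed)
  qed
  have uniq: "z = z'" if y: "y \<in> carrier L" and z: "rel y z" and z': "rel y z'" for y z z'
  proof -
    obtain x and m :: nat where x: "x \<in> carrier A" "y \<otimes>\<^bsub>L\<^esub> (\<iota> f [^]\<^bsub>L\<^esub> m) = \<iota> x"
      "z \<otimes>\<^bsub>B\<^esub> (\<phi> f [^]\<^bsub>B\<^esub> m) = \<phi> x" using z unfolding rel_def by blast
    obtain x' and n :: nat where x': "x' \<in> carrier A" "y \<otimes>\<^bsub>L\<^esub> (\<iota> f [^]\<^bsub>L\<^esub> n) = \<iota> x'"
      "z' \<otimes>\<^bsub>B\<^esub> (\<phi> f [^]\<^bsub>B\<^esub> n) = \<phi> x'" using z' unfolding rel_def by blast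
    have zc: "z \<in> carrier B" "z' \<in> carrier B" using z z' by (auto simp: rel_def)
    have "z \<otimes>\<^bsub>B\<^esub> (\<phi> f [^]\<^bsub>B\<^esub> n) = \<phi> x'" by (rule indep[OF y zc(1) x(1) x'(1) x(2) x'(2) x(3)])
    then show ?thesis using x'(3) B.Units_r_cancel[OF upow] zc by metis
  qed
  define \<psi> where "\<psi> y = (SOME z. rel y z)" for y
  have \<psi>: "rel y (\<psi> y)" if "y \<in> carrier L" for y
    unfolding \<psi>_def using ex[OF that] by (rule someI_ex)
  have \<psi>_eq: "\<psi> y = z" if "y \<in> carrier L" "rel y z" for y z using uniq[OF that(1) \<psi>[OF that(1)] that(2)] .
  have rel_\<iota>: "rel (\<iota> x) (\<phi> x)" if "x \<in> carrier A" for x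
    unfolding rel_def using that by (intro conjI bexI[of _ x] exI[of _ 0]) auto
  have rel_op: "rel (y \<otimes>\<^bsub>L\<^esub> y') (z \<otimes>\<^bsub>B\<^esub> z')" "rel (y \<oplus>\<^bsub>L\<^esub> y') (z \<oplus>\<^bsub>B\<^esub> z')"
    if y: "y \<in> carrier L" "y' \<in> carrier L" and z: "rel y z" and z': "rel y' z'" for y y' z z'
  proof -
    obtain x and m :: nat where x: "x \<in> carrier A" "y \<otimes>\<^bsub>L\<^esub> (\<iota> f [^]\<^bsub>L\<^esub> m) = \<iota> x"
      "z \<otimes>\<^bsub>B\<^esub> (\<phi> f [^]\<^bsub>B\<^esub> m) = \<phi> x" using z unfolding rel_def by blast
    obtain x' and n :: nat where x': "x' \<in> carrier A" "y' \<otimes>\<^bsub>L\<^esub> (\<iota> f [^]\<^bsub>L\<^esub> n) = \<iota> x'"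
      "z' \<otimes>\<^bsub>B\<^esub> (\<phi> f [^]\<^bsub>B\<^esub> n) = \<phi> x'" using z' unfolding rel_def by blast
    have zc: "z \<in> carrier B" "z' \<in> carrier B" using z z' by (auto simp: rel_def)
    \<comment> \<open>Products and sums of two fractions are both taken over the common denominator
      with exponent \<open>m + n\<close>.\<close>
    have L_ids: "(c \<otimes>\<^bsub>L\<^esub> d) \<otimes>\<^bsub>L\<^esub> (p \<otimes>\<^bsub>L\<^esub> q) = (c \<otimes>\<^bsub>L\<^esub> p) \<otimes>\<^bsub>L\<^esub> (d \<otimes>\<^bsub>L\<^esub> q)"
      "(c \<oplus>\<^bsub>L\<^esub> d) \<otimes>\<^bsub>L\<^esub> (p \<otimes>\<^bsub>L\<^esub> q) = (c \<otimes>\<^bsub>L\<^esub> p) \<otimes>\<^bsub>L\<^esub> q \<oplus>\<^bsub>L\<^esub> (d \<otimes>\<^bsub>L\<^esub> q) \<otimes>\<^bsub>L\<^esub> p"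
      if "c \<in> carrier L" "d \<in> carrier L" "p \<in> carrier L" "q \<in> carrier L" for c d p q
      using that by algebra+
    have B_ids: "(c \<otimes>\<^bsub>B\<^esub> d) \<otimes>\<^bsub>B\<^esub> (p \<otimes>\<^bsub>B\<^esub> q) = (c \<otimes>\<^bsub>B\<^esub> p) \<otimes>\<^bsub>B\<^esub> (d \<otimes>\<^bsub>B\<^esub> q)"
      "(c \<oplus>\<^bsub>B\<^esub> d) \<otimes>\<^bsub>B\<^esub> (p \<otimes>\<^bsub>B\<^esub> q) = (c \<otimes>\<^bsub>B\<^esub> p) \<otimes>\<^bsub>B\<^esub> q \<oplus>\<^bsub>B\<^esub> (d \<otimes>\<^bsub>B\<^esub> q) \<otimes>\<^bsub>B\<^esub> p"
      if "c \<in> carrier B" "d \<in> carrier B" "p \<in> carrier B" "q \<in> carrier B" for c d p q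
      using that by algebra+
    have 1: "(y \<otimes>\<^bsub>L\<^esub> y') \<otimes>\<^bsub>L\<^esub> (\<iota> f [^]\<^bsub>L\<^esub> (m + n)) = \<iota> (x \<otimes>\<^bsub>A\<^esub> x')"
      using f x(1) x'(1) y by (simp add: L.nat_pow_mult[symmetric] L_ids[of y y' "\<iota> f [^]\<^bsub>L\<^esub> m" "\<iota> f [^]\<^bsub>L\<^esub> n"] x(2) x'(2))
    have 2: "(z \<otimes>\<^bsub>B\<^esub> z') \<otimes>\<^bsub>B\<^esub> (\<phi> f [^]\<^bsub>B\<^esub> (m + n)) = \<phi> (x \<otimes>\<^bsub>A\<^esub> x')"
      using f x(1) x'(1) zc by (simp add: B.nat_pow_mult[symmetric] B_ids[of z z' "\<phi> f [^]\<^bsub>B\<^esub> m" "\<phi> f [^]\<^bsub>B\<^esub> n"] x(3) x'(3))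
    show "rel (y \<otimes>\<^bsub>L\<^esub> y') (z \<otimes>\<^bsub>B\<^esub> z')"
      unfolding rel_def using 1 2 zc x(1) x'(1) by blast
    let ?x = "x \<otimes>\<^bsub>A\<^esub> (f [^]\<^bsub>A\<^esub> n) \<oplus>\<^bsub>A\<^esub> x' \<otimes>\<^bsub>A\<^esub> (f [^]\<^bsub>A\<^esub> m)"
    have 3: "(y \<oplus>\<^bsub>L\<^esub> y') \<otimes>\<^bsub>L\<^esub> (\<iota> f [^]\<^bsub>L\<^esub> (m + n)) = \<iota> ?x"
      using f x(1) x'(1) y by (simp add: L.nat_pow_mult[symmetric] L_ids[of y y' "\<iota> f [^]\<^bsub>L\<^esub> m" "\<iota> f [^]\<^bsub>L\<^esub> n"] x(2) x'(2))
    have 4: "(z \<oplus>\<^bsub>B\<^esub> z') \<otimes>\<^bsub>B\<^esub> (\<phi> f [^]\<^bsub>B\<^esub> (m + n)) = \<phi> ?x"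
      using f x(1) x'(1) zc by (simp add: B.nat_pow_mult[symmetric] B_ids[of z z' "\<phi> f [^]\<^bsub>B\<^esub> m" "\<phi> f [^]\<^bsub>B\<^esub> n"] x(3) x'(3))
    show "rel (y \<oplus>\<^bsub>L\<^esub> y') (z \<oplus>\<^bsub>B\<^esub> z')"
      unfolding rel_def using 3 4 zc x(1) x'(1) f by (intro conjI bexI[of _ ?x] exI[of _ "m + n"]) auto
  qed
  show ?thesis
  proof
    show "\<psi> \<in> ring_hom L B"
    proof (rule ring_hom_memI)
      fix y y' assume y: "y \<in> carrier L" "y' \<in> carrier L"
      show "\<psi> y \<in> carrier B" using \<psi>[OF y(1)] by (simp add: rel_def)
      show "\<psi> (y \<otimes>\<^bsub>L\<^esub> y') = \<psi> y \<otimes>\<^bsub>B\<^esub> \<psi> y'" "\<psi> (y \<oplus>\<^bsub>L\<^esub> y') = \<psi> y \<oplus>\<^bsub>B\<^esub> \<psi> y'"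
        using y by (auto intro!: \<psi>_eq rel_op \<psi>)
    next
      show "\<psi> \<one>\<^bsub>L\<^esub> = \<one>\<^bsub>B\<^esub>" using \<psi>_eq[OF _ rel_\<iota>[OF A.one_closed]] by simp
    qed
    show "\<psi> (\<iota> x) = \<phi> x" if "x \<in> carrier A" for x using \<psi>_eq[OF _ rel_\<iota>[OF that]] that by simp
  qed
qed

text \<open>Multiplied by a power of \<open>\<iota> f\<close>, every element of \<open>L\<close>
  comes from \<open>A\<close>, and the image of that power in \<open>B\<close> can be cancelled.
  This is one half of injectivity in the representability proof.\<close>

lemma localization_hom_eq:
  assumes B: "cring B" and loc: "localization_away A f L \<iota>"
    and h: "\<psi> \<in> ring_hom L B" "\<psi>' \<in> ring_hom L B"
    and eq: "\<And>x. x \<in> carrier A \<Longrightarrow> \<psi> (\<iota> x) = \<psi>' (\<iota> x)" and y: "y \<in> carrier L"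
  shows "\<psi> y = \<psi>' y"
proof -
  have L: "cring L" and \<iota>: "\<iota> \<in> ring_hom A L" and f: "f \<in> carrier A" and u: "\<iota> f \<in> Units L"
    using loc by (auto simp: localization_away_def)
  obtain x and m :: nat where x: "x \<in> carrier A" "y \<otimes>\<^bsub>L\<^esub> (\<iota> f [^]\<^bsub>L\<^esub> m) = \<iota> x"
    using loc y unfolding localization_away_def by blast
  interpret p: ring_hom_cring L B \<psi> using L B h(1) by (rule ring_hom_cringI')
  interpret q: ring_hom_cring L B \<psi>' using L B h(2) by (rule ring_hom_cringI')
  have uc: "\<iota> f \<in> carrier L" using u by auto
  have unit: "\<psi> (\<iota> f) [^]\<^bsub>B\<^esub> m \<in> Units B"
    using p.hom_Units[OF u] by (rule p.S.Units_nat_pow)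
  have "\<psi> y \<otimes>\<^bsub>B\<^esub> \<psi> (\<iota> f) [^]\<^bsub>B\<^esub> m = \<psi> (\<iota> x)" using y uc by (simp flip: x(2))
  also have "\<dots> = \<psi>' (\<iota> x)" by (rule eq[OF x(1)])
  also have "\<dots> = \<psi>' y \<otimes>\<^bsub>B\<^esub> \<psi>' (\<iota> f) [^]\<^bsub>B\<^esub> m" using y uc by (simp flip: x(2))
  also have "\<psi>' (\<iota> f) = \<psi> (\<iota> f)" using eq[OF f] by simp
  finally show ?thesis using p.S.Units_r_cancel[OF unit] y by simp
qed

text \<open>The kernel of \<pi> is generated by \<open>E\<close>, so it lies in the kernel of
  \<psi>; hence \<psi> is constant on the fibres of \<pi> and any preimage may be chosen.\<close>

lemma quotient_lift:
  assumes L: "cring L" and B: "cring B" and quot: "quotient_by L E C \<pi>"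
    and \<psi>: "\<psi> \<in> ring_hom L B" and E: "\<And>e. e \<in> E \<Longrightarrow> \<psi> e = \<zero>\<^bsub>B\<^esub>"
  obtains \<theta> where "\<theta> \<in> ring_hom C B" "\<And>y. y \<in> carrier L \<Longrightarrow> \<theta> (\<pi> y) = \<psi> y"
proof -
  have C: "cring C" and \<pi>: "\<pi> \<in> ring_hom L C" and surj: "\<pi> ` carrier L = carrier C"
    and EL: "E \<subseteq> carrier L" and ker: "a_kernel L C \<pi> = Idl\<^bsub>L\<^esub> E"
    using quot by (auto simp: quotient_by_def)
  interpret L: cring L by fact
  interpret p: ring_hom_cring L B \<psi> using L B \<psi> by (rule ring_hom_cringI')
  interpret q: ring_hom_cring L C \<pi> using L C \<pi> by (rule ring_hom_cringI')
  have "ideal (a_kernel L B \<psi>) L"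
    by (intro ring_hom_ring.kernel_is_ideal ring_hom_ringI2 L.ring_axioms p.S.ring_axioms \<psi>)
  moreover have "E \<subseteq> a_kernel L B \<psi>" using E EL unfolding a_kernel_def' by blast
  ultimately have sub: "Idl\<^bsub>L\<^esub> E \<subseteq> a_kernel L B \<psi>" by (rule L.genideal_minimal)
  have wd: "\<psi> y = \<psi> y'" if y: "y \<in> carrier L" "y' \<in> carrier L" and eq: "\<pi> y = \<pi> y'" for y y'
  proof -
    have "y \<ominus>\<^bsub>L\<^esub> y' \<in> carrier L" using y by simp
    then have "y \<ominus>\<^bsub>L\<^esub> y' \<in> a_kernel L C \<pi>"
      using q.hom_minus_eq_zero_iff[OF y] eq unfolding a_kernel_def' by blast
    then have "y \<ominus>\<^bsub>L\<^esub> y' \<in> a_kernel L B \<psi>" using sub ker by blast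
    then show ?thesis using p.hom_minus_eq_zero_iff[OF y] unfolding a_kernel_def' by blast
  qed
  define \<theta> where "\<theta> z = \<psi> (inv_into (carrier L) \<pi> z)" for z
  have \<theta>: "\<theta> (\<pi> y) = \<psi> y" if "y \<in> carrier L" for y
    unfolding \<theta>_def using that by (intro wd inv_into_into f_inv_into_f) auto
  have "\<theta> \<in> ring_hom C B"
  proof (rule ring_hom_memI)
    fix z z' assume "z \<in> carrier C" "z' \<in> carrier C"
    then obtain y y' where y: "y \<in> carrier L" "y' \<in> carrier L" "z = \<pi> y" "z' = \<pi> y'"
      unfolding surj[symmetric] by blast
    show "\<theta> z \<in> carrier B" using y \<theta> by simp
    show "\<theta> (z \<otimes>\<^bsub>C\<^esub> z') = \<theta> z \<otimes>\<^bsub>B\<^esub> \<theta> z'" using y \<theta>[of "y \<otimes>\<^bsub>L\<^esub> y'"] \<theta> by simp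
    show "\<theta> (z \<oplus>\<^bsub>C\<^esub> z') = \<theta> z \<oplus>\<^bsub>B\<^esub> \<theta> z'" using y \<theta>[of "y \<oplus>\<^bsub>L\<^esub> y'"] \<theta> by simp
  next
    show "\<theta> \<one>\<^bsub>C\<^esub> = \<one>\<^bsub>B\<^esub>" using \<theta>[of "\<one>\<^bsub>L\<^esub>"] by simp
  qed
  then show ?thesis using \<theta> that by blast
qed

section \<open>Points of the intersection\<close>

lemma mpoly_idealI: "cring B \<Longrightarrow> ideal I (mpoly B) \<Longrightarrow> mpoly_ideal B I"
  by (simp add: mpoly_ideal_def mpoly_ideal_axioms_def coeff_ring_def)

lemma hilb_mpoly_ideal: "cring B \<Longrightarrow> I \<in> hilb D B \<Longrightarrow> mpoly_ideal B I"
  by (simp add: hilb_def mpoly_idealI)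

text \<open>A single \<open>X\<close> serves all row sets \<open>Q\<close>:
  \<open>coord_matrix\<close> merely truncates it, so rows outside \<open>Q\<close> stay
  accessible.\<close>

lemma hilb_nf_matrix:
  assumes "cring B" "finite D" "I \<in> hilb D B"
  obtains X where "mpoly_ideal.nf_matrix B I D X"
    "\<And>Q. coord_matrix B Q D I = (\<lambda>ij\<in>Q \<times> D. X (fst ij) (snd ij))"
proof -
  interpret mpoly_ideal B I using assms by (intro hilb_mpoly_ideal)
  obtain X where "nf_matrix D X"
    using assms is_monomial_basis_iff_nf_matrix by (auto simp: hilb_def)
  then show ?thesis using that coord_matrix_eq[OF assms(2)] by blast
qed

lemma nf_matrix_hilb:
  assumes "mpoly_ideal B I" "finite D" "mpoly_ideal.nf_matrix B I D X"
  shows "I \<in> hilb D B"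
  using assms mpoly_ideal.is_monomial_basis_iff_nf_matrix mpoly_ideal.ideal
  unfolding hilb_def by blast

lemma coord_matrix_closed:
  assumes "cring B" "finite D" "I \<in> hilb D B"
  shows "coord_matrix B Q D I \<in> Q \<times> D \<rightarrow>\<^sub>E carrier B"
proof -
  interpret mpoly_ideal B I using assms by (intro hilb_mpoly_ideal)
  obtain X where X: "nf_matrix D X" "coord_matrix B Q D I = (\<lambda>ij\<in>Q \<times> D. X (fst ij) (snd ij))"
    using hilb_nf_matrix[OF assms] by metis
  show ?thesis unfolding X(2) using nf_matrix_carrier[OF X(1)] by auto
qed

lemma submat_closed:
  "X \<in> R \<times> C \<rightarrow>\<^sub>E S \<Longrightarrow> R' \<subseteq> R \<Longrightarrow> submat R' C X \<in> R' \<times> C \<rightarrow>\<^sub>E S"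
  unfolding submat_def by (auto simp: PiE_def Pi_def)

text \<open>Matches the convention for the zero ring in \<open>hilb_prec\<close>. As
  \<open>\<one>\<close> equals \<open>\<zero>\<close>, the zero matrix also counts as the identity
  on \<open>D\<close>.\<close>

lemma hilb_zero_ring:
  fixes B :: "'b ring" and I :: "(('n::finite) expo \<Rightarrow> 'b) set"
  assumes "mpoly_ideal B I" "finite D" "carrier B = {\<zero>\<^bsub>B\<^esub>}"
  shows "I \<in> hilb D B"
proof (rule nf_matrix_hilb[OF assms(1,2)])
  interpret mpoly_ideal B I by fact
  have all: "x = \<zero>\<^bsub>B\<^esub>" if "x \<in> carrier B" for x using assms(3) that by blast
  have 1: "\<one>\<^bsub>B\<^esub> = \<zero>\<^bsub>B\<^esub>" using all by blast
  show "nf_matrix D (\<lambda>\<alpha> \<beta>. \<zero>\<^bsub>B\<^esub>)"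
    unfolding nf_matrix_def
  proof (intro conjI ballI allI)
    fix f :: "'n expo \<Rightarrow> 'b" assume f: "f \<in> carrier (mpoly B)"
    note fc = carrier_mpolyD(1)[OF f]
    have "f = (\<lambda>\<alpha>. \<zero>\<^bsub>B\<^esub>)" using all[OF fc] by blast
    moreover have "linext f (\<lambda>\<alpha>. \<zero>\<^bsub>B\<^esub>) = \<zero>\<^bsub>B\<^esub>" using fc by (intro all linext_closed) auto
    ultimately show "(f \<in> I) = (\<forall>\<beta>\<in>D. linext f (\<lambda>\<alpha>. \<zero>\<^bsub>B\<^esub>) = \<zero>\<^bsub>B\<^esub>)" using ideal_zero by auto
  qed (auto simp: 1)
qed

section \<open>Base change of ideals and of their coordinate matrices\<close>

lemma base_change_superset: "f \<in> I \<Longrightarrow> \<phi> \<circ> f \<in> base_change B \<phi> I"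
  unfolding base_change_def genideal_def by blast

lemma base_change_minimal:
  "ideal J (mpoly B) \<Longrightarrow> (\<And>f. f \<in> I \<Longrightarrow> \<phi> \<circ> f \<in> J) \<Longrightarrow> base_change B \<phi> I \<subseteq> J"
  unfolding base_change_def genideal_def by blast

text \<open>Maps in \<open>k_hom\<close> are extensional while composites of the structure maps need
  not be; this allows passing to a restriction without changing the ideal.\<close>

lemma base_change_cong:
  assumes "\<And>f. f \<in> I \<Longrightarrow> f \<in> carrier (mpoly A)" "\<And>x. x \<in> carrier A \<Longrightarrow> \<phi> x = \<psi> x"
  shows "base_change B \<phi> I = base_change B \<psi> I"
proof -
  have "(\<lambda>f. \<phi> \<circ> f) ` I = (\<lambda>f. \<psi> \<circ> f) ` I"
    using assms by (intro image_cong refl ext) (auto simp: carrier_mpoly)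
  then show ?thesis by (simp add: base_change_def)
qed

text \<open>The image under \<phi> of a relation in \<open>I\<close> is a relation in the extended
  ideal, and reductions there are unique. That \<open>D\<close> remains a basis is a hypothesis; it
  will come from representability or from an invertible square block.\<close>

lemma nf_matrix_base_change:
  assumes A: "cring A" and B: "cring B" and \<phi>: "\<phi> \<in> ring_hom A B" and D: "finite D"
    and I: "mpoly_ideal A I" and X: "mpoly_ideal.nf_matrix A I D X"
    and J: "mpoly_ideal B (base_change B \<phi> I)"
    and Y: "mpoly_ideal.nf_matrix B (base_change B \<phi> I) D Y" and \<beta>: "\<beta> \<in> D"
  shows "Y \<alpha> \<beta> = \<phi> (X \<alpha> \<beta>)"
proof -
  interpret I: mpoly_ideal A I by fact
  interpret J: mpoly_ideal B "base_change B \<phi> I" by fact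
  interpret p: ring_hom_cring A B \<phi> using A B \<phi> by (rule ring_hom_cringI')
  note Xc = I.nf_matrix_carrier[OF X]
  have "(\<lambda>\<gamma>. term_poly A \<one>\<^bsub>A\<^esub> \<alpha> \<gamma> \<ominus>\<^bsub>A\<^esub> I.lin D (X \<alpha>) \<gamma>) \<in> I"
    using I.nf_matrix_reduces[OF D X] by (simp add: I.reduces_to_def)
  then have "\<phi> \<circ> (\<lambda>\<gamma>. term_poly A \<one>\<^bsub>A\<^esub> \<alpha> \<gamma> \<ominus>\<^bsub>A\<^esub> I.lin D (X \<alpha>) \<gamma>) \<in> base_change B \<phi> I"
    by (rule base_change_superset)
  also have "\<phi> \<circ> (\<lambda>\<gamma>. term_poly A \<one>\<^bsub>A\<^esub> \<alpha> \<gamma> \<ominus>\<^bsub>A\<^esub> I.lin D (X \<alpha>) \<gamma>) =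
      (\<lambda>\<gamma>. term_poly B \<one>\<^bsub>B\<^esub> \<alpha> \<gamma> \<ominus>\<^bsub>B\<^esub> J.lin D (\<lambda>\<beta>. \<phi> (X \<alpha> \<beta>)) \<gamma>)"
  proof
    fix \<gamma>
    have "term_poly A \<one>\<^bsub>A\<^esub> \<alpha> \<gamma> \<in> carrier A" "I.lin D (X \<alpha>) \<gamma> \<in> carrier A"
      using Xc by (auto simp: term_poly_def I.lin_def)
    then have "\<phi> (term_poly A \<one>\<^bsub>A\<^esub> \<alpha> \<gamma> \<ominus>\<^bsub>A\<^esub> I.lin D (X \<alpha>) \<gamma>) =
        \<phi> (term_poly A \<one>\<^bsub>A\<^esub> \<alpha> \<gamma>) \<ominus>\<^bsub>B\<^esub> \<phi> (I.lin D (X \<alpha>) \<gamma>)"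
      by (rule p.hom_minus)
    also have "\<phi> (term_poly A \<one>\<^bsub>A\<^esub> \<alpha> \<gamma>) = term_poly B \<one>\<^bsub>B\<^esub> \<alpha> \<gamma>" by (simp add: term_poly_def)
    also have "\<phi> (I.lin D (X \<alpha>) \<gamma>) = J.lin D (\<lambda>\<beta>. \<phi> (X \<alpha> \<beta>)) \<gamma>"
      by (simp add: I.lin_def J.lin_def)
    finally show "(\<phi> \<circ> (\<lambda>\<gamma>. term_poly A \<one>\<^bsub>A\<^esub> \<alpha> \<gamma> \<ominus>\<^bsub>A\<^esub> I.lin D (X \<alpha>) \<gamma>)) \<gamma> =
        term_poly B \<one>\<^bsub>B\<^esub> \<alpha> \<gamma> \<ominus>\<^bsub>B\<^esub> J.lin D (\<lambda>\<beta>. \<phi> (X \<alpha> \<beta>)) \<gamma>" by simp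
  qed
  finally have "J.reduces_to D \<alpha> (\<lambda>\<beta>. \<phi> (X \<alpha> \<beta>))"
    using Xc by (simp add: J.reduces_to_def)
  then show ?thesis unfolding J.reduces_to_iff[OF D Y] using \<beta> by blast
qed

lemma coord_matrix_base_change:
  assumes A: "cring A" and B: "cring B" and \<phi>: "\<phi> \<in> ring_hom A B" and D: "finite D"
    and I: "I \<in> hilb D A" and J: "base_change B \<phi> I \<in> hilb D B"
  shows "coord_matrix B Q D (base_change B \<phi> I) = restrict (\<phi> \<circ> coord_matrix A Q D I) (Q \<times> D)"
proof -
  obtain X where X: "mpoly_ideal.nf_matrix A I D X"
    "coord_matrix A Q D I = (\<lambda>ij\<in>Q \<times> D. X (fst ij) (snd ij))"
    using hilb_nf_matrix[OF A D I] by metis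
  obtain Y where Y: "mpoly_ideal.nf_matrix B (base_change B \<phi> I) D Y"
    "coord_matrix B Q D (base_change B \<phi> I) = (\<lambda>ij\<in>Q \<times> D. Y (fst ij) (snd ij))"
    using hilb_nf_matrix[OF B D J] by metis
  show ?thesis
    unfolding X(2) Y(2)
    using nf_matrix_base_change[OF A B \<phi> D hilb_mpoly_ideal[OF A I] X(1) hilb_mpoly_ideal[OF B J] Y(1)]
    by (auto simp: restrict_def)
qed

text \<open>One inclusion holds on generators. For the other, elements of the intermediate ideal are
  not written out through generators: their coordinates vanish, \<psi> preserves this, and the
  matrix over \<open>B\<close> is the image of the one over \<open>C\<close>.\<close>

lemma base_change_comp:
  assumes A: "cring A" and C: "cring C" and B: "cring B" and D: "finite D"
    and \<phi>: "\<phi> \<in> ring_hom A C" and \<psi>: "\<psi> \<in> ring_hom C B"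
    and I: "I \<in> hilb D A" and J: "base_change C \<phi> I \<in> hilb D C"
    and K: "base_change B (\<psi> \<circ> \<phi>) I \<in> hilb D B"
  shows "base_change B \<psi> (base_change C \<phi> I) = base_change B (\<psi> \<circ> \<phi>) I"
proof
  let ?J = "base_change C \<phi> I" and ?K = "base_change B (\<psi> \<circ> \<phi>) I"
  interpret J: mpoly_ideal C ?J using hilb_mpoly_ideal[OF C J] .
  interpret K: mpoly_ideal B ?K using hilb_mpoly_ideal[OF B K] .
  interpret p: ring_hom_cring C B \<psi> using C B \<psi> by (rule ring_hom_cringI')
  obtain X where X: "mpoly_ideal.nf_matrix A I D X" using hilb_nf_matrix[OF A D I] by metis
  obtain Y where Y: "J.nf_matrix D Y" using hilb_nf_matrix[OF C D J] by metis
  obtain Z where Z: "K.nf_matrix D Z" using hilb_nf_matrix[OF B D K] by metis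
  note XY = nf_matrix_base_change[OF A C \<phi> D hilb_mpoly_ideal[OF A I] X J.mpoly_ideal_axioms Y]
  note XZ = nf_matrix_base_change[OF A B ring_hom_trans[OF \<phi> \<psi>] D hilb_mpoly_ideal[OF A I] X K.mpoly_ideal_axioms Z]
  have YZ: "Z \<alpha> \<beta> = \<psi> (Y \<alpha> \<beta>)" if "\<beta> \<in> D" for \<alpha> \<beta> using XY[OF that] XZ[OF that] by simp
  show "base_change B \<psi> ?J \<subseteq> ?K"
  proof (rule base_change_minimal[OF K.ideal])
    fix f assume f: "f \<in> ?J"
    note fc = J.carrier_mpolyD[OF J.ideal_carrier[OF f]]
    have g: "\<psi> \<circ> f \<in> carrier (mpoly B)"
      using fc by (auto simp: carrier_mpoly intro: finite_subset[OF _ fc(2)])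
    have "K.linext (\<psi> \<circ> f) (\<lambda>\<alpha>. Z \<alpha> \<beta>) = \<zero>\<^bsub>B\<^esub>" if \<beta>: "\<beta> \<in> D" for \<beta>
    proof -
      note Yc = J.nf_matrix_carrier[OF Y \<beta>] and Zc = K.nf_matrix_carrier[OF Z \<beta>]
      \<comment> \<open>The support of \<open>f\<close> and not that of its image, which may be
        smaller.\<close>
      let ?S = "{\<alpha>. f \<alpha> \<noteq> \<zero>\<^bsub>C\<^esub>}"
      have "K.linext (\<psi> \<circ> f) (\<lambda>\<alpha>. Z \<alpha> \<beta>) = (\<Oplus>\<^bsub>B\<^esub>\<alpha>\<in>?S. (\<psi> \<circ> f) \<alpha> \<otimes>\<^bsub>B\<^esub> Z \<alpha> \<beta>)"
        using fc Zc by (intro K.linext_superset) auto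
      also have "\<dots> = (\<Oplus>\<^bsub>B\<^esub>\<alpha>\<in>?S. \<psi> (f \<alpha> \<otimes>\<^bsub>C\<^esub> Y \<alpha> \<beta>))"
        using fc Yc YZ[OF \<beta>] by (intro K.finsum_cong') auto
      also have "\<dots> = \<psi> (J.linext f (\<lambda>\<alpha>. Y \<alpha> \<beta>))"
        unfolding J.linext_def using fc Yc by (subst p.hom_finsum) (auto simp: o_def)
      also have "J.linext f (\<lambda>\<alpha>. Y \<alpha> \<beta>) = \<zero>\<^bsub>C\<^esub>"
        using J.nf_matrix_kernel[OF Y J.ideal_carrier[OF f]] f \<beta> by blast
      finally show ?thesis unfolding p.hom_zero .
    qed
    then show "\<psi> \<circ> f \<in> ?K" using K.nf_matrix_kernel[OF Z g] by blast
  qed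
  have "(\<psi> \<circ> \<phi>) \<circ> f \<in> base_change B \<psi> ?J" if "f \<in> I" for f
    using base_change_superset[OF base_change_superset[OF that]] by (simp add: comp_assoc)
  then show "?K \<subseteq> base_change B \<psi> ?J"
    unfolding base_change_def genideal_def by blast
qed

text \<open>Any homomorphism \<phi> out of \<open>A\<close> makes its target a
  \<open>k\<close>-algebra through \<open>\<phi> \<circ> a\<close>, so the bijection in
  \<open>represents\<close> applies to \<phi>. Thus the monomial basis of the universal quotient
  survives every base change.\<close>

lemma represents_base_change:
  fixes A B :: "'b ring"
  assumes rep: "represents k A a \<I> (hilb D)" and B: "cring B" and \<phi>: "\<phi> \<in> ring_hom A B"
  shows "base_change B \<phi> \<I> \<in> hilb D B"
proof -
  have A: "cring A" and a: "a \<in> ring_hom k A" and I: "\<I> \<in> hilb D A"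
    using rep by (auto simp: represents_def k_algebra_def)
  interpret A: cring A by fact
  let ?\<phi> = "restrict \<phi> (carrier A)"
  have "k_algebra k B (\<phi> \<circ> a)"
    using B ring_hom_trans[OF a \<phi>] by (simp add: k_algebra_def)
  then have bij: "bij_betw (\<lambda>\<phi>. base_change B \<phi> \<I>) (k_hom k A a B (\<phi> \<circ> a)) (hilb D B)"
    using rep by (simp add: represents_def)
  have "?\<phi> \<in> ring_hom A B" using A.ring_hom_restrict[OF \<phi>] by simp
  then have "?\<phi> \<in> k_hom k A a B (\<phi> \<circ> a)"
    using ring_hom_closed[OF a] by (auto simp: k_hom_def)
  then have "base_change B ?\<phi> \<I> \<in> hilb D B" using bij unfolding bij_betw_def by blast
  also have "base_change B ?\<phi> \<I> = base_change B \<phi> \<I>"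
    using mpoly_ideal.ideal_carrier[OF hilb_mpoly_ideal[OF A I]] by (intro base_change_cong) auto
  finally show ?thesis .
qed

text \<open>\<Xi> is the set Pi of the informal statement. \<open>N\<close> and \<open>M\<close> act
  by making \<open>Q\<close> contain \<Xi>, \<Delta> and the border of \<Delta>. \<open>Q\<close>
  may be infinite, since matrix products sum over \<Delta> or \<Xi>. A nonempty \<Delta> contains
  the exponent 0, where the induction behind triangularity starts.\<close>

locale standard_sets =
  fixes prec :: "('n::finite) expo \<Rightarrow> 'n expo \<Rightarrow> bool" and \<Delta> \<Xi> Q :: "'n expo set"
  assumes prec: "monomial_order prec" and \<Delta>: "standard_set \<Delta>" "finite \<Delta>" "\<Delta> \<noteq> {}"
    and \<Xi>: "finite \<Xi>" "\<Xi> \<subseteq> Q" and \<Delta>Q: "\<Delta> \<subseteq> Q" "border \<Delta> \<subseteq> Q"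
begin

lemma hilb_if_invertible:
  assumes B: "cring B" and I: "I \<in> hilb \<Xi> B"
    and inv: "mat_invertible B \<Delta> \<Xi> (submat \<Delta> \<Xi> (coord_matrix B Q \<Xi> I))"
  shows "I \<in> hilb \<Delta> B"
    and "coord_matrix B Q \<Delta> I = mat_mult B Q \<Xi> \<Delta> (coord_matrix B Q \<Xi> I)
      (mat_inv B \<Delta> \<Xi> (submat \<Delta> \<Xi> (coord_matrix B Q \<Xi> I)))"
    and "submat \<Xi> \<Delta> (coord_matrix B Q \<Delta> I) =
      mat_inv B \<Delta> \<Xi> (submat \<Delta> \<Xi> (coord_matrix B Q \<Xi> I))"
proof -
  interpret mpoly_ideal B I using B I by (rule hilb_mpoly_ideal)
  obtain U where U: "nf_matrix \<Xi> U" "coord_matrix B Q \<Xi> I = (\<lambda>ij\<in>Q \<times> \<Xi>. U (fst ij) (snd ij))"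
    using hilb_nf_matrix[OF B \<Xi>(1) I] by metis
  note Uc = nf_matrix_carrier[OF U(1)]
  let ?U = "submat \<Delta> \<Xi> (coord_matrix B Q \<Xi> I)"
  define V where "V = mat_inv B \<Delta> \<Xi> ?U"
  have U_sub: "?U (\<alpha>, \<xi>) = U \<alpha> \<xi>" if "\<alpha> \<in> \<Delta>" "\<xi> \<in> \<Xi>" for \<alpha> \<xi>
    using that \<Delta>Q by (auto simp: submat_def U(2))
  have V: "is_mat_inv B \<Delta> \<Xi> ?U V"
    unfolding V_def by (intro mat_inv_is_mat_inv B \<Delta> \<Xi> inv)
  note V = this[unfolded is_mat_inv_iff[OF B]]
  have Vc: "V (\<xi>, \<beta>) \<in> carrier B" if "\<xi> \<in> \<Xi>" "\<beta> \<in> \<Delta>" for \<xi> \<beta> using V that by auto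
  have UV: "(\<Oplus>\<^bsub>B\<^esub>\<xi>\<in>\<Xi>. U \<alpha> \<xi> \<otimes>\<^bsub>B\<^esub> V (\<xi>, \<beta>)) = (if \<alpha> = \<beta> then \<one>\<^bsub>B\<^esub> else \<zero>\<^bsub>B\<^esub>)"
    if "\<alpha> \<in> \<Delta>" "\<beta> \<in> \<Delta>" for \<alpha> \<beta>
  proof -
    have "(\<Oplus>\<^bsub>B\<^esub>\<xi>\<in>\<Xi>. U \<alpha> \<xi> \<otimes>\<^bsub>B\<^esub> V (\<xi>, \<beta>)) = (\<Oplus>\<^bsub>B\<^esub>\<xi>\<in>\<Xi>. ?U (\<alpha>, \<xi>) \<otimes>\<^bsub>B\<^esub> V (\<xi>, \<beta>))"
      using that Uc Vc U_sub by (intro finsum_cong') auto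
    then show ?thesis using V that by simp
  qed
  have VU: "(\<Oplus>\<^bsub>B\<^esub>\<beta>\<in>\<Delta>. V (\<xi>, \<beta>) \<otimes>\<^bsub>B\<^esub> U \<beta> \<eta>) = (if \<xi> = \<eta> then \<one>\<^bsub>B\<^esub> else \<zero>\<^bsub>B\<^esub>)"
    if "\<xi> \<in> \<Xi>" "\<eta> \<in> \<Xi>" for \<xi> \<eta>
  proof -
    have "(\<Oplus>\<^bsub>B\<^esub>\<beta>\<in>\<Delta>. V (\<xi>, \<beta>) \<otimes>\<^bsub>B\<^esub> U \<beta> \<eta>) = (\<Oplus>\<^bsub>B\<^esub>\<beta>\<in>\<Delta>. V (\<xi>, \<beta>) \<otimes>\<^bsub>B\<^esub> ?U (\<beta>, \<eta>))"
      using that Uc Vc U_sub by (intro finsum_cong') auto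
    then show ?thesis using V that by simp
  qed
  let ?T = "\<lambda>\<alpha> \<beta>. \<Oplus>\<^bsub>B\<^esub>\<xi>\<in>\<Xi>. U \<alpha> \<xi> \<otimes>\<^bsub>B\<^esub> V (\<xi>, \<beta>)"
  have T: "nf_matrix \<Delta> ?T"
    using nf_matrix_mult_inverse[OF \<Delta>(2) \<Xi>(1) U(1), of "\<lambda>\<xi> \<beta>. V (\<xi>, \<beta>)"] Vc UV VU by simp
  show "I \<in> hilb \<Delta> B" by (rule nf_matrix_hilb[OF mpoly_ideal_axioms \<Delta>(2) T])
  have coord: "coord_matrix B Q \<Delta> I = (\<lambda>ij\<in>Q \<times> \<Delta>. ?T (fst ij) (snd ij))"
    by (rule coord_matrix_eq[OF \<Delta>(2) T])
  show "coord_matrix B Q \<Delta> I = mat_mult B Q \<Xi> \<Delta> (coord_matrix B Q \<Xi> I) (mat_inv B \<Delta> \<Xi> ?U)"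
    unfolding coord mat_mult_def V_def[symmetric]
  proof (rule restrict_ext)
    fix ij assume "ij \<in> Q \<times> \<Delta>"
    then show "?T (fst ij) (snd ij) =
        (\<Oplus>\<^bsub>B\<^esub>q\<in>\<Xi>. coord_matrix B Q \<Xi> I (fst ij, q) \<otimes>\<^bsub>B\<^esub> V (q, snd ij))"
      using Uc Vc by (intro finsum_cong') (auto simp: U(2))
  qed
  show "submat \<Xi> \<Delta> (coord_matrix B Q \<Delta> I) = mat_inv B \<Delta> \<Xi> ?U"
    unfolding V_def[symmetric]
  proof (rule PiE_ext)
    show "submat \<Xi> \<Delta> (coord_matrix B Q \<Delta> I) \<in> \<Xi> \<times> \<Delta> \<rightarrow>\<^sub>E carrier B"
      using coord_matrix_closed[OF B \<Delta>(2) \<open>I \<in> hilb \<Delta> B\<close>] \<Xi>(2) by (rule submat_closed)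
    show "V \<in> \<Xi> \<times> \<Delta> \<rightarrow>\<^sub>E carrier B" using V by blast
    fix ij assume "ij \<in> \<Xi> \<times> \<Delta>"
    then obtain \<xi> \<beta> where ij: "ij = (\<xi>, \<beta>)" "\<xi> \<in> \<Xi>" "\<beta> \<in> \<Delta>" by auto
    then have "submat \<Xi> \<Delta> (coord_matrix B Q \<Delta> I) ij = ?T \<xi> \<beta>"
      using \<Xi>(2) by (auto simp: submat_def coord)
    \<comment> \<open>Row \<xi> of \<open>U\<close> is a unit vector because \<xi> belongs to the
      basis \<Xi>; hence the square block of \<open>T\<close> is the inverse itself.\<close>
    also have "\<dots> = U \<xi> \<xi> \<otimes>\<^bsub>B\<^esub> V (\<xi>, \<beta>)"
      using \<Xi>(1) ij Uc Vc nf_matrix_diag[OF U(1)] by (intro finsum_single) auto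
    also have "\<dots> = V (\<xi>, \<beta>)" using nf_matrix_diag[OF U(1)] ij Vc by simp
    finally show "submat \<Xi> \<Delta> (coord_matrix B Q \<Delta> I) ij = V ij" using ij by simp
  qed
qed

text \<open>Both products are instances of \<open>nf_matrix_change\<close>, read at rows where the
  resulting coordinate matrix is the identity.\<close>

lemma is_mat_inv_coord_matrices:
  assumes B: "cring B" and I: "I \<in> hilb \<Delta> B" "I \<in> hilb \<Xi> B"
  shows "is_mat_inv B \<Xi> \<Delta> (submat \<Xi> \<Delta> (coord_matrix B Q \<Delta> I)) (submat \<Delta> \<Xi> (coord_matrix B Q \<Xi> I))"
proof -
  interpret mpoly_ideal B I using B I(1) by (rule hilb_mpoly_ideal)
  obtain T where T: "nf_matrix \<Delta> T" "coord_matrix B Q \<Delta> I = (\<lambda>ij\<in>Q \<times> \<Delta>. T (fst ij) (snd ij))"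
    using hilb_nf_matrix[OF B \<Delta>(2) I(1)] by metis
  obtain U where U: "nf_matrix \<Xi> U" "coord_matrix B Q \<Xi> I = (\<lambda>ij\<in>Q \<times> \<Xi>. U (fst ij) (snd ij))"
    using hilb_nf_matrix[OF B \<Xi>(1) I(2)] by metis
  note Tc = nf_matrix_carrier[OF T(1)] and Uc = nf_matrix_carrier[OF U(1)]
  have Ts: "submat \<Xi> \<Delta> (coord_matrix B Q \<Delta> I) (\<xi>, \<beta>) = T \<xi> \<beta>" if "\<xi> \<in> \<Xi>" "\<beta> \<in> \<Delta>" for \<xi> \<beta>
    using that \<Xi>(2) by (auto simp: submat_def T(2))
  have Us: "submat \<Delta> \<Xi> (coord_matrix B Q \<Xi> I) (\<beta>, \<xi>) = U \<beta> \<xi>" if "\<xi> \<in> \<Xi>" "\<beta> \<in> \<Delta>" for \<xi> \<beta>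
    using that \<Delta>Q by (auto simp: submat_def U(2))
  show ?thesis
    unfolding is_mat_inv_iff[OF B]
  proof (intro conjI ballI)
    show "submat \<Xi> \<Delta> (coord_matrix B Q \<Delta> I) \<in> \<Xi> \<times> \<Delta> \<rightarrow>\<^sub>E carrier B"
      using coord_matrix_closed[OF B \<Delta>(2) I(1)] \<Xi>(2) by (rule submat_closed)
    show "submat \<Delta> \<Xi> (coord_matrix B Q \<Xi> I) \<in> \<Delta> \<times> \<Xi> \<rightarrow>\<^sub>E carrier B"
      using coord_matrix_closed[OF B \<Xi>(1) I(2)] \<Delta>Q(1) by (rule submat_closed)
  next
    fix \<xi> \<eta> assume *: "\<xi> \<in> \<Xi>" "\<eta> \<in> \<Xi>"
    have "(\<Oplus>\<^bsub>B\<^esub>q\<in>\<Delta>. submat \<Xi> \<Delta> (coord_matrix B Q \<Delta> I) (\<xi>, q) \<otimes>\<^bsub>B\<^esub>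
          submat \<Delta> \<Xi> (coord_matrix B Q \<Xi> I) (q, \<eta>)) = (\<Oplus>\<^bsub>B\<^esub>q\<in>\<Delta>. T \<xi> q \<otimes>\<^bsub>B\<^esub> U q \<eta>)"
      using * Tc Uc Ts Us by (intro finsum_cong') auto
    also have "\<dots> = U \<xi> \<eta>" by (rule nf_matrix_change[OF \<Delta>(2) T(1) \<Xi>(1) U(1) *(2), symmetric])
    finally show "(\<Oplus>\<^bsub>B\<^esub>q\<in>\<Delta>. submat \<Xi> \<Delta> (coord_matrix B Q \<Delta> I) (\<xi>, q) \<otimes>\<^bsub>B\<^esub>
          submat \<Delta> \<Xi> (coord_matrix B Q \<Xi> I) (q, \<eta>)) = (if \<xi> = \<eta> then \<one>\<^bsub>B\<^esub> else \<zero>\<^bsub>B\<^esub>)"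
      using nf_matrix_diag[OF U(1)] * by simp
  next
    fix \<alpha> \<beta> assume *: "\<alpha> \<in> \<Delta>" "\<beta> \<in> \<Delta>"
    have "(\<Oplus>\<^bsub>B\<^esub>q\<in>\<Xi>. submat \<Delta> \<Xi> (coord_matrix B Q \<Xi> I) (\<alpha>, q) \<otimes>\<^bsub>B\<^esub>
          submat \<Xi> \<Delta> (coord_matrix B Q \<Delta> I) (q, \<beta>)) = (\<Oplus>\<^bsub>B\<^esub>q\<in>\<Xi>. U \<alpha> q \<otimes>\<^bsub>B\<^esub> T q \<beta>)"
      using * Tc Uc Ts Us by (intro finsum_cong') auto
    also have "\<dots> = T \<alpha> \<beta>" by (rule nf_matrix_change[OF \<Xi>(1) U(1) \<Delta>(2) T(1) *(2), symmetric])
    finally show "(\<Oplus>\<^bsub>B\<^esub>q\<in>\<Xi>. submat \<Delta> \<Xi> (coord_matrix B Q \<Xi> I) (\<alpha>, q) \<otimes>\<^bsub>B\<^esub>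
          submat \<Xi> \<Delta> (coord_matrix B Q \<Delta> I) (q, \<beta>)) = (if \<alpha> = \<beta> then \<one>\<^bsub>B\<^esub> else \<zero>\<^bsub>B\<^esub>)"
      using nf_matrix_diag[OF T(1)] * by simp
  qed
qed

text \<open>The basis property is not part of \<open>hilb_prec\<close> and comes from
  \<open>monic_basis\<close>. Conversely, triangularity on the rows in \<open>Q\<close> extends to
  all rows, as \<open>Q\<close> contains \<Delta> and its border. Over the zero ring
  \<open>hilb_prec\<close> admits the only ideal and all matrix entries vanish.\<close>

lemma hilb_prec_iff:
  assumes B: "cring B"
  shows "I \<in> hilb_prec prec \<Delta> B \<longleftrightarrow>
    I \<in> hilb \<Delta> B \<and> lower_triangular prec B Q \<Delta> (coord_matrix B Q \<Delta> I)"
proof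
  assume I: "I \<in> hilb_prec prec \<Delta> B"
  then interpret mpoly_ideal B I using B by (simp add: hilb_prec_def mpoly_idealI)
  have nz: "\<one>\<^bsub>B\<^esub> = \<zero>\<^bsub>B\<^esub> \<longleftrightarrow> carrier B = {\<zero>\<^bsub>B\<^esub>}" using carrier_one_zero by simp
  have hilb: "I \<in> hilb \<Delta> B"
  proof (cases "carrier B = {\<zero>\<^bsub>B\<^esub>}")
    case True
    then show ?thesis by (intro hilb_zero_ring mpoly_ideal_axioms \<Delta>)
  next
    case False
    then show ?thesis
      using I monic_basis[OF \<Delta>(2) prec] nz ideal by (simp add: hilb_prec_def hilb_def)
  qed
  obtain T where T: "nf_matrix \<Delta> T" "coord_matrix B Q \<Delta> I = (\<lambda>ij\<in>Q \<times> \<Delta>. T (fst ij) (snd ij))"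
    using hilb_nf_matrix[OF B \<Delta>(2) hilb] by metis
  have "T \<alpha> \<beta> = \<zero>\<^bsub>B\<^esub>" if "\<beta> \<in> \<Delta>" "prec \<alpha> \<beta>" for \<alpha> \<beta>
  proof (cases "carrier B = {\<zero>\<^bsub>B\<^esub>}")
    case True
    then show ?thesis using nf_matrix_carrier[OF T(1) that(1)] by blast
  next
    case False
    then show ?thesis
      using I triangular_if_attached[OF \<Delta>(2) T(1) prec _ that] by (simp add: hilb_prec_def)
  qed
  then show "I \<in> hilb \<Delta> B \<and> lower_triangular prec B Q \<Delta> (coord_matrix B Q \<Delta> I)"
    using hilb by (auto simp: lower_triangular_def T(2))
next
  assume I: "I \<in> hilb \<Delta> B \<and> lower_triangular prec B Q \<Delta> (coord_matrix B Q \<Delta> I)"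
  then interpret mpoly_ideal B I using B by (intro hilb_mpoly_ideal) auto
  obtain T where T: "nf_matrix \<Delta> T" "coord_matrix B Q \<Delta> I = (\<lambda>ij\<in>Q \<times> \<Delta>. T (fst ij) (snd ij))"
    using hilb_nf_matrix[OF B \<Delta>(2)] I by metis
  have tri: "T \<alpha> \<beta> = \<zero>\<^bsub>B\<^esub>" if "\<alpha> \<in> Q" "\<beta> \<in> \<Delta>" "prec \<alpha> \<beta>" for \<alpha> \<beta>
    using I that by (auto simp: lower_triangular_def T(2))
  have tri: "T \<alpha> \<beta> = \<zero>\<^bsub>B\<^esub>" if "\<beta> \<in> \<Delta>" "prec \<alpha> \<beta>" for \<alpha> \<beta>
    using \<Delta>Q tri by (intro triangular_everywhere[OF \<Delta>(2,1,3) T(1) prec _ that]) blast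
  have nz: "\<one>\<^bsub>B\<^esub> = \<zero>\<^bsub>B\<^esub> \<longleftrightarrow> carrier B = {\<zero>\<^bsub>B\<^esub>}" using carrier_one_zero by simp
  show "I \<in> hilb_prec prec \<Delta> B"
    using monic_if_triangular[OF \<Delta>(2) T(1) prec tri] nz ideal by (auto simp: hilb_prec_def)
qed

text \<open>The second description uses data of the \<Xi>-point alone, as a subscheme of the
  \<Xi>-chart requires. For such a point, invertibility of the square block is equivalent to
  \<Delta> being a basis.\<close>

lemma intersection_eq:
  assumes B: "cring B"
  shows "hilb_prec prec \<Delta> B \<inter> hilb \<Xi> B =
          {I \<in> hilb \<Delta> B \<inter> hilb \<Xi> B.
             is_mat_inv B \<Xi> \<Delta> (submat \<Xi> \<Delta> (coord_matrix B Q \<Delta> I))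
               (submat \<Delta> \<Xi> (coord_matrix B Q \<Xi> I)) \<and>
             lower_triangular prec B Q \<Delta> (coord_matrix B Q \<Delta> I)}" (is ?A)
    and "hilb_prec prec \<Delta> B \<inter> hilb \<Xi> B =
          {I \<in> hilb \<Xi> B.
             mat_invertible B \<Delta> \<Xi> (submat \<Delta> \<Xi> (coord_matrix B Q \<Xi> I)) \<and>
             lower_triangular prec B Q \<Delta>
               (mat_mult B Q \<Xi> \<Delta> (coord_matrix B Q \<Xi> I)
                  (mat_inv B \<Delta> \<Xi> (submat \<Delta> \<Xi> (coord_matrix B Q \<Xi> I))))}" (is ?B)
proof -
  show ?A using hilb_prec_iff[OF B] is_mat_inv_coord_matrices[OF B] by blast
  have inv: "mat_invertible B \<Delta> \<Xi> (submat \<Delta> \<Xi> (coord_matrix B Q \<Xi> I)) \<longleftrightarrow> I \<in> hilb \<Delta> B"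
    if "I \<in> hilb \<Xi> B" for I
    using hilb_if_invertible(1)[OF B that] is_mat_inv_coord_matrices[OF B _ that]
    unfolding mat_invertible_def is_mat_inv_sym[of B \<Delta>] by blast
  show ?B
  proof (rule Set.set_eqI)
    fix I
    show "I \<in> hilb_prec prec \<Delta> B \<inter> hilb \<Xi> B \<longleftrightarrow> I \<in> {I \<in> hilb \<Xi> B.
             mat_invertible B \<Delta> \<Xi> (submat \<Delta> \<Xi> (coord_matrix B Q \<Xi> I)) \<and>
             lower_triangular prec B Q \<Delta>
               (mat_mult B Q \<Xi> \<Delta> (coord_matrix B Q \<Xi> I)
                  (mat_inv B \<Delta> \<Xi> (submat \<Delta> \<Xi> (coord_matrix B Q \<Xi> I))))}"
    proof (cases "I \<in> hilb \<Xi> B \<and> I \<in> hilb \<Delta> B")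
      case True
      then show ?thesis
        using hilb_if_invertible(2)[OF B] inv[of I] hilb_prec_iff[OF B, of I] by auto
    next
      case False
      then show ?thesis using inv[of I] hilb_prec_iff[OF B, of I] by blast
    qed
  qed
qed

end

section \<open>Representability\<close>

lemma k_homD:
  assumes "\<phi> \<in> k_hom k A a B b"
  shows "\<phi> \<in> ring_hom A B" "\<phi> \<in> extensional (carrier A)" "c \<in> carrier k \<Longrightarrow> \<phi> (a c) = b c"
  using assms unfolding k_hom_def by blast+

lemma restrict_k_hom:
  assumes A: "cring A" and "\<phi> \<in> ring_hom A B" "a \<in> ring_hom k A" "\<And>c. c \<in> carrier k \<Longrightarrow> \<phi> (a c) = b c"
  shows "restrict \<phi> (carrier A) \<in> k_hom k A a B b"
proof -
  interpret A: cring A by fact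
  have "restrict \<phi> (carrier A) \<in> ring_hom A B"
    using A.ring_hom_restrict[OF assms(2), of "restrict \<phi> (carrier A)"] by simp
  then show ?thesis using ring_hom_closed[OF assms(3)] assms(4) by (simp add: k_hom_def)
qed

text \<open>The tower from \<open>A\<close> through \<open>L\<close> to \<open>C\<close> reflects a
  locally closed subscheme: \<open>L\<close> inverts the determinant of the square block, and
  \<open>C\<close> imposes the triangularity equations. All three rings live on one type because
  \<open>L\<close> and \<open>C\<close> also serve as test algebras for the functor represented by
  \<open>A\<close>.\<close>

locale universal_data = standard_sets prec \<Delta> \<Xi> Q
  for prec :: "('n::finite) expo \<Rightarrow> 'n expo \<Rightarrow> bool" and \<Delta> \<Xi> Q +
  fixes k :: "'k ring" and A L C :: "'b ring" and a :: "'k \<Rightarrow> 'b" and \<I> :: "('n expo \<Rightarrow> 'b) set"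
    and \<sigma> :: "'n expo \<Rightarrow> 'n expo" and \<iota> \<pi> :: "'b \<Rightarrow> 'b" and f :: 'b
    and U T :: "'n expo \<times> 'n expo \<Rightarrow> 'b"
  assumes rep: "represents k A a \<I> (hilb \<Xi>)" and \<sigma>: "bij_betw \<sigma> \<Delta> \<Xi>"
    and f_def: "f = mat_det A \<Delta> \<sigma> (submat \<Delta> \<Xi> (coord_matrix A Q \<Xi> \<I>))"
    and loc: "localization_away A f L \<iota>"
    and U_def: "U = restrict (\<iota> \<circ> coord_matrix A Q \<Xi> \<I>) (Q \<times> \<Xi>)"
    and T_def: "T = mat_mult L Q \<Xi> \<Delta> U (mat_inv L \<Delta> \<Xi> (submat \<Delta> \<Xi> U))"
    and quot: "quotient_by L {T (\<alpha>, \<beta>) | \<alpha> \<beta>. \<alpha> \<in> Q \<and> \<beta> \<in> \<Delta> \<and> prec \<alpha> \<beta>} C \<pi>"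
begin

lemma A: "cring A" and a: "a \<in> ring_hom k A" and \<I>: "\<I> \<in> hilb \<Xi> A"
  using rep by (auto simp: represents_def k_algebra_def)

lemma L: "cring L" and \<iota>: "\<iota> \<in> ring_hom A L" and \<iota>f: "\<iota> f \<in> Units L"
  using loc by (auto simp: localization_away_def)

lemma C: "cring C" and \<pi>: "\<pi> \<in> ring_hom L C" and \<pi>_surj: "\<pi> ` carrier L = carrier C"
  using quot by (auto simp: quotient_by_def)

lemmas base_change_hilb = represents_base_change[OF rep]

lemma coord_base_change:
  fixes B :: "'b ring"
  assumes "cring B" "\<phi> \<in> ring_hom A B"
  shows "coord_matrix B Q \<Xi> (base_change B \<phi> \<I>) = restrict (\<phi> \<circ> coord_matrix A Q \<Xi> \<I>) (Q \<times> \<Xi>)"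
  by (rule coord_matrix_base_change[OF A assms \<Xi>(1) \<I> base_change_hilb[OF assms]])

text \<open>The image of \<open>f\<close> under \<phi> is the determinant of the square block at the
  point given by \<phi>, so localising at \<open>f\<close> is the universal way of making that block
  invertible.\<close>

lemma invertible_iff_unit:
  fixes B :: "'b ring"
  assumes B: "cring B" and \<phi>: "\<phi> \<in> ring_hom A B"
  shows "mat_invertible B \<Delta> \<Xi> (submat \<Delta> \<Xi> (coord_matrix B Q \<Xi> (base_change B \<phi> \<I>))) \<longleftrightarrow> \<phi> f \<in> Units B"
proof -
  interpret p: ring_hom_cring A B \<phi> using A B \<phi> by (rule ring_hom_cringI')
  let ?Y = "submat \<Delta> \<Xi> (coord_matrix B Q \<Xi> (base_change B \<phi> \<I>))"
  have X: "submat \<Delta> \<Xi> (coord_matrix A Q \<Xi> \<I>) \<in> \<Delta> \<times> \<Xi> \<rightarrow>\<^sub>E carrier A"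
    using coord_matrix_closed[OF A \<Xi>(1) \<I>] \<Delta>Q(1) by (rule submat_closed)
  have Y: "?Y \<in> \<Delta> \<times> \<Xi> \<rightarrow>\<^sub>E carrier B"
    using coord_matrix_closed[OF B \<Xi>(1) base_change_hilb[OF B \<phi>]] \<Delta>Q(1) by (rule submat_closed)
  have YX: "?Y ij = \<phi> (submat \<Delta> \<Xi> (coord_matrix A Q \<Xi> \<I>) ij)" if "ij \<in> \<Delta> \<times> \<Xi>" for ij
    using that \<Delta>Q(1) unfolding coord_base_change[OF B \<phi>] by (auto simp: submat_def)
  have "\<phi> f = mat_det B \<Delta> \<sigma> ?Y"
    unfolding f_def using X by (intro p.hom_mat_det[OF \<Delta>(2) \<sigma> _ YX]) auto
  then show ?thesis using mat_det_unit_iff[OF B \<Delta>(2) \<sigma> Y] by simp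
qed

lemma U_eq: "U = coord_matrix L Q \<Xi> (base_change L \<iota> \<I>)"
  unfolding U_def by (rule coord_base_change[OF L \<iota>, symmetric])

lemma U_invertible: "mat_invertible L \<Delta> \<Xi> (submat \<Delta> \<Xi> U)"
  unfolding U_eq using invertible_iff_unit[OF L \<iota>] \<iota>f by simp

text \<open>Applied to the tautological point over \<open>L\<close>: \<Delta> is a basis there, and
  \<open>T\<close> and its square block are given by the formulas of the theorem.\<close>

lemmas over_L = hilb_if_invertible[OF L base_change_hilb[OF L \<iota>] U_invertible[unfolded U_eq]]

lemma T_eq: "T = coord_matrix L Q \<Delta> (base_change L \<iota> \<I>)"
  unfolding T_def U_eq by (rule over_L(2)[symmetric])

text \<open>A point that factors through \<open>L\<close> already has \<Delta> as a basis, because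
  the determinant maps to a unit. Only triangularity remains, and it can be tested on the image of
  \<open>T\<close>, whose entries commute with base change.\<close>

lemma over_L_algebra:
  fixes B :: "'b ring"
  assumes B: "cring B" and \<psi>: "\<psi> \<in> ring_hom L B"
  shows "base_change B (\<psi> \<circ> \<iota>) \<I> \<in> hilb_prec prec \<Delta> B \<inter> hilb \<Xi> B \<longleftrightarrow>
    (\<forall>\<alpha>\<in>Q. \<forall>\<beta>\<in>\<Delta>. prec \<alpha> \<beta> \<longrightarrow> \<psi> (T (\<alpha>, \<beta>)) = \<zero>\<^bsub>B\<^esub>)"
proof -
  interpret p: ring_hom_cring L B \<psi> using L B \<psi> by (rule ring_hom_cringI')
  have \<psi>\<iota>: "\<psi> \<circ> \<iota> \<in> ring_hom A B" by (rule ring_hom_trans[OF \<iota> \<psi>])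
  let ?J = "base_change B (\<psi> \<circ> \<iota>) \<I>"
  have J: "?J \<in> hilb \<Xi> B" by (rule base_change_hilb[OF B \<psi>\<iota>])
  have "mat_invertible B \<Delta> \<Xi> (submat \<Delta> \<Xi> (coord_matrix B Q \<Xi> ?J))"
    using invertible_iff_unit[OF B \<psi>\<iota>] p.hom_Units[OF \<iota>f] by simp
  then have J\<Delta>: "?J \<in> hilb \<Delta> B" by (rule hilb_if_invertible(1)[OF B J])
  have comp: "base_change B \<psi> (base_change L \<iota> \<I>) = ?J"
    by (rule base_change_comp[OF A L B \<Xi>(1) \<iota> \<psi> \<I> base_change_hilb[OF L \<iota>] J])
  have "coord_matrix B Q \<Delta> ?J = restrict (\<psi> \<circ> T) (Q \<times> \<Delta>)"
    using coord_matrix_base_change[OF L B \<psi> \<Delta>(2) over_L(1)] J\<Delta> unfolding comp T_eq by blast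
  then show ?thesis
    using hilb_prec_iff[OF B, of ?J] J J\<Delta> by (auto simp: lower_triangular_def)
qed

text \<open>Maps out of \<open>C\<close> amount to maps out of \<open>A\<close> that make
  \<open>f\<close> a unit and then kill the triangularity equations. They are determined on
  \<open>A\<close>, as \<pi> is onto and maps from a localisation are determined by their values on
  \<open>A\<close>; existence is lifting first to \<open>L\<close> and then to
  \<open>C\<close>.\<close>

lemma represents_intersection:
  "represents k C (\<pi> \<circ> \<iota> \<circ> a) (base_change C (\<pi> \<circ> \<iota>) \<I>) (\<lambda>B. hilb_prec prec \<Delta> B \<inter> hilb \<Xi> B)"
  unfolding represents_def
proof (intro conjI allI impI)
  interpret A: cring A by (rule A)
  interpret L: cring L by (rule L)
  interpret C: cring C by (rule C)
  let ?E = "{T (\<alpha>, \<beta>) | \<alpha> \<beta>. \<alpha> \<in> Q \<and> \<beta> \<in> \<Delta> \<and> prec \<alpha> \<beta>}"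
  have \<pi>\<iota>: "\<pi> \<circ> \<iota> \<in> ring_hom A C" by (rule ring_hom_trans[OF \<iota> \<pi>])
  show "k_algebra k C (\<pi> \<circ> \<iota> \<circ> a)"
    using C ring_hom_trans[OF a \<pi>\<iota>] by (simp add: k_algebra_def)
  have \<pi>T: "\<pi> (T (\<alpha>, \<beta>)) = \<zero>\<^bsub>C\<^esub>" if "\<alpha> \<in> Q" "\<beta> \<in> \<Delta>" "prec \<alpha> \<beta>" for \<alpha> \<beta>
  proof -
    have "T (\<alpha>, \<beta>) \<in> a_kernel L C \<pi>"
      using quot that L.genideal_self[of ?E] unfolding quotient_by_def by blast
    then show ?thesis by (simp add: a_kernel_def')
  qed
  show mem: "base_change C (\<pi> \<circ> \<iota>) \<I> \<in> hilb_prec prec \<Delta> C \<inter> hilb \<Xi> C"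
    unfolding over_L_algebra[OF C \<pi>] using \<pi>T by blast
  fix B :: "'b ring" and b assume B_alg: "k_algebra k B b"
  then have B: "cring B" by (simp add: k_algebra_def)
  interpret B: cring B by (rule B)
  have bij_A: "bij_betw (\<lambda>\<phi>. base_change B \<phi> \<I>) (k_hom k A a B b) (hilb \<Xi> B)"
    using rep B_alg unfolding represents_def by blast
  have \<I>c: "g \<in> carrier (mpoly A)" if "g \<in> \<I>" for g
    using mpoly_ideal.ideal_carrier[OF hilb_mpoly_ideal[OF A \<I>] that] .
  have comp: "base_change B \<phi> (base_change C (\<pi> \<circ> \<iota>) \<I>) = base_change B ((\<phi> \<circ> \<pi>) \<circ> \<iota>) \<I>"
    if "\<phi> \<in> ring_hom C B" for \<phi>
    using base_change_comp[OF A C B \<Xi>(1) \<pi>\<iota> that \<I> base_change_hilb[OF C \<pi>\<iota>]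
        base_change_hilb[OF B ring_hom_trans[OF \<pi>\<iota> that]]] by (simp add: comp_assoc)
  have restr: "restrict ((\<phi> \<circ> \<pi>) \<circ> \<iota>) (carrier A) \<in> k_hom k A a B b"
    if "\<phi> \<in> k_hom k C (\<pi> \<circ> \<iota> \<circ> a) B b" for \<phi>
    using k_homD[OF that] ring_hom_trans[OF \<pi>\<iota>, of \<phi> B] a
    by (intro restrict_k_hom[OF A]) (auto simp: comp_assoc)
  have restr_bc: "base_change B (restrict \<phi> (carrier A)) \<I> = base_change B \<phi> \<I>" for \<phi>
    using \<I>c by (intro base_change_cong) auto
  show "bij_betw (\<lambda>\<phi>. base_change B \<phi> (base_change C (\<pi> \<circ> \<iota>) \<I>))
      (k_hom k C (\<pi> \<circ> \<iota> \<circ> a) B b) (hilb_prec prec \<Delta> B \<inter> hilb \<Xi> B)"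
    unfolding bij_betw_def
  proof (intro conjI inj_onI equalityI subsetI)
    fix \<phi> \<phi>' assume \<phi>: "\<phi> \<in> k_hom k C (\<pi> \<circ> \<iota> \<circ> a) B b" and \<phi>': "\<phi>' \<in> k_hom k C (\<pi> \<circ> \<iota> \<circ> a) B b"
      and eq: "base_change B \<phi> (base_change C (\<pi> \<circ> \<iota>) \<I>) = base_change B \<phi>' (base_change C (\<pi> \<circ> \<iota>) \<I>)"
    note h = k_homD(1)[OF \<phi>] k_homD(1)[OF \<phi>']
    have "restrict ((\<phi> \<circ> \<pi>) \<circ> \<iota>) (carrier A) = restrict ((\<phi>' \<circ> \<pi>) \<circ> \<iota>) (carrier A)"
      using bij_A restr[OF \<phi>] restr[OF \<phi>'] eq
      by (intro inj_onD[OF bij_betw_imp_inj_on[OF bij_A]]) (simp_all add: restr_bc comp h)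
    then have "(\<phi> \<circ> \<pi>) (\<iota> x) = (\<phi>' \<circ> \<pi>) (\<iota> x)" if "x \<in> carrier A" for x
      using that by (auto dest: fun_cong[of _ _ x])
    then have "(\<phi> \<circ> \<pi>) y = (\<phi>' \<circ> \<pi>) y" if "y \<in> carrier L" for y
      using that by (rule localization_hom_eq[OF B loc ring_hom_trans[OF \<pi> h(1)] ring_hom_trans[OF \<pi> h(2)]])
    then have "\<phi> z = \<phi>' z" if "z \<in> carrier C" for z
      using that unfolding \<pi>_surj[symmetric] by auto
    then show "\<phi> = \<phi>'" by (intro extensionalityI[OF k_homD(2)[OF \<phi>] k_homD(2)[OF \<phi>']])
  next
    fix J assume "J \<in> (\<lambda>\<phi>. base_change B \<phi> (base_change C (\<pi> \<circ> \<iota>) \<I>)) ` k_hom k C (\<pi> \<circ> \<iota> \<circ> a) B b"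
    then obtain \<phi> where \<phi>: "\<phi> \<in> k_hom k C (\<pi> \<circ> \<iota> \<circ> a) B b"
      and J: "J = base_change B \<phi> (base_change C (\<pi> \<circ> \<iota>) \<I>)" by blast
    note h = k_homD(1)[OF \<phi>]
    interpret p: ring_hom_cring C B \<phi> using C B h by (rule ring_hom_cringI')
    show "J \<in> hilb_prec prec \<Delta> B \<inter> hilb \<Xi> B"
      unfolding J comp[OF h] over_L_algebra[OF B ring_hom_trans[OF \<pi> h]] using \<pi>T by simp
  next
    fix J assume J: "J \<in> hilb_prec prec \<Delta> B \<inter> hilb \<Xi> B"
    \<comment> \<open>As a \<Xi>-point, \<open>J\<close> comes from a map out of \<open>A\<close>.
      Membership in the other functor makes \<open>f\<close> a unit, and then gives the vanishing
      needed to pass to the quotient.\<close>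
    then obtain \<phi> where \<phi>: "\<phi> \<in> k_hom k A a B b" and J_eq: "J = base_change B \<phi> \<I>"
      using bij_A unfolding bij_betw_def by blast
    have "mat_invertible B \<Delta> \<Xi> (submat \<Delta> \<Xi> (coord_matrix B Q \<Xi> J))"
      using J unfolding intersection_eq(2)[OF B] by blast
    then have "\<phi> f \<in> Units B"
      unfolding J_eq invertible_iff_unit[OF B k_homD(1)[OF \<phi>]] .
    then obtain \<psi> where \<psi>: "\<psi> \<in> ring_hom L B" "\<And>x. x \<in> carrier A \<Longrightarrow> \<psi> (\<iota> x) = \<phi> x"
      using localization_lift[OF A B loc k_homD(1)[OF \<phi>]] by metis
    have J_\<psi>: "J = base_change B (\<psi> \<circ> \<iota>) \<I>"
      unfolding J_eq using \<I>c \<psi>(2) by (intro base_change_cong) auto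
    have "\<forall>\<alpha>\<in>Q. \<forall>\<beta>\<in>\<Delta>. prec \<alpha> \<beta> \<longrightarrow> \<psi> (T (\<alpha>, \<beta>)) = \<zero>\<^bsub>B\<^esub>"
      using J unfolding J_\<psi> over_L_algebra[OF B \<psi>(1)] .
    then have E: "\<psi> e = \<zero>\<^bsub>B\<^esub>" if "e \<in> ?E" for e using that by blast
    obtain \<theta> where \<theta>: "\<theta> \<in> ring_hom C B" "\<And>y. y \<in> carrier L \<Longrightarrow> \<theta> (\<pi> y) = \<psi> y"
      using quotient_lift[OF L B quot \<psi>(1) E] by blast
    have \<theta>\<iota>: "\<theta> (\<pi> (\<iota> x)) = \<phi> x" if "x \<in> carrier A" for x
      using that \<theta>(2) \<psi>(2) ring_hom_closed[OF \<iota>] by simp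
    let ?\<theta> = "restrict \<theta> (carrier C)"
    have k_hom: "?\<theta> \<in> k_hom k C (\<pi> \<circ> \<iota> \<circ> a) B b"
      using \<theta>(1) ring_hom_trans[OF a \<pi>\<iota>] k_homD(3)[OF \<phi>] \<theta>\<iota> ring_hom_closed[OF a]
      by (intro restrict_k_hom[OF C]) auto
    have "J = base_change B ((?\<theta> \<circ> \<pi>) \<circ> \<iota>) \<I>"
      unfolding J_eq using \<I>c \<theta>\<iota> ring_hom_closed[OF \<iota>] ring_hom_closed[OF \<pi>]
      by (intro base_change_cong) auto
    also have "\<dots> = base_change B ?\<theta> (base_change C (\<pi> \<circ> \<iota>) \<I>)"
      by (rule comp[OF k_homD(1)[OF k_hom], symmetric])
    finally show "J \<in> (\<lambda>\<phi>. base_change B \<phi> (base_change C (\<pi> \<circ> \<iota>) \<I>)) ` k_hom k C (\<pi> \<circ> \<iota> \<circ> a) B b"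
      using k_hom by blast
  qed
qed

end

text \<open>The first conjunct compares functors of points, the second speaks of schemes:
  \<open>A\<close> is any coordinate ring of the \<Xi>-chart, and \<open>L\<close> and
  \<open>C\<close> are any models of the localisation and the quotient, so nothing depends on how
  they are built. That \<open>C\<close> is the coordinate ring of the intersection is its last
  clause.\<close>

theorem corollary3:
  fixes k :: "'k ring"
    and prec :: "('n::finite) expo \<Rightarrow> 'n expo \<Rightarrow> bool"
    and \<Delta> \<Xi> N M P Q :: "'n expo set"
    and d :: nat
  assumes k: "cring k"
    and prec: "monomial_order prec"
    and \<Delta>: "standard_set \<Delta>" "finite \<Delta>" "card \<Delta> = d"
    and \<Xi>: "standard_set \<Xi>" "finite \<Xi>" "card \<Xi> = d"
    and d: "d \<ge> 1"
    and N: "standard_set N" "\<Delta> \<subseteq> N"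
    and M: "standard_set M" "\<Xi> \<subseteq> M"
    and P: "P = N \<union> M"
    and Q: "Q = P \<union> border P"
  shows
    "(\<forall>(B :: 'b ring) b. k_algebra k B b \<longrightarrow>
        hilb_prec prec \<Delta> B \<inter> hilb \<Xi> B =
          {I \<in> hilb \<Delta> B \<inter> hilb \<Xi> B.
             is_mat_inv B \<Xi> \<Delta> (submat \<Xi> \<Delta> (coord_matrix B Q \<Delta> I))
               (submat \<Delta> \<Xi> (coord_matrix B Q \<Xi> I)) \<and>
             lower_triangular prec B Q \<Delta> (coord_matrix B Q \<Delta> I)} \<and>
        hilb_prec prec \<Delta> B \<inter> hilb \<Xi> B =
          {I \<in> hilb \<Xi> B.
             mat_invertible B \<Delta> \<Xi> (submat \<Delta> \<Xi> (coord_matrix B Q \<Xi> I)) \<and>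
             lower_triangular prec B Q \<Delta>
               (mat_mult B Q \<Xi> \<Delta> (coord_matrix B Q \<Xi> I)
                  (mat_inv B \<Delta> \<Xi> (submat \<Delta> \<Xi> (coord_matrix B Q \<Xi> I))))} \<and>
        (\<forall>I \<in> hilb \<Xi> B.
           mat_invertible B \<Delta> \<Xi> (submat \<Delta> \<Xi> (coord_matrix B Q \<Xi> I)) \<longrightarrow>
           I \<in> hilb \<Delta> B \<and>
           coord_matrix B Q \<Delta> I =
             mat_mult B Q \<Xi> \<Delta> (coord_matrix B Q \<Xi> I)
               (mat_inv B \<Delta> \<Xi> (submat \<Delta> \<Xi> (coord_matrix B Q \<Xi> I))) \<and>
           submat \<Xi> \<Delta> (coord_matrix B Q \<Delta> I) =
             mat_inv B \<Delta> \<Xi> (submat \<Delta> \<Xi> (coord_matrix B Q \<Xi> I))))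
     \<and>
     (\<forall>(A :: 'b ring) a \<I> \<sigma> (L :: 'b ring) \<iota> (C :: 'b ring) \<pi> U T.
        represents k A a \<I> (hilb \<Xi>) \<and>
        bij_betw \<sigma> \<Delta> \<Xi> \<and>
        localization_away A (mat_det A \<Delta> \<sigma> (submat \<Delta> \<Xi> (coord_matrix A Q \<Xi> \<I>))) L \<iota> \<and>
        U = restrict (\<iota> \<circ> coord_matrix A Q \<Xi> \<I>) (Q \<times> \<Xi>) \<and>
        T = mat_mult L Q \<Xi> \<Delta> U (mat_inv L \<Delta> \<Xi> (submat \<Delta> \<Xi> U)) \<and>
        quotient_by L {T (\<alpha>, \<beta>) | \<alpha> \<beta>. \<alpha> \<in> Q \<and> \<beta> \<in> \<Delta> \<and> prec \<alpha> \<beta>} C \<pi> \<longrightarrow>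
        mat_invertible L \<Delta> \<Xi> (submat \<Delta> \<Xi> U) \<and>
        base_change L \<iota> \<I> \<in> hilb \<Delta> L \<and>
        T = coord_matrix L Q \<Delta> (base_change L \<iota> \<I>) \<and>
        submat \<Xi> \<Delta> T = mat_inv L \<Delta> \<Xi> (submat \<Delta> \<Xi> U) \<and>
        represents k C (\<pi> \<circ> \<iota> \<circ> a) (base_change C (\<pi> \<circ> \<iota>) \<I>)
          (\<lambda>B. hilb_prec prec \<Delta> B \<inter> hilb \<Xi> B))"
proof -
  interpret standard_sets prec \<Delta> \<Xi> Q
  proof
    show "\<Delta> \<noteq> {}" using \<Delta> d by auto
    \<comment> \<open>A neighbour of \<Delta> is a neighbour of the larger set \<open>P\<close>, so
      it lies in \<open>P\<close> or in the border of \<open>P\<close>.\<close>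
    show "border \<Delta> \<subseteq> Q" using N P Q by (auto simp: border_def)
  qed (use prec \<Delta> \<Xi> N M P Q in auto)
  show ?thesis (is "?points \<and> ?universal")
  proof
    show ?points
    proof (intro allI impI conjI ballI)
      fix B :: "'b ring" and b assume "k_algebra k B b"
      then have B: "cring B" by (simp add: k_algebra_def)
      note eqs = intersection_eq[OF B]
      show "hilb_prec prec \<Delta> B \<inter> hilb \<Xi> B =
          {I \<in> hilb \<Delta> B \<inter> hilb \<Xi> B.
             is_mat_inv B \<Xi> \<Delta> (submat \<Xi> \<Delta> (coord_matrix B Q \<Delta> I))
               (submat \<Delta> \<Xi> (coord_matrix B Q \<Xi> I)) \<and>
             lower_triangular prec B Q \<Delta> (coord_matrix B Q \<Delta> I)}" by (rule eqs)
      show "hilb_prec prec \<Delta> B \<inter> hilb \<Xi> B =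
          {I \<in> hilb \<Xi> B.
             mat_invertible B \<Delta> \<Xi> (submat \<Delta> \<Xi> (coord_matrix B Q \<Xi> I)) \<and>
             lower_triangular prec B Q \<Delta>
               (mat_mult B Q \<Xi> \<Delta> (coord_matrix B Q \<Xi> I)
                  (mat_inv B \<Delta> \<Xi> (submat \<Delta> \<Xi> (coord_matrix B Q \<Xi> I))))}" by (rule eqs)
    qed (auto simp: k_algebra_def intro: hilb_if_invertible)
    show ?universal
    proof (intro allI impI)
      fix A :: "'b ring" and a \<I> \<sigma> and L :: "'b ring" and \<iota> and C :: "'b ring" and \<pi> U T
      assume *: "represents k A a \<I> (hilb \<Xi>) \<and>
        bij_betw \<sigma> \<Delta> \<Xi> \<and>
        localization_away A (mat_det A \<Delta> \<sigma> (submat \<Delta> \<Xi> (coord_matrix A Q \<Xi> \<I>))) L \<iota> \<and>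
        U = restrict (\<iota> \<circ> coord_matrix A Q \<Xi> \<I>) (Q \<times> \<Xi>) \<and>
        T = mat_mult L Q \<Xi> \<Delta> U (mat_inv L \<Delta> \<Xi> (submat \<Delta> \<Xi> U)) \<and>
        quotient_by L {T (\<alpha>, \<beta>) | \<alpha> \<beta>. \<alpha> \<in> Q \<and> \<beta> \<in> \<Delta> \<and> prec \<alpha> \<beta>} C \<pi>"
      interpret universal_data prec \<Delta> \<Xi> Q k A L C a \<I> \<sigma> \<iota> \<pi>
        "mat_det A \<Delta> \<sigma> (submat \<Delta> \<Xi> (coord_matrix A Q \<Xi> \<I>))" U T
        by unfold_locales (use * in blast)+
      show "mat_invertible L \<Delta> \<Xi> (submat \<Delta> \<Xi> U) \<and>
        base_change L \<iota> \<I> \<in> hilb \<Delta> L \<and>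
        T = coord_matrix L Q \<Delta> (base_change L \<iota> \<I>) \<and>
        submat \<Xi> \<Delta> T = mat_inv L \<Delta> \<Xi> (submat \<Delta> \<Xi> U) \<and>
        represents k C (\<pi> \<circ> \<iota> \<circ> a) (base_change C (\<pi> \<circ> \<iota>) \<I>)
          (\<lambda>B. hilb_prec prec \<Delta> B \<inter> hilb \<Xi> B)"
        using U_invertible over_L(1) T_eq over_L(3)[folded T_eq U_eq] represents_intersection by blast
    qed
  qed
qed

end
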